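(* Let $\mathbf X$ and $Y$ be the state process and the CARMA process given by the state-space representation described in the context. Suppose that $\mathbb E L(1)=0$ and $\mathbb E|L(1)|^2=\sigma^2<\infty$, that $\mathbf X(0)$ is independent of $(L(t))_{t\ge 0}$, that all eigenvalues of $\mathbf A$ have strictly negative real parts, and that $\mathbf X(0)\stackrel{d}{=}\int_{-\infty}^0e^{-\mathbf Au}\mathbf e\,dL^*(u)$. Suppose that, for each $T>0$, the process $Y$ is observed at not necessarily equidistant (deterministic) points $0=x_0^{(T)}<x_1^{(T)}<\dots<x_{N(T)-1}^{(T)}=T$, let $h_{\max}(T):=\max_{j=0,\dots,N(T)-2}\left(x_{j+1}^{(T)}-x_j^{(T)}\right)$, and assume that $$\lim_{T\to\infty}N(T)h_{\max}^3(T)=0.$$ Let $\omega\in\mathbb R$ and let $\mathcal T_TY(\omega)$ be the trapezoidal approximation of the truncated Fourier transform on this grid (see context). Put $\Sigma=\frac{\sigma^2}2\left|\frac{b(i\omega)}{a(i\omega)}\right|^2I_{2\times2}$. If $\omega\ne0$, then as $T\to\infty$, $\left[\Re(\mathcal T_TY(\omega)),\Im(\mathcal T_TY(\omega))\right]^T$ converges in distribution to $\mathcal N(0,\Sigma)$, and $\Re(\mathcal T_TY(\omega))^2+\Im(\mathcal T_TY(\omega))^2$ converges in distribution to $\operatorname{Exp}\left(\sigma^2\left|\frac{b(i\omega)}{a(i\omega)}\right|^2\right)$. If $\omega=0$, then as $T\to\infty$, $\mathcal T_TY(0)$ converges in distribution to $\mathcal N\left(0,\left(\frac{b(0)}{a(0)}\right)^2\sigma^2\right)$,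 and (provided $b(0)\ne0$ and $\sigma^2>0$, so that the expression is defined) $\frac1{\sigma^2}\left|\frac{a(0)\mathcal T_TY(0)}{b(0)}\right|^2$ converges in distribution to the $\chi^2(1)$ distribution.
   Context: Let $p>q\ge 0$ be integers, $a(z)=z^p+a_1z^{p-1}+\dots+a_p$ and $b(z)=b_0+b_1z+\dots+b_{p-1}z^{p-1}$ polynomials with real coefficients, with $b_q\ne 0$ and $b_j=0$ for $q<j<p$. Let $\mathbf A\in\mathbb R^{p\times p}$ be the companion matrix $$\mathbf A=\begin{pmatrix}0&1&0&\cdots&0\\0&0&1&\cdots&0\\ \vdots&\vdots&\vdots&\ddots&\vdots\\0&0&0&\cdots&1\\-a_p&-a_{p-1}&-a_{p-2}&\cdots&-a_1\end{pmatrix}$$ (with $\mathbf A=-a_1$ if $p=1$), $\mathbf e=[0,\dots,0,1]^T\in\mathbb R^p$, $\mathbf b=[b_0,b_1,\dots,b_{p-1}]^T\in\mathbb R^p$. Let $(L(t))_{t\ge 0}$ be a one-dimensional (real-valued) Lévy process with $L(0)=0$ a.s., on a filtered probability space satisfying the usual hypotheses. Its two-sided extension is $L^*(t)=L(t)$ for $t\ge0$ and $L^*(t)=-\widetilde L((-t)-)$ for $t<0$, where $\widetilde L$ is an independent copy of $L$ and $\widetilde L(s-)$ denotes the left limit. State-space representation: the $\mathbb R^p$-valued process $\mathbf X$ solves $d\mathbf X(t)=\mathbf A\mathbf X(t)\,dt+\mathbf e\,dL(t)$, i.e. $\mathbf X(t)=e^{\mathbf At}\mathbf X(0)+\int_0^te^{\mathbf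 A(t-u)}\mathbf e\,dL(u)$ for $t\ge 0$, and the CARMA process is $Y(t)=\mathbf b^T\mathbf X(t)$. The truncated Fourier transform of $Y$ at frequency $\omega$ is $\frac1{\sqrt T}\int_0^TY(t)e^{-i\omega t}\,dt$. Its trapezoidal approximation on the grid $(x_j^{(T)})_{j=0,\dots,N(T)-1}$ (with $N(T)\ge2$ points) is $$\mathcal T_TY(\omega)=\mathcal T_T(Y)(\omega)=\frac1{\sqrt T}\sum_{j=0}^{N(T)-1}\alpha_j^{(N(T))}Y\left(x_j^{(T)}\right),$$ where, with $F(x)=e^{-i\omega x}$, $\alpha_0^{(N(T))}=\frac{x_1^{(T)}-x_0^{(T)}}2F(x_0^{(T)})$, $\alpha_{N(T)-1}^{(N(T))}=\frac{x_{N(T)-1}^{(T)}-x_{N(T)-2}^{(T)}}2F(x_{N(T)-1}^{(T)})$, and $\alpha_j^{(N(T))}=\frac{x_{j+1}^{(T)}-x_{j-1}^{(T)}}2F(x_j^{(T)})$ for $j=1,\dots,N(T)-2$. $\operatorname{Exp}(\lambda)$ denotes the exponential distribution with mean $\lambda$ (the point mass at $0$ if $\lambda=0$); $I_{2\times2}$ is the $2\times2$ identity matrix. *)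

theory Defs
  imports "HOL-Probability.Probability" "HOL-Computational_Algebra.Polynomial"
begin

section \<open>Companion matrix, eigenvalues, matrix exponential\<close>

text \<open>
  The dimension is \<open>p = CARD('n)\<close> for a finite linearly ordered index type \<open>'n\<close>; \<open>pos i\<close> is the
  zero-based position of the index \<open>i\<close>, so \<open>pos\<close> enumerates \<open>'n\<close> as \<open>0, \<dots>, p - 1\<close>.
\<close>

definition pos :: "'n::{finite,linorder} \<Rightarrow> nat" where
  "pos i = card {j. j < i}"

text \<open>For \<open>a(z) = z^p + a\<^sub>1 z^(p-1) + \<dots> + a\<^sub>p\<close> the entry \<open>-a\<^sub>(p-j)\<close> in column \<open>j\<close> (zero-based) of the
  last row is minus the coefficient of \<open>z^j\<close>.\<close>

definition companion_matrix :: "real poly \<Rightarrow> ((real, 'n::{finite,linorder}) vec, 'n) vec" where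
  "companion_matrix a = (\<chi> i j. if i = Max UNIV then - coeff a (pos j)
                                else if pos j = Suc (pos i) then 1 else 0)"

definition last_unit_vector :: "real^'n::{finite,linorder}" where
  "last_unit_vector = axis (Max UNIV) 1"

definition coeff_vector :: "real poly \<Rightarrow> real^'n::{finite,linorder}" where
  "coeff_vector b = (\<chi> i. coeff b (pos i))"

definition eigenvalue :: "complex^'n^'n \<Rightarrow> complex \<Rightarrow> bool" where
  "eigenvalue A l \<longleftrightarrow> (\<exists>v. v \<noteq> 0 \<and> A *v v = l *s v)"

text \<open>The type class multiplication on \<^typ>\<open>real^'n^'n\<close> is componentwise, so \<^const>\<open>exp\<close> is
  not available for matrices.\<close>

definition matrix_exp :: "real^'n^'n \<Rightarrow> real^'n^'n" where
  "matrix_exp A = (\<Sum>k. (1 / fact k) *\<^sub>R (((**) A) ^^ k) (mat 1))"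

section \<open>Convergence in probability and in distribution\<close>

definition converges_in_prob ::
  "'a measure \<Rightarrow> ('i \<Rightarrow> 'a \<Rightarrow> 'v::real_normed_vector) \<Rightarrow> ('a \<Rightarrow> 'v) \<Rightarrow> 'i filter \<Rightarrow> bool" where
  "converges_in_prob M Z Z' G \<longleftrightarrow>
     (\<forall>\<epsilon>>0. ((\<lambda>i. measure M {w \<in> space M. norm (Z i w - Z' w) > \<epsilon>}) \<longlongrightarrow> 0) G)"

text \<open>\<^const>\<open>weak_conv_m\<close> covers only sequences of measures on the real line; here the index is
  continuous time and the values may be vectors.\<close>

definition converges_in_distr ::
  "'a measure \<Rightarrow> ('i \<Rightarrow> 'a \<Rightarrow> 'v::topological_space) \<Rightarrow> 'v measure \<Rightarrow> 'i filter \<Rightarrow> bool" where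
  "converges_in_distr M Z \<mu> G \<longleftrightarrow>
     (\<forall>f :: 'v \<Rightarrow> real. continuous_on UNIV f \<longrightarrow> bounded (range f) \<longrightarrow>
        ((\<lambda>i. integral\<^sup>L (distr M borel (Z i)) f) \<longlongrightarrow> integral\<^sup>L \<mu> f) G)"

section \<open>Limit laws\<close>

text \<open>The second parameter is the variance. The density with standard deviation \<open>0\<close> is identically
  \<open>0\<close>, hence the case distinction.\<close>

definition normal_law :: "real \<Rightarrow> real \<Rightarrow> real measure" where
  "normal_law m v =
     (if v = 0 then return borel m else density lborel (\<lambda>x. ennreal (normal_density m (sqrt v) x)))"

text \<open>The law of \<open>m + C Z\<close> with \<open>C C\<^sup>T = S\<close> and \<open>Z\<close> a vector of independent standard normal
  variables; it does not depend on the choice of \<open>C\<close>, which exists iff \<open>S\<close> is symmetric and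
  positive semidefinite.\<close>

definition multivariate_normal_law :: "real^'n \<Rightarrow> real^'n^'n \<Rightarrow> (real^'n) measure" where
  "multivariate_normal_law m S =
     distr (\<Pi>\<^sub>M i\<in>(UNIV :: 'n set). std_normal_distribution) borel
       (\<lambda>z. m + (SOME C. C ** transpose C = S) *v (\<chi> i. z i))"

text \<open>The parameter is the mean, whereas that of \<^const>\<open>erlang_density\<close> is the rate.\<close>

definition exponential_law :: "real \<Rightarrow> real measure" where
  "exponential_law l =
     (if l = 0 then return borel 0 else density lborel (\<lambda>x. ennreal (exponential_density (1 / l) x)))"

definition chi_squared_law :: "nat \<Rightarrow> real measure" where
  "chi_squared_law k =
     distr (\<Pi>\<^sub>M i\<in>{..<k}. std_normal_distribution) borel (\<lambda>z. \<Sum>i<k. (z i)\<^sup>2)"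

section \<open>Levy processes\<close>

text \<open>Processes and filtrations are indexed by \<^typ>\<open>real\<close>; only times \<open>t \<ge> 0\<close> matter unless a process
  is said to be two-sided.\<close>

locale usual_filtered_prob_space = prob_space M + complete_measure M
  for M :: "'a measure" and F :: "real \<Rightarrow> 'a measure" +
  assumes subalg: "\<And>t. 0 \<le> t \<Longrightarrow> subalgebra M (F t)"
    and mono: "\<And>s t. 0 \<le> s \<Longrightarrow> s \<le> t \<Longrightarrow> sets (F s) \<subseteq> sets (F t)"
    and null: "null_sets M \<subseteq> sets (F 0)"
    and right_cont: "\<And>t. 0 \<le> t \<Longrightarrow> sets (F t) = (\<Inter>s\<in>{t<..}. sets (F s))"

definition cadlag :: "(real \<Rightarrow> real) \<Rightarrow> bool" where
  "cadlag f \<longleftrightarrow> (\<forall>t\<ge>0. continuous (at_right t) f) \<and> (\<forall>t>0. \<exists>l. (f \<longlongrightarrow> l) (at_left t))"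

locale levy_process = usual_filtered_prob_space M F
  for M :: "'a measure" and F :: "real \<Rightarrow> 'a measure" +
  fixes L :: "real \<Rightarrow> 'a \<Rightarrow> real"
  assumes adapted: "\<And>t. 0 \<le> t \<Longrightarrow> L t \<in> borel_measurable (F t)"
    and start: "AE w in M. L 0 w = 0"
    and indep_increments: "\<And>s t. 0 \<le> s \<Longrightarrow> s \<le> t \<Longrightarrow>
          indep_set (sets (F s)) (sets (vimage_algebra (space M) (\<lambda>w. L t w - L s w) borel))"
    and stationary_increments: "\<And>s t. 0 \<le> s \<Longrightarrow> s \<le> t \<Longrightarrow>
          distr M borel (\<lambda>w. L t w - L s w) = distr M borel (L (t - s))"
    and stochastically_continuous: "\<And>s. 0 \<le> s \<Longrightarrow> converges_in_prob M L (L s) (at s within {0..})"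
    and cadlag_paths: "AE w in M. cadlag (\<lambda>t. L t w)"

definition path_space :: "(real \<Rightarrow> real) measure" where
  "path_space = (\<Pi>\<^sub>M t\<in>{0..}. borel)"

definition path_map :: "(real \<Rightarrow> 'a \<Rightarrow> real) \<Rightarrow> 'a \<Rightarrow> real \<Rightarrow> real" where
  "path_map L w = (\<lambda>t\<in>{0..}. L t w)"

text \<open>\<^const>\<open>prob_space.indep_var\<close> requires both random variables to have the same type.\<close>

definition independent_rvs ::
  "'a measure \<Rightarrow> 'b measure \<Rightarrow> ('a \<Rightarrow> 'b) \<Rightarrow> 'c measure \<Rightarrow> ('a \<Rightarrow> 'c) \<Rightarrow> bool" where
  "independent_rvs M N f N' g \<longleftrightarrow>
     f \<in> measurable M N \<and> g \<in> measurable M N' \<and>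
     prob_space.indep_set M (sets (vimage_algebra (space M) f N))
       (sets (vimage_algebra (space M) g N'))"

definition independent_copy ::
  "'a measure \<Rightarrow> (real \<Rightarrow> 'a \<Rightarrow> real) \<Rightarrow> (real \<Rightarrow> 'a \<Rightarrow> real) \<Rightarrow> bool" where
  "independent_copy M L L' \<longleftrightarrow>
     independent_rvs M path_space (path_map L) path_space (path_map L') \<and>
     distr M path_space (path_map L') = distr M path_space (path_map L) \<and>
     (AE w in M. cadlag (\<lambda>t. L' t w))"

definition two_sided ::
  "(real \<Rightarrow> 'a \<Rightarrow> real) \<Rightarrow> (real \<Rightarrow> 'a \<Rightarrow> real) \<Rightarrow> real \<Rightarrow> 'a \<Rightarrow> real" where
  "two_sided L L' t w = (if 0 \<le> t then L t w else - Lim (at_left (- t)) (\<lambda>s. L' s w))"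

section \<open>Stochastic integrals of deterministic continuous functions\<close>

text \<open>A grid \<open>a = x\<^sub>0 < \<dots> < x\<^sub>n = b\<close>.\<close>

definition is_grid :: "real \<Rightarrow> real \<Rightarrow> nat \<Rightarrow> (nat \<Rightarrow> real) \<Rightarrow> bool" where
  "is_grid a b n x \<longleftrightarrow> x 0 = a \<and> x n = b \<and> (\<forall>i<n. x i < x (Suc i))"

text \<open>
  For a continuous deterministic integrand \<open>f\<close> and a semimartingale \<open>L\<close>, the Ito integral over
  \<open>(a, b]\<close> is the limit in probability of the left-endpoint Riemann sums along every sequence of
  partitions whose mesh tends to \<open>0\<close>. As it is determined only almost surely, it is
  introduced as a relation: \<open>Z\<close> is a version of the integral.
\<close>

definition has_stoch_integral ::
  "'a measure \<Rightarrow> (real \<Rightarrow> 'a \<Rightarrow> real) \<Rightarrow> (real \<Rightarrow> 'v::real_normed_vector) \<Rightarrow> real \<Rightarrow> real \<Rightarrow>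
     ('a \<Rightarrow> 'v) \<Rightarrow> bool" where
  "has_stoch_integral M L f a b Z \<longleftrightarrow>
     Z \<in> borel_measurable M \<and>
     (\<forall>n x. (\<forall>k. is_grid a b (n k) (x k)) \<longrightarrow>
        (\<forall>\<delta>>0. \<forall>\<^sub>F k in sequentially. \<forall>i<n k. x k (Suc i) - x k i < \<delta>) \<longrightarrow>
        converges_in_prob M
          (\<lambda>k w. \<Sum>i<n k. (L (x k (Suc i)) w - L (x k i) w) *\<^sub>R f (x k i)) Z sequentially)"

text \<open>The integral over \<open>(-\<infinity>, b]\<close>, as the limit in probability of the integrals over \<open>(s, b]\<close> for
  \<open>s \<rightarrow> -\<infinity>\<close>.\<close>

definition has_stoch_integral_minf ::
  "'a measure \<Rightarrow> (real \<Rightarrow> 'a \<Rightarrow> real) \<Rightarrow> (real \<Rightarrow> 'v::real_normed_vector) \<Rightarrow> real \<Rightarrow>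
     ('a \<Rightarrow> 'v) \<Rightarrow> bool" where
  "has_stoch_integral_minf M L f b Z \<longleftrightarrow>
     Z \<in> borel_measurable M \<and>
     (\<exists>I. (\<forall>s\<le>b. has_stoch_integral M L f s b (I s)) \<and> converges_in_prob M I Z at_bot)"

section \<open>CARMA processes and the trapezoidal approximation\<close>

text \<open>The integral is unique only up to null sets, so the variation-of-constants formula is required
  almost surely for each fixed \<open>t\<close>.\<close>

definition state_process ::
  "'a measure \<Rightarrow> (real \<Rightarrow> 'a \<Rightarrow> real) \<Rightarrow> real^'n^'n \<Rightarrow> real^'n \<Rightarrow> (real \<Rightarrow> 'a \<Rightarrow> real^'n) \<Rightarrow> bool" where
  "state_process M L A e X \<longleftrightarrow>
     (\<forall>t\<ge>0. X t \<in> borel_measurable M \<and>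
        (\<exists>Z. has_stoch_integral M L (\<lambda>u. matrix_exp ((t - u) *\<^sub>R A) *v e) 0 t Z \<and>
             (AE w in M. X t w = matrix_exp (t *\<^sub>R A) *v X 0 w + Z w)))"

definition trapezoid_weight :: "real \<Rightarrow> nat \<Rightarrow> (nat \<Rightarrow> real) \<Rightarrow> nat \<Rightarrow> complex" where
  "trapezoid_weight \<omega> N x j =
     complex_of_real
       (if j = 0 then (x 1 - x 0) / 2
        else if j = N - 1 then (x (N - 1) - x (N - 2)) / 2
        else (x (j + 1) - x (j - 1)) / 2)
     * exp (- (\<i> * complex_of_real \<omega> * complex_of_real (x j)))"

definition trapezoid_fourier ::
  "real \<Rightarrow> real \<Rightarrow> nat \<Rightarrow> (nat \<Rightarrow> real) \<Rightarrow> (real \<Rightarrow> 'a \<Rightarrow> real) \<Rightarrow> 'a \<Rightarrow> complex" where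
  "trapezoid_fourier \<omega> T N x Y w =
     complex_of_real (1 / sqrt T) * (\<Sum>j<N. trapezoid_weight \<omega> N x j * complex_of_real (Y (x j) w))"

definition h_max :: "nat \<Rightarrow> (nat \<Rightarrow> real) \<Rightarrow> real" where
  "h_max N x = Max ((\<lambda>j. x (j + 1) - x j) ` {0..N - 2})"

text \<open>\<open>b(i\<omega>) / a(i\<omega>)\<close>\<close>

definition transfer_function :: "real poly \<Rightarrow> real poly \<Rightarrow> real \<Rightarrow> complex" where
  "transfer_function a b \<omega> =
     poly (map_poly complex_of_real b) (\<i> * complex_of_real \<omega>)
     / poly (map_poly complex_of_real a) (\<i> * complex_of_real \<omega>)"

end

theory Submission
  imports Defs "HOL-Computational_Algebra.Fundamental_Theorem_Algebra"
begin

text \<open>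
  Inserting the variation-of-constants formula, the trapezoidal sum becomes a term in \<open>X(0)\<close>, which
  stays bounded in probability by exponential stability and vanishes after division by \<open>sqrt T\<close>, plus
  \<open>\<integral> G\<^sub>T(u) dL(u)\<close> over \<open>(0, T]\<close> with \<open>G\<^sub>T(u)\<close> the trapezoidal sum of the kernel \<open>g(x - u) e\<^sup>-\<^sup>i\<^sup>\<omega>\<^sup>x\<close>. As the
  Fourier transform of \<open>g\<close> at \<open>\<omega>\<close> is \<open>H = b(i\<omega>) / a(i\<omega>)\<close>, one has
  \<open>G\<^sub>T(u) = H e\<^sup>-\<^sup>i\<^sup>\<omega>\<^sup>u + O(h + exp (- \<mu> (T - u)))\<close> with \<open>h\<close> the mesh.

  A Riemann sum of the integral over a sufficiently fine refinement of the grid is a sum of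
  independent increments. The characteristic function of \<open>L(t)\<close> at \<open>\<theta>\<close> is \<open>exp (t \<psi>(\<theta>))\<close> with
  \<open>\<psi>(\<theta>) = - \<sigma>\<^sup>2 \<theta>\<^sup>2 / 2 + o(\<theta>\<^sup>2)\<close>, so that of the sum involves only the sum of the squared weights times
  the lengths of the increments, which is a Riemann sum of \<open>(Re (\<zeta> H e\<^sup>-\<^sup>i\<^sup>\<omega>\<^sup>u))\<^sup>2 / T\<close>.
\<close>

section \<open>Multivariate characteristic functions\<close>

text \<open>The stochastic integral is available only as a limit in probability of left Riemann
  sums, separately for each end point. One refinement serves the integrals up to all grid points, so
  their Riemann sums share increments and can be interchanged with the trapezoidal sum. No rate of
  convergence is known, hence the refinement has to be chosen anew for every T, and every estimate
  must be independent of its number of cells. Infinite divisibility provides this: for small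
  \<theta> and d \<le> 1 an increment of length d has the exponent d \<psi>(\<theta>) exactly, so
  the errors of the quadratic expansion carry the factor d and add up. For the same reason the
  errors of the kernel sums are bounded by increments of bounded functions, which telescope. A first
  order bound for the trapezoidal rule is enough: the kernel, extended by zero, may jump at 0, and
  the one cell around the jump costs O(h) in any case. The limit is planar and the time index is
  continuous, so weak convergence is derived from characteristic functions together with tightness,
  which second moments supply.\<close>

inductive trigonometric :: "('v::euclidean_space \<Rightarrow> real) \<Rightarrow> bool" where
  cos: "trigonometric (\<lambda>z. cos (\<theta> \<bullet> z + c))"
| add: "trigonometric f \<Longrightarrow> trigonometric g \<Longrightarrow> trigonometric (\<lambda>z. f z + g z)"
| scale: "trigonometric f \<Longrightarrow> trigonometric (\<lambda>z. c * f z)"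

lemma trigonometric_const: "trigonometric (\<lambda>_::'v::euclidean_space. c)"
  using trigonometric.scale[OF trigonometric.cos[of "0::'v" 0], of c] by simp

lemma trigonometric_sum:
  "finite I \<Longrightarrow> (\<And>i. i \<in> I \<Longrightarrow> trigonometric (f i)) \<Longrightarrow> trigonometric (\<lambda>z. \<Sum>i\<in>I. f i z)"
  by (induction rule: finite_induct) (auto intro: trigonometric_const trigonometric.add)

lemma trigonometric_cos_mult: "trigonometric g \<Longrightarrow> trigonometric (\<lambda>z. cos (\<theta> \<bullet> z + c) * g z)"
proof (induction rule: trigonometric.induct)
  case (cos \<eta> d)
  have eq: "(\<lambda>z. cos (\<theta> \<bullet> z + c) * cos (\<eta> \<bullet> z + d)) =
      (\<lambda>z. 1/2 * cos ((\<theta> - \<eta>) \<bullet> z + (c - d)) + 1/2 * cos ((\<theta> + \<eta>) \<bullet> z + (c + d)))"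
    by (simp add: cos_times_cos inner_diff_left inner_add_left algebra_simps add_divide_distrib)
  show ?case unfolding eq by (intro trigonometric.intros)
next
  case (add f g)
  then show ?case by (simp add: distrib_left trigonometric.add)
next
  case (scale f d)
  then show ?case
    using trigonometric.scale[of "\<lambda>z. cos (\<theta> \<bullet> z + c) * f z" d] by (simp add: mult.left_commute)
qed

lemma trigonometric_mult: "trigonometric f \<Longrightarrow> trigonometric g \<Longrightarrow> trigonometric (\<lambda>z. f z * g z)"
proof (induction rule: trigonometric.induct)
  case (add f h)
  then show ?case by (simp add: distrib_right trigonometric.add)
next
  case (scale f d)
  then show ?case
    using trigonometric.scale[of "\<lambda>z. f z * g z" d] by (simp add: mult.assoc)
qed (rule trigonometric_cos_mult)

text \<open>The phase in the first rule of \<open>trigonometric\<close> serves this purpose: a sine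
  is a cosine shifted by \<open>pi / 2\<close>. Polynomials in the sines then stay in the span
  because products of cosines are sums of cosines.\<close>

lemma trigonometric_polynomial_of_sines:
  fixes p :: "'v::euclidean_space \<Rightarrow> real"
  assumes "real_polynomial_function p"
  shows "trigonometric (\<lambda>z. p (\<Sum>b\<in>Basis. (c * sin (r * (z \<bullet> b))) *\<^sub>R b))"
  using assms
proof (induction rule: real_polynomial_function.induct)
  case (linear f)
  interpret bounded_linear f by fact
  have eq: "(\<lambda>z. f (\<Sum>b\<in>Basis. (c * sin (r * (z \<bullet> b))) *\<^sub>R b)) =
      (\<lambda>z. \<Sum>b\<in>Basis. (c * f b) * cos ((r *\<^sub>R b) \<bullet> z + - (pi / 2)))"
    by (auto simp: sum scale cos_diff inner_commute mult.assoc mult.left_commute intro!: sum.cong)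
  show ?case unfolding eq
    by (intro trigonometric_sum trigonometric.scale trigonometric.cos finite_Basis)
next
  case (add f g)
  show ?case by (rule trigonometric.add) (fact add.IH)+
next
  case (mult f g)
  show ?case by (rule trigonometric_mult) (fact mult.IH)+
qed (rule trigonometric_const)

lemma trigonometric_bounded_measurable:
  assumes "trigonometric g"
  shows "g \<in> borel_measurable borel" and "\<exists>B. \<forall>z. \<bar>g z\<bar> \<le> B"
proof -
  have "continuous_on UNIV g \<and> (\<exists>B. \<forall>z. \<bar>g z\<bar> \<le> B)" using assms
  proof (induction rule: trigonometric.induct)
    case (cos \<theta> c)
    then show ?case by (auto intro!: continuous_intros exI[of _ 1])
  next
    case (add f g)
    then obtain B C where "\<And>z. \<bar>f z\<bar> \<le> B" "\<And>z. \<bar>g z\<bar> \<le> C" by blast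
    then have "\<bar>f z + g z\<bar> \<le> B + C" for z
      by (meson abs_triangle_ineq add_mono order_trans)
    with add show ?case by (auto intro!: continuous_intros)
  next
    case (scale f c)
    then obtain B where "\<And>z. \<bar>f z\<bar> \<le> B" by blast
    then have "\<bar>c * f z\<bar> \<le> \<bar>c\<bar> * B" for z
      by (simp add: abs_mult mult_left_mono)
    with scale show ?case by (auto intro!: continuous_intros)
  qed
  then show "g \<in> borel_measurable borel" "\<exists>B. \<forall>z. \<bar>g z\<bar> \<le> B"
    by (auto intro: borel_measurable_continuous_onI)
qed

lemma (in prob_space) integrable_bounded_comp:
  fixes g :: "'v::euclidean_space \<Rightarrow> real"
  assumes "g \<in> borel_measurable borel" "\<And>z. \<bar>g z\<bar> \<le> B" "Z \<in> borel_measurable M"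
  shows "integrable M (\<lambda>w. g (Z w))"
  by (rule integrable_const_bound[where B = B]) (use assms in auto)

text \<open>A shifted cosine is the real part of
  \<open>iexp c * iexp (\<theta> \<bullet> z)\<close>, so its expectation depends continuously on
  the characteristic function; the rest is linearity.\<close>

lemma trigonometric_expectation_tendsto:
  fixes Z :: "'i \<Rightarrow> 'a \<Rightarrow> 'v::euclidean_space"
  assumes M: "prob_space M" and \<mu>: "prob_space \<mu>" "sets \<mu> = sets borel"
    and meas: "\<forall>\<^sub>F i in G. Z i \<in> borel_measurable M"
    and char: "\<And>\<theta>. ((\<lambda>i. \<integral>w. iexp (\<theta> \<bullet> Z i w) \<partial>M) \<longlongrightarrow> (\<integral>z. iexp (\<theta> \<bullet> z) \<partial>\<mu>)) G"
    and g: "trigonometric g"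
  shows "((\<lambda>i. \<integral>w. g (Z i w) \<partial>M) \<longlongrightarrow> (\<integral>z. g z \<partial>\<mu>)) G"
  using g
proof (induction rule: trigonometric.induct)
  case (cos \<theta> c)
  have eq: "(\<integral>w. cos (\<theta> \<bullet> f w + c) \<partial>N) = Re (iexp c * (\<integral>w. iexp (\<theta> \<bullet> f w) \<partial>N))"
    if "prob_space N" "f \<in> borel_measurable N" for N and f :: "'b \<Rightarrow> 'v"
  proof -
    interpret prob_space N by fact
    have [measurable]: "f \<in> borel_measurable N" by fact
    have int: "integrable N (\<lambda>w. iexp (\<theta> \<bullet> f w))"
      by (rule integrable_iexp) auto
    have "(\<integral>w. cos (\<theta> \<bullet> f w + c) \<partial>N) = (\<integral>w. Re (iexp c * iexp (\<theta> \<bullet> f w)) \<partial>N)"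
      by (intro Bochner_Integration.integral_cong refl)
         (simp add: cis_conv_exp[symmetric] cos_add mult.commute)
    also have "\<dots> = Re (\<integral>w. iexp c * iexp (\<theta> \<bullet> f w) \<partial>N)"
      using int by (intro integral_Re) auto
    finally show ?thesis using int by simp
  qed
  have id: "(\<lambda>z. z) \<in> borel_measurable \<mu>" using \<mu>(2) by (simp add: measurable_ident_sets)
  have "((\<lambda>i. Re (iexp c * (\<integral>w. iexp (\<theta> \<bullet> Z i w) \<partial>M))) \<longlongrightarrow> Re (iexp c * (\<integral>z. iexp (\<theta> \<bullet> z) \<partial>\<mu>))) G"
    by (intro tendsto_intros char)
  then show ?case
    unfolding eq[OF \<mu>(1) id]
    by (rule Lim_transform_eventually) (use meas in eventually_elim, use eq[OF M] in auto)
next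
  case (add f g)
  have int: "integrable N (\<lambda>w. f (h w))" "integrable N (\<lambda>w. g (h w))"
    if "prob_space N" "h \<in> borel_measurable N" for N and h :: "'b \<Rightarrow> 'v"
    using prob_space.integrable_bounded_comp[OF that(1) _ _ that(2)] trigonometric_bounded_measurable add.hyps
    by metis+
  have id: "(\<lambda>z. z) \<in> borel_measurable \<mu>" using \<mu>(2) by (simp add: measurable_ident_sets)
  have "((\<lambda>i. (\<integral>w. f (Z i w) \<partial>M) + (\<integral>w. g (Z i w) \<partial>M)) \<longlongrightarrow> (\<integral>z. f z \<partial>\<mu>) + (\<integral>z. g z \<partial>\<mu>)) G"
    by (intro tendsto_add add.IH)
  also have "(\<integral>z. f z \<partial>\<mu>) + (\<integral>z. g z \<partial>\<mu>) = (\<integral>z. f z + g z \<partial>\<mu>)"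
    using int[OF \<mu>(1) id] by simp
  finally show ?case
    by (rule Lim_transform_eventually) (use meas in eventually_elim, use int[OF M] in auto)
next
  case (scale f c)
  then show ?case by (auto intro!: tendsto_intros)
qed

text \<open>\<open>D\<close> is the excess of the error outside the ball, paid only with the tail
  probability. The bound is applied to the converging variables and, with the identity as
  \<open>Z\<close>, to the limit law.\<close>

lemma (in prob_space) expectation_diff_le_tail:
  fixes f g :: "'v::euclidean_space \<Rightarrow> real"
  assumes Z[measurable]: "Z \<in> borel_measurable M"
    and f[measurable]: "f \<in> borel_measurable borel" "\<And>z. \<bar>f z\<bar> \<le> B"
    and g[measurable]: "g \<in> borel_measurable borel" "\<And>z. \<bar>g z\<bar> \<le> C"
    and in_ball: "\<And>z. norm z \<le> R \<Longrightarrow> \<bar>f z - g z\<bar> \<le> \<delta>"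
    and everywhere: "\<And>z. \<bar>f z - g z\<bar> \<le> \<delta> + D"
  shows "\<bar>(\<integral>w. f (Z w) \<partial>M) - (\<integral>w. g (Z w) \<partial>M)\<bar> \<le> \<delta> + D * prob {w \<in> space M. norm (Z w) > R}"
proof -
  have int: "integrable M (\<lambda>w. f (Z w))" "integrable M (\<lambda>w. g (Z w))"
    by (rule integrable_bounded_comp[OF f(1) f(2) Z] integrable_bounded_comp[OF g(1) g(2) Z])+
  have [measurable]: "{w \<in> space M. norm (Z w) > R} \<in> events" by measurable
  have "\<bar>(\<integral>w. f (Z w) \<partial>M) - (\<integral>w. g (Z w) \<partial>M)\<bar> = \<bar>\<integral>w. f (Z w) - g (Z w) \<partial>M\<bar>"
    using int by simp
  also have "\<dots> \<le> (\<integral>w. \<bar>f (Z w) - g (Z w)\<bar> \<partial>M)" by (rule integral_abs_bound)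
  also have "\<dots> \<le> (\<integral>w. \<delta> + D * indicator {w \<in> space M. norm (Z w) > R} w \<partial>M)"
  proof (rule integral_mono)
    show "integrable M (\<lambda>w. \<bar>f (Z w) - g (Z w)\<bar>)" using int by simp
    show "integrable M (\<lambda>w. \<delta> + D * indicator {w \<in> space M. norm (Z w) > R} w)"
      by (auto simp: integrable_real_indicator emeasure_eq_measure)
  qed (auto simp: indicator_def in_ball everywhere)
  also have "\<dots> = \<delta> + D * prob {w \<in> space M. norm (Z w) > R}"
    by (subst Bochner_Integration.integral_add) (auto simp: prob_space emeasure_eq_measure integrable_real_indicator)
  finally show ?thesis .
qed

lemma (in prob_space) norm_tail_tight:
  fixes Z :: "'a \<Rightarrow> 'v::euclidean_space"
  assumes [measurable]: "Z \<in> borel_measurable M" and "\<epsilon> > 0"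
  shows "\<exists>R0. \<forall>R\<ge>R0. prob {w \<in> space M. norm (Z w) > R} < \<epsilon>"
proof -
  define D where "D = distr M borel (\<lambda>w. norm (Z w))"
  interpret D: real_distribution D unfolding D_def by (rule real_distribution_distr) simp
  have "(cdf D \<longlongrightarrow> 1) at_top" by (rule D.cdf_lim_at_top_prob)
  then have "eventually (\<lambda>R. cdf D R > 1 - \<epsilon>) at_top"
    using \<open>\<epsilon> > 0\<close> by (intro order_tendstoD(1)[of _ 1]) auto
  then obtain R0 where R0: "\<And>R. R \<ge> R0 \<Longrightarrow> cdf D R > 1 - \<epsilon>"
    by (auto simp: eventually_at_top_linorder)
  have "prob {w \<in> space M. norm (Z w) > R} = 1 - cdf D R" for R
  proof -
    have "cdf D R = prob {w \<in> space M. norm (Z w) \<le> R}"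
      unfolding cdf_def D_def by (subst measure_distr) (auto intro!: arg_cong[where f = prob])
    moreover have "prob {w \<in> space M. norm (Z w) > R} = 1 - prob {w \<in> space M. norm (Z w) \<le> R}"
      by (subst prob_compl[symmetric]) (auto intro!: arg_cong[where f = prob])
    ultimately show ?thesis by simp
  qed
  with R0 have "prob {w \<in> space M. norm (Z w) > R} < \<epsilon>" if "R \<ge> R0" for R
    using that by (metis diff_less_eq less_diff_eq add.commute)
  then show ?thesis by blast
qed

text \<open>By Taylor's formula \<open>sin y\<close> differs from \<open>y\<close> by at most
  \<open>y\<^sup>2\<close>. Division by \<open>r\<close> leaves an error of order
  \<open>r * R\<^sup>2\<close> in each coordinate, while the rescaled sine is bounded by
  \<open>1 / r\<close> everywhere.\<close>

lemma sine_rescaling_close: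
  fixes z :: "'v::euclidean_space" and r R :: real
  assumes "r > 0" "norm z \<le> R"
  shows "norm ((\<Sum>b\<in>Basis. (1 / r * sin (r * (z \<bullet> b))) *\<^sub>R b) - z) \<le> DIM('v) * (r * R\<^sup>2)"
proof -
  have "(\<Sum>b\<in>Basis. (1 / r * sin (r * (z \<bullet> b))) *\<^sub>R b) - z =
      (\<Sum>b\<in>Basis. (1 / r * sin (r * (z \<bullet> b)) - z \<bullet> b) *\<^sub>R b)"
    by (subst (2) euclidean_representation[of z, symmetric])
       (simp add: sum_subtractf[symmetric] scaleR_diff_left)
  also have "norm \<dots> \<le> (\<Sum>b\<in>(Basis :: 'v set). r * R\<^sup>2)"
  proof (rule sum_norm_le)
    fix b :: 'v assume b: "b \<in> Basis"
    have "\<bar>sin (r * (z \<bullet> b)) - (\<Sum>m<2. sin_coeff m * (r * (z \<bullet> b)) ^ m)\<bar> \<le>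
        inverse (fact 2) * \<bar>r * (z \<bullet> b)\<bar> ^ 2"
      by (rule Maclaurin_sin_bound)
    then have "\<bar>sin (r * (z \<bullet> b)) - r * (z \<bullet> b)\<bar> \<le> (r * (z \<bullet> b))\<^sup>2 / 2"
      by (simp add: numeral_2_eq_2 sin_coeff_def)
    also have "\<dots> \<le> (r * (z \<bullet> b))\<^sup>2" by simp
    also have "\<dots> = r\<^sup>2 * (z \<bullet> b)\<^sup>2" by (rule power_mult_distrib)
    also have "\<dots> \<le> r\<^sup>2 * R\<^sup>2"
    proof (intro mult_left_mono)
      have "\<bar>z \<bullet> b\<bar> \<le> R" using Basis_le_norm[OF b, of z] assms(2) by linarith
      then show "(z \<bullet> b)\<^sup>2 \<le> R\<^sup>2" by (simp add: abs_le_square_iff[symmetric])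
    qed simp
    finally have "\<bar>sin (r * (z \<bullet> b)) - r * (z \<bullet> b)\<bar> / r \<le> r * R\<^sup>2"
      using assms(1) by (simp add: field_simps power2_eq_square)
    moreover have "1 / r * sin (r * (z \<bullet> b)) - z \<bullet> b = (sin (r * (z \<bullet> b)) - r * (z \<bullet> b)) / r"
      using assms(1) by (simp add: field_simps)
    ultimately show "norm ((1 / r * sin (r * (z \<bullet> b)) - z \<bullet> b) *\<^sub>R b) \<le> r * R\<^sup>2"
      using assms(1) b by simp
  qed
  finally show ?thesis by simp
qed

text \<open>A bounded continuous \<open>f\<close> is close on bounded sets to \<open>z \<mapsto> f (K sin (z / K))\<close> for large \<open>K\<close>, and
  this function is uniformly close on the whole space to a polynomial in the \<open>sin (z\<^sub>b / K)\<close>. No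
  control of the approximation at infinity is therefore needed besides tightness.\<close>

lemma converges_in_distr_char:
  fixes Z :: "'i \<Rightarrow> 'a \<Rightarrow> 'v::euclidean_space"
  assumes M: "prob_space M" and \<mu>: "prob_space \<mu>" "sets \<mu> = sets borel"
    and meas: "\<forall>\<^sub>F i in G. Z i \<in> borel_measurable M"
    and char: "\<And>\<theta>. ((\<lambda>i. \<integral>w. iexp (\<theta> \<bullet> Z i w) \<partial>M) \<longlongrightarrow> (\<integral>z. iexp (\<theta> \<bullet> z) \<partial>\<mu>)) G"
    and tight: "\<And>\<epsilon>. \<epsilon> > 0 \<Longrightarrow> \<exists>R. \<forall>\<^sub>F i in G. measure M {w \<in> space M. norm (Z i w) > R} < \<epsilon>"
  shows "converges_in_distr M Z \<mu> G"
  unfolding converges_in_distr_def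
proof (intro allI impI)
  fix f :: "'v \<Rightarrow> real" assume f: "continuous_on UNIV f" "bounded (range f)"
  have [measurable]: "f \<in> borel_measurable borel" using f(1) by (rule borel_measurable_continuous_onI)
  interpret M: prob_space M by fact
  interpret \<mu>: prob_space \<mu> by fact
  obtain B where B: "B > 0" "\<And>z. \<bar>f z\<bar> \<le> B"
    using f(2) unfolding bounded_pos by auto
  have id[measurable]: "(\<lambda>z. z) \<in> borel_measurable \<mu>" using \<mu>(2) by (simp add: measurable_ident_sets)
  show "((\<lambda>i. integral\<^sup>L (distr M borel (Z i)) f) \<longlongrightarrow> integral\<^sup>L \<mu> f) G"
  proof (rule tendstoI)
    fix \<epsilon> :: real assume \<epsilon>: "\<epsilon> > 0"
    \<comment> \<open>Each of the two tails then costs at most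
      \<open>2 * B * \<eta> = \<epsilon> / 8\<close>; all contributions at the end add up to less
      than \<open>7 / 8 * \<epsilon>\<close>.\<close>
    define \<eta> where "\<eta> = \<epsilon> / (16 * B)"
    have \<eta>: "\<eta> > 0" using \<epsilon> B(1) by (simp add: \<eta>_def)
    obtain R1 where R1: "\<forall>\<^sub>F i in G. measure M {w \<in> space M. norm (Z i w) > R1} < \<eta>"
      using tight[OF \<eta>] by blast
    obtain R2 where R2: "\<And>R. R \<ge> R2 \<Longrightarrow> measure \<mu> {z \<in> space \<mu>. norm z > R} < \<eta>"
      using \<mu>.norm_tail_tight[OF id \<eta>] by blast
    define R where "R = max 0 (max R1 R2)"
    have tailM: "\<forall>\<^sub>F i in G. measure M {w \<in> space M. norm (Z i w) > R} < \<eta>"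
      using R1 meas
    proof eventually_elim
      case (elim i)
      then have [measurable]: "Z i \<in> borel_measurable M" by simp
      have "measure M {w \<in> space M. norm (Z i w) > R} \<le> measure M {w \<in> space M. norm (Z i w) > R1}"
        by (rule M.finite_measure_mono) (auto simp: R_def)
      with elim show ?case by simp
    qed
    have tail\<mu>: "measure \<mu> {z \<in> space \<mu>. norm z > R} < \<eta>" by (rule R2) (simp add: R_def)
    have "uniformly_continuous_on (cball 0 (R + 1)) f"
      by (rule compact_uniformly_continuous[OF continuous_on_subset[OF f(1)]]) auto
    then obtain \<delta> where \<delta>: "\<delta> > 0"
      "\<And>y z. y \<in> cball 0 (R + 1) \<Longrightarrow> z \<in> cball 0 (R + 1) \<Longrightarrow> dist z y < \<delta> \<Longrightarrow> dist (f z) (f y) < \<epsilon> / 8"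
      unfolding uniformly_continuous_on_def using \<epsilon> by (metis zero_less_divide_iff zero_less_numeral)
    \<comment> \<open>The bound \<open>1\<close> keeps \<open>S z\<close> in the ball of radius
      \<open>R + 1\<close>, where \<open>f\<close> is uniformly continuous;
      \<open>\<delta> / 2\<close> leaves room for the strict inequality. Adding \<open>1\<close> to
      \<open>R\<^sup>2\<close> avoids division by zero for \<open>R = 0\<close>.\<close>
    define r where "r = min (\<delta> / 2) 1 / (DIM('v) * (R\<^sup>2 + 1))"
    have R21: "R\<^sup>2 + 1 > 0" by (simp add: add_nonneg_pos)
    then have r: "r > 0" using \<delta>(1) by (simp add: r_def)
    define S where "S z = (\<Sum>b\<in>Basis. (1 / r * sin (r * (z \<bullet> b))) *\<^sub>R b)" for z :: 'v
    have S_close: "norm (S z - z) \<le> min (\<delta> / 2) 1" if "norm z \<le> R" for z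
    proof -
      have "norm (S z - z) \<le> DIM('v) * (r * R\<^sup>2)"
        unfolding S_def by (rule sine_rescaling_close[OF r that])
      also have "\<dots> \<le> DIM('v) * (r * (R\<^sup>2 + 1))" using r by (intro mult_left_mono) auto
      also have "\<dots> = min (\<delta> / 2) 1" using R21 by (simp add: r_def)
      finally show ?thesis .
    qed
    have fS_close: "\<bar>f z - f (S z)\<bar> \<le> \<epsilon> / 8" if "norm z \<le> R" for z
    proof -
      have "norm (S z) \<le> R + 1"
        using S_close[OF that] norm_triangle_ineq[of "S z - z" z] that by simp
      then have "dist (f (S z)) (f z) < \<epsilon> / 8"
        using S_close[OF that] \<delta>(1) that by (intro \<delta>(2)) (auto simp: dist_norm)
      then show ?thesis by (simp add: dist_real_def abs_minus_commute)
    qed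
    \<comment> \<open>All values of \<open>S\<close> lie in this ball, so approximation on a compact
      set makes \<open>g\<close> close to \<open>f \<circ> S\<close> on the whole space.\<close>
    obtain p where p: "real_polynomial_function p"
      "\<And>y. y \<in> cball 0 (DIM('v) / r) \<Longrightarrow> \<bar>f y - p y\<bar> < \<epsilon> / 8"
      using Stone_Weierstrass_real_polynomial_function
        [OF compact_cball[of "0 :: 'v" "DIM('v) / r"] continuous_on_subset[OF f(1)], of "\<epsilon> / 8"] \<epsilon>
      by (metis divide_pos_pos subset_UNIV zero_less_numeral)
    define g where "g z = p (S z)" for z
    have trig: "trigonometric g"
      unfolding g_def[abs_def] S_def by (rule trigonometric_polynomial_of_sines[OF p(1)])
    have g_close: "\<bar>f (S z) - g z\<bar> \<le> \<epsilon> / 8" for z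
    proof -
      have "norm (S z) \<le> (\<Sum>b\<in>(Basis :: 'v set). 1 / r)"
        unfolding S_def using r by (intro sum_norm_le) (auto simp: abs_mult divide_right_mono)
      then show ?thesis unfolding g_def using p(2)[of "S z"] by simp
    qed
    have in_ball: "\<bar>f z - g z\<bar> \<le> \<epsilon> / 4" if "norm z \<le> R" for z
      using fS_close[OF that] g_close[of z] by linarith
    have everywhere: "\<bar>f z - g z\<bar> \<le> \<epsilon> / 4 + 2 * B" for z
      using g_close[of z] B(2)[of z] B(2)[of "S z"] \<epsilon> by linarith
    obtain C where C: "\<And>z. \<bar>g z\<bar> \<le> C" using trigonometric_bounded_measurable(2)[OF trig] by blast
    note [measurable] = trigonometric_bounded_measurable(1)[OF trig]
    have 2: "\<bar>(\<integral>z. f z \<partial>\<mu>) - (\<integral>z. g z \<partial>\<mu>)\<bar> \<le> \<epsilon> / 4 + 2 * B * measure \<mu> {z \<in> space \<mu>. norm z > R}"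
      by (rule \<mu>.expectation_diff_le_tail[OF id _ B(2) _ C in_ball everywhere]) auto
    have small: "2 * B * t < \<epsilon> / 8" if "t < \<eta>" for t
    proof -
      have "2 * B * t < 2 * B * \<eta>" using that B(1) by simp
      then show ?thesis using B(1) by (simp add: \<eta>_def)
    qed
    have "((\<lambda>i. \<integral>w. g (Z i w) \<partial>M) \<longlongrightarrow> (\<integral>z. g z \<partial>\<mu>)) G"
      by (rule trigonometric_expectation_tendsto[OF M \<mu> meas char trig])
    then have "\<forall>\<^sub>F i in G. dist (\<integral>w. g (Z i w) \<partial>M) (\<integral>z. g z \<partial>\<mu>) < \<epsilon> / 8"
      using \<epsilon> by (intro tendstoD) auto
    then show "\<forall>\<^sub>F i in G. dist (integral\<^sup>L (distr M borel (Z i)) f) (integral\<^sup>L \<mu> f) < \<epsilon>"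
      using tailM meas
    proof eventually_elim
      case (elim i)
      then have Zi[measurable]: "Z i \<in> borel_measurable M" by simp
      have 1: "\<bar>(\<integral>w. f (Z i w) \<partial>M) - (\<integral>w. g (Z i w) \<partial>M)\<bar>
          \<le> \<epsilon> / 4 + 2 * B * measure M {w \<in> space M. norm (Z i w) > R}"
        by (rule M.expectation_diff_le_tail[OF Zi _ B(2) _ C in_ball everywhere]) auto
      have 3: "integral\<^sup>L (distr M borel (Z i)) f = (\<integral>w. f (Z i w) \<partial>M)"
        by (rule integral_distr) auto
      show ?case unfolding 3 dist_real_def
        using 1 2 small[OF tail\<mu>] small[OF elim(2)] elim(1) unfolding dist_real_def by linarith
    qed
  qed
qed

section \<open>Continuous mapping and asymptotically negligible perturbations\<close>

lemma converges_in_distr_comp: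
  fixes Z :: "'i \<Rightarrow> 'a \<Rightarrow> 'v::euclidean_space" and h :: "'v \<Rightarrow> 'u::euclidean_space"
  assumes conv: "converges_in_distr M Z \<mu> G" and h: "continuous_on UNIV h"
    and meas: "\<forall>\<^sub>F i in G. Z i \<in> borel_measurable M" and \<mu>: "sets \<mu> = sets borel"
  shows "converges_in_distr M (\<lambda>i w. h (Z i w)) (distr \<mu> borel h) G"
  unfolding converges_in_distr_def
proof (intro allI impI)
  fix f :: "'u \<Rightarrow> real" assume f: "continuous_on UNIV f" "bounded (range f)"
  have [measurable]: "f \<in> borel_measurable borel" "h \<in> borel_measurable borel"
    using f(1) h by (auto intro: borel_measurable_continuous_onI)
  have h\<mu>: "h \<in> borel_measurable \<mu>" using \<mu> by (simp cong: measurable_cong_sets)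
  have "continuous_on UNIV (\<lambda>z. f (h z))"
    using continuous_on_compose2[OF f(1) h] by simp
  moreover have "bounded (range (\<lambda>z. f (h z)))"
    by (rule bounded_subset[OF f(2)]) auto
  ultimately have lim: "((\<lambda>i. integral\<^sup>L (distr M borel (Z i)) (\<lambda>z. f (h z))) \<longlongrightarrow> integral\<^sup>L \<mu> (\<lambda>z. f (h z))) G"
    using conv unfolding converges_in_distr_def by blast
  have "integral\<^sup>L (distr \<mu> borel h) f = integral\<^sup>L \<mu> (\<lambda>z. f (h z))"
    by (rule integral_distr[OF h\<mu>]) simp
  moreover have "\<forall>\<^sub>F i in G. integral\<^sup>L (distr M borel (Z i)) (\<lambda>z. f (h z)) =
      integral\<^sup>L (distr M borel (\<lambda>w. h (Z i w))) f"
    using meas by eventually_elim (simp add: integral_distr)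
  ultimately show "((\<lambda>i. integral\<^sup>L (distr M borel (\<lambda>w. h (Z i w))) f) \<longlongrightarrow> integral\<^sup>L (distr \<mu> borel h) f) G"
    using lim by (auto intro: Lim_transform_eventually)
qed

lemma norm_iexp_diff_le: "norm (iexp x - iexp y) \<le> \<bar>x - y\<bar>"
proof -
  have "iexp x - iexp y = iexp y * (iexp (x - y) - 1)"
    by (simp add: exp_diff right_diff_distrib)
  moreover have "norm (iexp (x - y) - 1) \<le> \<bar>x - y\<bar>"
    using iexp_approx1[of "x - y" 0] by simp
  ultimately show ?thesis by (simp add: norm_mult)
qed

text \<open>Both hypotheses of the continuity criterion pass from \<open>W\<close> to
  \<open>Z\<close>: tightness at the cost of enlarging the radius by \<open>1\<close>,
  characteristic functions because \<open>iexp\<close> is bounded and Lipschitz.\<close>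

lemma converges_in_distr_slutsky:
  fixes Z W :: "'i \<Rightarrow> 'a \<Rightarrow> 'v::euclidean_space"
  assumes M: "prob_space M" and \<mu>: "prob_space \<mu>" "sets \<mu> = sets borel"
    and measZ: "\<forall>\<^sub>F i in G. Z i \<in> borel_measurable M"
    and measW: "\<forall>\<^sub>F i in G. W i \<in> borel_measurable M"
    and char: "\<And>\<theta>. ((\<lambda>i. \<integral>w. iexp (\<theta> \<bullet> W i w) \<partial>M) \<longlongrightarrow> (\<integral>z. iexp (\<theta> \<bullet> z) \<partial>\<mu>)) G"
    and tight: "\<And>\<epsilon>. \<epsilon> > 0 \<Longrightarrow> \<exists>R. \<forall>\<^sub>F i in G. measure M {w \<in> space M. norm (W i w) > R} < \<epsilon>"
    and diff: "converges_in_prob M (\<lambda>i w. Z i w - W i w) (\<lambda>_. 0) G"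
  shows "converges_in_distr M Z \<mu> G"
proof (rule converges_in_distr_char[OF M \<mu> measZ])
  interpret M: prob_space M by fact
  have diffD: "\<forall>\<^sub>F i in G. measure M {w \<in> space M. norm (Z i w - W i w) > \<delta>} < \<epsilon>"
    if "\<delta> > 0" "\<epsilon> > 0" for \<delta> \<epsilon>
    using diff that unfolding converges_in_prob_def
    by (auto intro!: order_tendstoD(2)[where y = 0])
  show "\<exists>R. \<forall>\<^sub>F i in G. measure M {w \<in> space M. norm (Z i w) > R} < \<epsilon>" if "\<epsilon> > 0" for \<epsilon>
  proof -
    obtain R where "\<forall>\<^sub>F i in G. measure M {w \<in> space M. norm (W i w) > R} < \<epsilon> / 2"
      using tight[of "\<epsilon> / 2"] \<open>\<epsilon> > 0\<close> by auto
    moreover have "\<forall>\<^sub>F i in G. measure M {w \<in> space M. norm (Z i w - W i w) > 1} < \<epsilon> / 2"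
      using \<open>\<epsilon> > 0\<close> by (intro diffD) auto
    ultimately have "\<forall>\<^sub>F i in G. measure M {w \<in> space M. norm (Z i w) > R + 1} < \<epsilon>"
      using measZ measW
    proof eventually_elim
      case (elim i)
      then have [measurable]: "Z i \<in> borel_measurable M" "W i \<in> borel_measurable M" by simp_all
      have sub: "{w \<in> space M. norm (Z i w) > R + 1} \<subseteq>
          {w \<in> space M. norm (W i w) > R} \<union> {w \<in> space M. norm (Z i w - W i w) > 1}"
      proof
        fix w assume w: "w \<in> {w \<in> space M. norm (Z i w) > R + 1}"
        then have "R + 1 < norm (W i w) + norm (Z i w - W i w)"
          using norm_triangle_ineq[of "W i w" "Z i w - W i w"] by simp
        with w show "w \<in> {w \<in> space M. norm (W i w) > R} \<union> {w \<in> space M. norm (Z i w - W i w) > 1}"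
          by auto
      qed
      have "measure M {w \<in> space M. norm (Z i w) > R + 1} \<le>
          measure M ({w \<in> space M. norm (W i w) > R} \<union> {w \<in> space M. norm (Z i w - W i w) > 1})"
        by (rule M.finite_measure_mono[OF sub]) measurable
      also have "\<dots> \<le> measure M {w \<in> space M. norm (W i w) > R} +
          measure M {w \<in> space M. norm (Z i w - W i w) > 1}"
        by (rule measure_Un_le) measurable
      finally show ?case using elim by simp
    qed
    then show ?thesis by blast
  qed
  show "((\<lambda>i. \<integral>w. iexp (\<theta> \<bullet> Z i w) \<partial>M) \<longlongrightarrow> (\<integral>z. iexp (\<theta> \<bullet> z) \<partial>\<mu>)) G" for \<theta>
  proof (rule Lim_transform[OF char[of \<theta>]], rule tendstoI)
    fix \<epsilon> :: real assume \<epsilon>: "\<epsilon> > 0"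
    \<comment> \<open>With \<open>norm \<theta> + 1\<close> in place of \<open>norm \<theta>\<close>
      the quotient is meaningful for \<open>\<theta> = 0\<close> too.\<close>
    define \<delta> where "\<delta> = \<epsilon> / (4 * (norm \<theta> + 1))"
    have \<delta>: "\<delta> > 0" "norm \<theta> * \<delta> \<le> \<epsilon> / 4"
    proof -
      have pos: "norm \<theta> + 1 > 0" by (simp add: add_nonneg_pos)
      then show "\<delta> > 0" using \<epsilon> by (simp add: \<delta>_def)
      then have "norm \<theta> * \<delta> \<le> (norm \<theta> + 1) * \<delta>" by simp
      also have "\<dots> = \<epsilon> / 4" using pos by (simp add: \<delta>_def field_simps)
      finally show "norm \<theta> * \<delta> \<le> \<epsilon> / 4" .
    qed
    have "\<forall>\<^sub>F i in G. measure M {w \<in> space M. norm (Z i w - W i w) > \<delta>} < \<epsilon> / 8"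
      using \<delta> \<epsilon> by (intro diffD) auto
    then show "\<forall>\<^sub>F i in G. dist ((\<integral>w. iexp (\<theta> \<bullet> Z i w) \<partial>M) - (\<integral>w. iexp (\<theta> \<bullet> W i w) \<partial>M)) 0 < \<epsilon>"
      using measZ measW
    proof eventually_elim
      case (elim i)
      then have [measurable]: "Z i \<in> borel_measurable M" "W i \<in> borel_measurable M" by simp_all
      let ?E = "{w \<in> space M. norm (Z i w - W i w) > \<delta>}"
      have [measurable]: "?E \<in> M.events" by measurable
      have int: "integrable M (\<lambda>w. iexp (\<theta> \<bullet> Z i w))" "integrable M (\<lambda>w. iexp (\<theta> \<bullet> W i w))"
        by (rule M.integrable_iexp; simp)+
      have pt: "norm (iexp (\<theta> \<bullet> Z i w) - iexp (\<theta> \<bullet> W i w)) \<le> \<epsilon> / 4 + 2 * indicator ?E w"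
        if "w \<in> space M" for w
      proof (cases "w \<in> ?E")
        case True
        have "norm (iexp (\<theta> \<bullet> Z i w) - iexp (\<theta> \<bullet> W i w)) \<le> 1 + 1"
          by (rule order_trans[OF norm_triangle_ineq4]) simp
        with True \<epsilon> show ?thesis by simp
      next
        case False
        then have le: "norm (Z i w - W i w) \<le> \<delta>" using that by simp
        have "norm (iexp (\<theta> \<bullet> Z i w) - iexp (\<theta> \<bullet> W i w)) \<le> \<bar>\<theta> \<bullet> (Z i w - W i w)\<bar>"
          using norm_iexp_diff_le by (simp add: inner_diff_right)
        also have "\<dots> \<le> norm \<theta> * norm (Z i w - W i w)" by (rule Cauchy_Schwarz_ineq2)
        also have "\<dots> \<le> norm \<theta> * \<delta>" using le by (intro mult_left_mono) auto
        finally show ?thesis using False \<delta> by simp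
      qed
      have "norm ((\<integral>w. iexp (\<theta> \<bullet> Z i w) \<partial>M) - (\<integral>w. iexp (\<theta> \<bullet> W i w) \<partial>M))
          = norm (\<integral>w. iexp (\<theta> \<bullet> Z i w) - iexp (\<theta> \<bullet> W i w) \<partial>M)"
        using int by simp
      also have "\<dots> \<le> (\<integral>w. norm (iexp (\<theta> \<bullet> Z i w) - iexp (\<theta> \<bullet> W i w)) \<partial>M)"
        by (rule integral_norm_bound)
      also have "\<dots> \<le> (\<integral>w. \<epsilon> / 4 + 2 * indicator ?E w \<partial>M)"
      proof (rule integral_mono[OF _ _ pt])
        show "integrable M (\<lambda>w. norm (iexp (\<theta> \<bullet> Z i w) - iexp (\<theta> \<bullet> W i w)))"
          using int by (intro integrable_norm Bochner_Integration.integrable_diff)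
        show "integrable M (\<lambda>w. \<epsilon> / 4 + 2 * indicator ?E w)"
          by (auto simp: integrable_real_indicator M.emeasure_eq_measure)
      qed
      also have "\<dots> = \<epsilon> / 4 + 2 * measure M ?E"
        by (subst Bochner_Integration.integral_add)
           (auto simp: M.prob_space M.emeasure_eq_measure integrable_real_indicator)
      finally show ?case using elim(1) \<epsilon> by (simp add: dist_norm)
    qed
  qed
qed

section \<open>Limit laws\<close>

text \<open>Scaling a standard normal variable by \<open>sqrt v\<close> covers the point mass at
  \<open>v = 0\<close> as well, so later computations need no case distinction.\<close>

lemma normal_law_eq_distr:
  assumes "v \<ge> 0"
  shows "normal_law 0 v = distr std_normal_distribution borel (\<lambda>x. sqrt v * x)"
proof (cases "v = 0")
  case True
  interpret real_distribution std_normal_distribution by (rule real_dist_normal_dist)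
  show ?thesis using True by (simp add: normal_law_def)
next
  case False
  with assms have v: "v > 0" by simp
  interpret real_distribution std_normal_distribution by (rule real_dist_normal_dist)
  have "distributed std_normal_distribution lborel (\<lambda>x. x) std_normal_density"
    unfolding distributed_def by (simp add: distr_id2)
  from normal_density_affine[OF this, of "sqrt v" 0] v
  have "distributed std_normal_distribution lborel (\<lambda>x. sqrt v * x) (normal_density 0 (sqrt v))"
    by simp
  then have "distr std_normal_distribution lborel (\<lambda>x. sqrt v * x) = density lborel (normal_density 0 (sqrt v))"
    by (simp add: distributed_def)
  moreover have "distr std_normal_distribution lborel (\<lambda>x. sqrt v * x) =
      distr std_normal_distribution borel (\<lambda>x. sqrt v * x)"
    by (rule distr_cong) auto
  ultimately show ?thesis using v by (simp add: normal_law_def)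
qed

lemma iexp_std_normal: "(\<integral>x. iexp (c * x) \<partial>std_normal_distribution) = exp (- (of_real c)\<^sup>2 / 2)"
proof -
  have "char std_normal_distribution c = complex_of_real (exp (- (c^2) / 2))"
    by (simp add: char_std_normal_distribution)
  then show ?thesis unfolding char_def by (simp add: exp_of_real[symmetric])
qed

lemma char_normal_law:
  assumes "v \<ge> 0"
  shows "(\<integral>x. iexp (c * x) \<partial>normal_law 0 v) = exp (- of_real (v * c\<^sup>2 / 2))"
proof -
  have "(\<integral>x. iexp (c * x) \<partial>normal_law 0 v) = (\<integral>x. iexp ((c * sqrt v) * x) \<partial>std_normal_distribution)"
    unfolding normal_law_eq_distr[OF assms]
    by (subst integral_distr) (auto simp: mult.assoc)
  then show ?thesis
    unfolding iexp_std_normal using assms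
    by (simp add: power_mult_distrib mult.commute flip: of_real_power)
qed

lemma prob_space_normal_law: "v \<ge> 0 \<Longrightarrow> prob_space (normal_law 0 v)"
proof -
  interpret real_distribution std_normal_distribution by (rule real_dist_normal_dist)
  show "v \<ge> 0 \<Longrightarrow> prob_space (normal_law 0 v)"
    unfolding normal_law_eq_distr by (rule prob_space_distr) simp
qed

lemma sets_normal_law: "sets (normal_law m v) = sets borel"
  by (simp add: normal_law_def)

lemma chi_squared_law_1:
  "chi_squared_law 1 = distr std_normal_distribution borel (\<lambda>x. x\<^sup>2)"
proof -
  interpret N: real_distribution std_normal_distribution by (rule real_dist_normal_dist)
  interpret product_sigma_finite "\<lambda>_::nat. std_normal_distribution" ..
  have "distr (Pi\<^sub>M {0::nat} (\<lambda>_. std_normal_distribution)) std_normal_distribution (\<lambda>z. z 0) = std_normal_distribution"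
    by (rule distr_singleton)
  then have "distr std_normal_distribution borel (\<lambda>x. x\<^sup>2) =
      distr (distr (Pi\<^sub>M {0::nat} (\<lambda>_. std_normal_distribution)) std_normal_distribution (\<lambda>z. z 0)) borel (\<lambda>x. x\<^sup>2)"
    by simp
  also have "\<dots> = distr (Pi\<^sub>M {0::nat} (\<lambda>_. std_normal_distribution)) borel (\<lambda>z. (z 0)\<^sup>2)"
    by (subst distr_distr) (auto simp: comp_def intro: measurable_component_singleton)
  also have "\<dots> = chi_squared_law 1"
    unfolding chi_squared_law_def lessThan_Suc One_nat_def lessThan_0 by simp
  finally show ?thesis ..
qed

lemma distr_square_normal_law:
  assumes "v > 0" "k * v = 1"
  shows "distr (normal_law 0 v) borel (\<lambda>x. k * x\<^sup>2) = chi_squared_law 1"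
  unfolding chi_squared_law_1 normal_law_eq_distr[OF less_imp_le[OF assms(1)]]
  using assms by (subst distr_distr) (auto simp: comp_def power_mult_distrib mult.assoc[symmetric])

section \<open>Isotropic normal laws\<close>

lemma measurable_vec_lambda_PiM [measurable]:
  "(\<lambda>z. \<chi> i. z i) \<in> borel_measurable (Pi\<^sub>M (UNIV :: 'n::finite set) (\<lambda>_. std_normal_distribution))"
proof (subst borel_measurable_euclidean_space, intro ballI)
  fix b :: "real^'n" assume "b \<in> Basis"
  then obtain j where b: "b = axis j 1" by (auto simp: Basis_vec_def)
  have eq: "(\<lambda>z. (\<chi> i. z i) \<bullet> b) = (\<lambda>z. z j)" by (simp add: b inner_axis)
  show "(\<lambda>z. (\<chi> i. z i) \<bullet> b) \<in> borel_measurable (Pi\<^sub>M UNIV (\<lambda>_. std_normal_distribution))"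
    unfolding eq
    using measurable_component_singleton[of j UNIV "\<lambda>_. std_normal_distribution"] by simp
qed

lemma measurable_matrix_vector_mult [measurable]:
  fixes C :: "real^'n^'m"
  shows "(\<lambda>v. C *v v) \<in> borel_measurable borel"
  by (intro borel_measurable_continuous_onI matrix_vector_mult_linear_continuous_on)

context
  fixes s :: real and C :: "real^'n^'n"
  assumes s: "s \<ge> 0"
    and C_def: "C = (SOME C. C ** transpose C = s *\<^sub>R mat 1)"
begin

text \<open>The multiple \<open>sqrt s *\<^sub>R mat 1\<close> of the identity shows that the choice
  is made from a nonempty set. Beyond this equation nothing is known about the chosen root.\<close>

lemma scaled_identity_root: "C ** transpose C = s *\<^sub>R mat 1"
proof -
  have "(sqrt s *\<^sub>R mat 1 :: real^'n^'n) ** transpose (sqrt s *\<^sub>R mat 1) = s *\<^sub>R mat 1"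
    using s by (simp add: transpose_scalar scalar_matrix_assoc[symmetric] matrix_scalar_ac[symmetric])
  then show ?thesis unfolding C_def by (rule someI)
qed

lemma norm_transpose_root: "(norm (transpose C *v \<theta>))\<^sup>2 = s * (norm \<theta>)\<^sup>2"
proof -
  have "(norm (transpose C *v \<theta>))\<^sup>2 = (\<theta> v* C) \<bullet> (transpose C *v \<theta>)"
    by (simp add: power2_norm_eq_inner)
  also have "\<dots> = \<theta> \<bullet> ((C ** transpose C) *v \<theta>)"
    by (simp only: dot_lmul_matrix matrix_vector_mul_assoc)
  finally show ?thesis
    by (simp add: scaled_identity_root scaleR_matrix_vector_assoc[symmetric] power2_norm_eq_inner)
qed

text \<open>For \<open>s \<noteq> 0\<close> the transpose divided by \<open>s\<close> is a right
  inverse, hence also a left inverse; for \<open>s = 0\<close> the transpose annihilates every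
  vector, hence \<open>C = 0\<close>. Squared lengths are thus the same for every root.\<close>

lemma norm_root: "(norm (C *v z))\<^sup>2 = s * (norm z)\<^sup>2"
proof (cases "s = 0")
  case True
  have "transpose C *v \<theta> = 0" for \<theta>
    using norm_transpose_root[of \<theta>] True by simp
  then have "C = 0"
    by (metis matrix_eq matrix_vector_mult_0 transpose_transpose transpose_mat mat_0)
  then show ?thesis using True by simp
next
  case False
  have "C ** ((1 / s) *\<^sub>R transpose C) = mat 1"
    using scaled_identity_root False by (simp add: matrix_scalar_ac scalar_matrix_assoc[symmetric])
  then have "((1 / s) *\<^sub>R transpose C) ** C = mat 1"
    by (simp only: matrix_left_right_inverse)
  then have "s *\<^sub>R (((1 / s) *\<^sub>R transpose C) ** C) = s *\<^sub>R mat 1" by simp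
  then have 1: "transpose C ** C = s *\<^sub>R mat 1"
    using False by (simp add: scalar_matrix_assoc[symmetric])
  have "(norm (C *v z))\<^sup>2 = (z v* transpose C) \<bullet> (C *v z)"
    by (simp add: power2_norm_eq_inner)
  also have "\<dots> = z \<bullet> ((transpose C ** C) *v z)"
    by (simp only: dot_lmul_matrix matrix_vector_mul_assoc)
  finally show ?thesis
    by (simp add: 1 scaleR_matrix_vector_assoc[symmetric] power2_norm_eq_inner)
qed

end

lemma multivariate_normal_law_0:
  "multivariate_normal_law 0 S = distr (Pi\<^sub>M (UNIV :: 'n set) (\<lambda>_. std_normal_distribution)) borel
     (\<lambda>z. (SOME C :: real^'n^'n. C ** transpose C = S) *v (\<chi> i. z i))"
  by (simp add: multivariate_normal_law_def)

lemma sets_multivariate_normal_law: "sets (multivariate_normal_law m S) = sets borel"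
  by (simp add: multivariate_normal_law_def)

lemma prob_space_multivariate_normal_law: "prob_space (multivariate_normal_law 0 (S :: real^'n^'n))"
proof -
  interpret N: real_distribution std_normal_distribution by (rule real_dist_normal_dist)
  interpret product_prob_space "\<lambda>_::'n. std_normal_distribution" UNIV ..
  show ?thesis unfolding multivariate_normal_law_0
    by (rule prob_space_distr) measurable
qed

lemma char_multivariate_normal_law:
  fixes \<theta> :: "real^'n"
  assumes "s \<ge> 0"
  shows "(\<integral>z. iexp (\<theta> \<bullet> z) \<partial>multivariate_normal_law 0 (s *\<^sub>R mat 1)) = exp (- of_real (s * (norm \<theta>)\<^sup>2 / 2))"
proof -
  interpret N: real_distribution std_normal_distribution by (rule real_dist_normal_dist)
  interpret product_sigma_finite "\<lambda>_::'n. std_normal_distribution" ..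
  define C where "C = (SOME C :: real^'n^'n. C ** transpose C = s *\<^sub>R mat 1)"
  define d where "d = transpose C *v \<theta>"
  have "(\<integral>z. iexp (\<theta> \<bullet> z) \<partial>multivariate_normal_law 0 (s *\<^sub>R mat 1)) =
      (\<integral>z. iexp (\<theta> \<bullet> (C *v (\<chi> i. z i))) \<partial>(Pi\<^sub>M (UNIV :: 'n set) (\<lambda>_. std_normal_distribution)))"
    unfolding multivariate_normal_law_0 C_def[symmetric] by (subst integral_distr) auto
  also have "\<dots> = (\<integral>z. (\<Prod>i\<in>UNIV. iexp (d $ i * z i)) \<partial>(Pi\<^sub>M (UNIV :: 'n set) (\<lambda>_. std_normal_distribution)))"
  proof (intro Bochner_Integration.integral_cong refl)
    fix z :: "'n \<Rightarrow> real"
    have "\<theta> \<bullet> (C *v (\<chi> i. z i)) = d \<bullet> (\<chi> i. z i)"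
      by (simp add: d_def dot_lmul_matrix)
    also have "\<dots> = (\<Sum>i\<in>UNIV. d $ i * z i)" by (simp add: inner_vec_def)
    finally show "iexp (\<theta> \<bullet> (C *v (\<chi> i. z i))) = (\<Prod>i\<in>UNIV. iexp (d $ i * z i))"
      by (simp add: exp_sum sum_distrib_left)
  qed
  also have "\<dots> = (\<Prod>i\<in>UNIV. (\<integral>x. iexp (d $ i * x) \<partial>std_normal_distribution))"
    by (rule product_integral_prod) (auto intro!: N.integrable_iexp)
  also have "\<dots> = exp (\<Sum>i\<in>UNIV. - (of_real (d $ i))\<^sup>2 / 2)"
    unfolding iexp_std_normal by (simp add: exp_sum)
  also have "(\<Sum>i\<in>UNIV. - (complex_of_real (d $ i))\<^sup>2 / 2) = - of_real ((norm d)\<^sup>2 / 2)"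
    unfolding power2_norm_eq_inner inner_vec_def
    by (simp add: sum_negf sum_divide_distrib power2_eq_square)
  also have "(norm d)\<^sup>2 = s * (norm \<theta>)\<^sup>2"
    unfolding d_def by (rule norm_transpose_root[OF assms C_def])
  finally show ?thesis .
qed

text \<open>In the plane the disc given by the bound \<open>a\<close> has area
  \<open>pi / s * a\<close>, which is linear in \<open>a\<close>; this is why the image measure is
  uniform on the half-line. It takes the place of polar coordinates.\<close>

lemma distr_lborel_square_norm:
  assumes "s > 0"
  shows "distr (lborel :: (real \<times> real) measure) borel (\<lambda>z. s * (norm z)\<^sup>2) =
     density lborel (\<lambda>t. ennreal (pi / s) * indicator {0..} t)"
proof (rule measure_eqI_generator_eq[where E = "range (\<lambda>a::real. {..<a})" and \<Omega> = UNIV and A = "\<lambda>n. {..<real n}"])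
  show "Int_stable (range (\<lambda>a::real. {..<a}))"
  proof -
    have "{..<a} \<inter> {..<b} = {..<min a b}" for a b :: real by auto
    then show ?thesis unfolding Int_stable_def by auto
  qed
  show "(\<Union>n. {..<real n}) = UNIV" by (auto simp: reals_Archimedean2)
  have eq: "emeasure (distr (lborel :: (real \<times> real) measure) borel (\<lambda>z. s * (norm z)\<^sup>2)) {..<a} = ennreal (pi / s * max 0 a)"
    for a :: real
  proof -
    have "emeasure (distr (lborel :: (real \<times> real) measure) borel (\<lambda>z. s * (norm z)\<^sup>2)) {..<a} =
        emeasure lborel {z :: real \<times> real. s * (norm z)\<^sup>2 < a}"
      by (subst emeasure_distr) (auto intro!: arg_cong[where f = "emeasure lborel"])
    also have "{z :: real \<times> real. s * (norm z)\<^sup>2 < a} = ball 0 (sqrt (max 0 a / s))"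
    proof (cases "a > 0")
      case True
      have "s * (norm z)\<^sup>2 < a \<longleftrightarrow> norm z < sqrt (a / s)" for z :: "real \<times> real"
      proof -
        have "norm z < sqrt (a / s) \<longleftrightarrow> sqrt ((norm z)\<^sup>2) < sqrt (a / s)" by simp
        also have "\<dots> \<longleftrightarrow> (norm z)\<^sup>2 < a / s" by (rule real_sqrt_less_iff)
        finally show ?thesis using assms by (simp add: field_simps)
      qed
      with True show ?thesis by auto
    next
      case False
      then have "\<not> s * (norm z)\<^sup>2 < a" for z :: "real \<times> real"
        using assms by (simp add: not_less order_trans[of a 0])
      with False show ?thesis by auto
    qed
    also have "emeasure lborel (ball (0 :: real \<times> real) (sqrt (max 0 a / s))) =
        ennreal (unit_ball_vol 2 * (sqrt (max 0 a / s))\<^sup>2)"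
      using assms by (subst emeasure_ball) auto
    also have "unit_ball_vol 2 * (sqrt (max 0 a / s))\<^sup>2 = pi / s * max 0 a"
      using assms by (simp add: unit_ball_vol_2)
    finally show ?thesis .
  qed
  have eq2: "emeasure (density lborel (\<lambda>t. ennreal (pi / s) * indicator {0..} t)) {..<a} = ennreal (pi / s * max 0 a)"
    for a :: real
  proof -
    have "emeasure (density lborel (\<lambda>t. ennreal (pi / s) * indicator {0..} t)) {..<a} =
        (\<integral>\<^sup>+t. ennreal (pi / s) * indicator {0..<a} t \<partial>lborel)"
      by (subst emeasure_density) (auto intro!: nn_integral_cong split: split_indicator)
    also have "\<dots> = ennreal (pi / s) * emeasure lborel {0..<a}"
      by (subst nn_integral_cmult) auto
    also have "\<dots> = ennreal (pi / s * max 0 a)"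
      using assms by (cases "a \<ge> 0") (auto simp: ennreal_mult'[symmetric])
    finally show ?thesis .
  qed
  show "emeasure (distr (lborel :: (real \<times> real) measure) borel (\<lambda>z. s * (norm z)\<^sup>2)) X =
      emeasure (density lborel (\<lambda>t. ennreal (pi / s) * indicator {0..} t)) X"
    if "X \<in> range (\<lambda>a::real. {..<a})" for X
    using that eq eq2 by auto
  show "emeasure (distr (lborel :: (real \<times> real) measure) borel (\<lambda>z. s * (norm z)\<^sup>2)) {..<real i} \<noteq> \<infinity>" for i
    unfolding eq by simp
qed (auto simp: borel_Iio)

text \<open>The planar Gaussian density depends on \<open>z\<close> only through
  \<open>t = s * (norm z)\<^sup>2\<close>, so it passes to the image measure and multiplies the
  uniform density \<open>pi / s\<close> by \<open>exp (- t / (2 * s)) / (2 * pi)\<close>.\<close>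

lemma distr_std_normal_square_norm:
  assumes "s > 0"
  shows "distr (std_normal_distribution \<Otimes>\<^sub>M std_normal_distribution) borel (\<lambda>z. s * (norm z)\<^sup>2) =
    density lborel (exponential_density (1 / (2 * s)))"
proof -
  interpret N: real_distribution std_normal_distribution by (rule real_dist_normal_dist)
  define g where "g t = ennreal (exp (- t / (2 * s)) / (2 * pi))" for t :: real
  have [measurable]: "g \<in> borel_measurable borel" unfolding g_def[abs_def] by measurable
  have "std_normal_distribution \<Otimes>\<^sub>M std_normal_distribution =
      density (lborel \<Otimes>\<^sub>M lborel) (\<lambda>(x, y). ennreal (std_normal_density x) * ennreal (std_normal_density y))"
    by (rule pair_measure_density) (auto intro: N.sigma_finite_measure_axioms lborel.sigma_finite_measure_axioms)
  also have "(\<lambda>(x, y). ennreal (std_normal_density x) * ennreal (std_normal_density y)) =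
      (\<lambda>z. g (s * (norm z)\<^sup>2))"
  proof (intro ext, clarify)
    fix x y :: real
    have "ennreal (std_normal_density x) * ennreal (std_normal_density y) =
        ennreal (std_normal_density x * std_normal_density y)"
      by (simp add: ennreal_mult')
    also have "std_normal_density x * std_normal_density y = exp (- (s * (norm (x, y))\<^sup>2) / (2 * s)) / (2 * pi)"
      using assms by (simp add: std_normal_density_def norm_Pair exp_add[symmetric] add_divide_distrib)
    finally show "ennreal (std_normal_density x) * ennreal (std_normal_density y) = g (s * (norm (x, y))\<^sup>2)"
      by (simp add: g_def)
  qed
  also have "distr (density (lborel \<Otimes>\<^sub>M lborel) (\<lambda>z :: real \<times> real. g (s * (norm z)\<^sup>2))) borel (\<lambda>z. s * (norm z)\<^sup>2) =
      density (distr lborel borel (\<lambda>z :: real \<times> real. s * (norm z)\<^sup>2)) g"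
    unfolding lborel_prod by (subst density_distr) auto
  also have "\<dots> = density lborel (\<lambda>t. (ennreal (pi / s) * indicator {0..} t) * g t)"
    unfolding distr_lborel_square_norm[OF assms]
    by (rule density_density_eq) auto
  also have "\<dots> = density lborel (exponential_density (1 / (2 * s)))"
    using assms
    by (intro density_cong)
       (auto simp: g_def exponential_density_def ennreal_mult'[symmetric] field_simps split: split_indicator)
  finally show ?thesis .
qed

lemma distr_PiM_2_pair:
  "distr (Pi\<^sub>M (UNIV :: 2 set) (\<lambda>_. std_normal_distribution)) (borel \<Otimes>\<^sub>M borel) (\<lambda>z. (z 1, z 2)) =
    std_normal_distribution \<Otimes>\<^sub>M std_normal_distribution"
proof (rule pair_measure_eqI[symmetric])
  interpret N: real_distribution std_normal_distribution by (rule real_dist_normal_dist)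
  interpret product_sigma_finite "\<lambda>_::2. std_normal_distribution" ..
  show "sigma_finite_measure std_normal_distribution" "sigma_finite_measure std_normal_distribution" ..
  show "sets (std_normal_distribution \<Otimes>\<^sub>M std_normal_distribution) =
      sets (distr (Pi\<^sub>M (UNIV :: 2 set) (\<lambda>_. std_normal_distribution)) (borel \<Otimes>\<^sub>M borel) (\<lambda>z. (z 1, z 2)))"
    unfolding sets_distr by (rule sets_pair_measure_cong) auto
  fix A B assume AB: "A \<in> sets std_normal_distribution" "B \<in> sets std_normal_distribution"
  have comp: "(\<lambda>z. z i) \<in> borel_measurable (Pi\<^sub>M (UNIV :: 2 set) (\<lambda>_. std_normal_distribution))" for i
    using measurable_component_singleton[of i UNIV "\<lambda>_. std_normal_distribution"] by simp
  have "emeasure (distr (Pi\<^sub>M (UNIV :: 2 set) (\<lambda>_. std_normal_distribution)) (borel \<Otimes>\<^sub>M borel) (\<lambda>z. (z 1, z 2))) (A \<times> B) =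
      emeasure (Pi\<^sub>M (UNIV :: 2 set) (\<lambda>_. std_normal_distribution)) (Pi\<^sub>E UNIV (\<lambda>i. if i = 1 then A else B))"
    using AB comp
    by (subst emeasure_distr)
       (auto simp: space_PiM PiE_UNIV_domain Pi_def forall_2 vimage_def
         intro!: arg_cong[where f = "emeasure _"] measurable_Pair)
  also have "\<dots> = (\<Prod>i\<in>(UNIV :: 2 set). emeasure std_normal_distribution (if i = 1 then A else B))"
    using AB by (intro emeasure_PiM) auto
  also have "\<dots> = emeasure std_normal_distribution A * emeasure std_normal_distribution B"
    by (simp add: UNIV_2)
  finally show "emeasure std_normal_distribution A * emeasure std_normal_distribution B =
    emeasure (distr (Pi\<^sub>M (UNIV :: 2 set) (\<lambda>_. std_normal_distribution)) (borel \<Otimes>\<^sub>M borel) (\<lambda>z. (z 1, z 2))) (A \<times> B)" ..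
qed

lemma distr_square_norm_multivariate_normal_law:
  assumes "s \<ge> 0"
  shows "distr (multivariate_normal_law 0 (s *\<^sub>R mat 1 :: real^2^2)) borel (\<lambda>v. (norm v)\<^sup>2) = exponential_law (2 * s)"
proof -
  interpret N: real_distribution std_normal_distribution by (rule real_dist_normal_dist)
  interpret P: product_prob_space "\<lambda>_::2. std_normal_distribution" UNIV ..
  let ?P = "Pi\<^sub>M (UNIV :: 2 set) (\<lambda>_. std_normal_distribution)"
  define C where "C = (SOME C :: real^2^2. C ** transpose C = s *\<^sub>R mat 1)"
  have comp: "(\<lambda>z. z i) \<in> borel_measurable ?P" for i
    using measurable_component_singleton[of i UNIV "\<lambda>_. std_normal_distribution"] by simp
  have "distr (multivariate_normal_law 0 (s *\<^sub>R mat 1 :: real^2^2)) borel (\<lambda>v. (norm v)\<^sup>2) =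
      distr ?P borel (\<lambda>z. (norm (C *v (\<chi> i. z i)))\<^sup>2)"
    unfolding multivariate_normal_law_0 C_def[symmetric]
    by (subst distr_distr) (auto simp: comp_def)
  also have "(\<lambda>z. (norm (C *v (\<chi> i. z i)))\<^sup>2) = (\<lambda>z. s * (norm (z 1, z 2))\<^sup>2)"
    unfolding norm_root[OF assms C_def]
    unfolding power2_norm_eq_inner by (simp add: inner_vec_def sum_2 power2_eq_square)
  also have "distr ?P borel \<dots> = exponential_law (2 * s)"
  proof (cases "s = 0")
    case True
    then show ?thesis by (simp add: exponential_law_def)
  next
    case False
    with assms have s: "s > 0" by simp
    have "distr ?P borel (\<lambda>z. s * (norm (z 1, z 2))\<^sup>2) =
        distr (distr ?P (borel \<Otimes>\<^sub>M borel) (\<lambda>z. (z 1, z 2))) borel (\<lambda>z. s * (norm z)\<^sup>2)"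
      using comp by (subst distr_distr) (auto simp: comp_def borel_prod intro!: borel_measurable_Pair)
    also have "\<dots> = exponential_law (2 * s)"
      unfolding distr_PiM_2_pair distr_std_normal_square_norm[OF s]
      using False by (simp add: exponential_law_def)
    finally show ?thesis .
  qed
  finally show ?thesis .
qed

section \<open>Linear differential equations with constant coefficients\<close>

text \<open>\<open>Y k\<close> stands for the \<open>k\<close>-th derivative of a function \<open>y\<close>, and \<open>diff_op p Y k\<close> for \<open>p(D)\<close> applied
  to that derivative.\<close>

definition diff_op :: "complex poly \<Rightarrow> (nat \<Rightarrow> real \<Rightarrow> complex) \<Rightarrow> nat \<Rightarrow> real \<Rightarrow> complex" where
  "diff_op p Y k t = (\<Sum>j\<le>degree p. coeff p j * Y (j + k) t)"

lemma diff_op_eq: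
  assumes "degree p \<le> n"
  shows "diff_op p Y k t = (\<Sum>j\<le>n. coeff p j * Y (j + k) t)"
  unfolding diff_op_def using assms
  by (intro sum.mono_neutral_left) (auto simp: coeff_eq_0)

lemma diff_op_0 [simp]: "diff_op 0 Y k t = 0"
  by (simp add: diff_op_def)

lemma diff_op_pCons: "diff_op (pCons c p) Y k t = c * Y k t + diff_op p Y (Suc k) t"
proof -
  have "diff_op (pCons c p) Y k t = (\<Sum>j\<le>Suc (degree p). coeff (pCons c p) j * Y (j + k) t)"
    by (rule diff_op_eq) (rule degree_pCons_le)
  then show ?thesis by (simp only: sum.atMost_Suc_shift) (simp add: diff_op_def)
qed

lemma diff_op_add: "diff_op (p + q) Y k t = diff_op p Y k t + diff_op q Y k t"
proof -
  define n where "n = max (degree p) (degree q)"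
  have "degree (p + q) \<le> n" by (simp add: n_def degree_add_le_max)
  then show ?thesis
    by (simp add: diff_op_eq[of _ n] n_def distrib_right sum.distrib)
qed

lemma diff_op_smult: "diff_op (smult c p) Y k t = c * diff_op p Y k t"
proof -
  have "degree (smult c p) \<le> degree p" by (rule degree_smult_le)
  then show ?thesis by (simp add: diff_op_eq[of _ "degree p"] sum_distrib_left mult.assoc)
qed

lemma diff_op_linear_factor:
  "diff_op ([:- c, 1:] * p) Y k t = diff_op p Y (Suc k) t - c * diff_op p Y k t"
proof -
  have "[:- c, 1:] * p = smult (- c) p + pCons 0 p" by simp
  then show ?thesis by (simp only: diff_op_add diff_op_smult diff_op_pCons) simp
qed

lemma diff_op_shift_diff:
  "diff_op p (\<lambda>k t. Y (Suc k) t - c * Y k t) k t = diff_op p Y (Suc k) t - c * diff_op p Y k t"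
  by (simp add: diff_op_def sum_subtractf right_diff_distrib sum_distrib_left mult_ac)

lemma diff_op_has_vector_derivative:
  assumes "\<And>k t. (Y k has_vector_derivative Y (Suc k) t) (at t)"
  shows "(diff_op p Y k has_vector_derivative diff_op p Y (Suc k) t) (at t)"
  unfolding diff_op_def[abs_def] using assms
  by (auto intro!: derivative_eq_intros has_vector_derivative_sum)

text \<open>Multiply by the integrating factor \<open>exp (- c * t)\<close> and compare with the
  exponential majorant \<open>\<phi>\<close>. The strict inequality between \<open>\<nu>\<close> and
  \<open>- Re c\<close> keeps the exponent of the majorant positive; at equal rates resonance could
  produce a factor \<open>t\<close>.\<close>

lemma inhomogeneous_decay:
  fixes y z :: "real \<Rightarrow> complex"
  assumes deriv: "\<And>t. (y has_vector_derivative (c * y t + z t)) (at t)"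
    and z: "\<And>t. t \<ge> 0 \<Longrightarrow> norm (z t) \<le> C * exp (- \<mu> * t)"
    and \<nu>: "\<nu> \<le> \<mu>" "\<nu> < - Re c"
  shows "\<exists>C'. \<forall>t\<ge>0. norm (y t) \<le> C' * exp (- \<nu> * t)"
proof -
  define \<rho> where "\<rho> = - Re c"
  have \<rho>: "\<rho> - \<nu> > 0" using \<nu> by (simp add: \<rho>_def)
  have C: "C \<ge> 0" using z[of 0] norm_ge_zero[of "z 0"] by (simp del: norm_ge_zero)
  define f where "f t = exp (- c * of_real t) * y t" for t
  define \<phi> where "\<phi> t = C / (\<rho> - \<nu>) * exp ((\<rho> - \<nu>) * t)" for t
  have f': "(f has_vector_derivative exp (- c * of_real t) * z t) (at t)" for t
    unfolding f_def[abs_def]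
    by (rule derivative_eq_intros deriv refl has_vector_derivative_real_field | simp)+
       (simp add: algebra_simps)
  have \<phi>': "(\<phi> has_vector_derivative C * exp ((\<rho> - \<nu>) * t)) (at t)" for t
    unfolding \<phi>_def[abs_def] has_real_derivative_iff_has_vector_derivative[symmetric]
    using \<rho> by (auto intro!: derivative_eq_intros)
  have diff: "norm (f t - f 0) \<le> \<phi> t - \<phi> 0" if "t > 0" for t
  proof (rule differentiable_bound_general[OF that, where f' = "\<lambda>t. exp (- c * of_real t) * z t"
        and \<phi>' = "\<lambda>t. C * exp ((\<rho> - \<nu>) * t)"])
    show "continuous_on {0..t} f" "continuous_on {0..t} \<phi>"
      using f' \<phi>' by (meson continuous_at_imp_continuous_on has_vector_derivative_continuous)+
    show "(f has_vector_derivative exp (- c * of_real s) * z s) (at s)"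
      "(\<phi> has_vector_derivative C * exp ((\<rho> - \<nu>) * s)) (at s)" for s
      using f' \<phi>' by auto
    show "norm (exp (- c * of_real s) * z s) \<le> C * exp ((\<rho> - \<nu>) * s)" if "0 < s" "s < t" for s
    proof -
      have "norm (exp (- c * of_real s) * z s) = exp (\<rho> * s) * norm (z s)"
        by (simp add: norm_mult \<rho>_def)
      also have "\<dots> \<le> exp (\<rho> * s) * (C * exp (- \<nu> * s))"
      proof (intro mult_left_mono)
        have "norm (z s) \<le> C * exp (- \<mu> * s)" using that by (intro z) simp
        also have "\<dots> \<le> C * exp (- \<nu> * s)"
          using \<nu>(1) C that by (intro mult_left_mono) (auto intro: mult_right_mono)
        finally show "norm (z s) \<le> C * exp (- \<nu> * s)" .
      qed simp
      also have "\<dots> = C * exp ((\<rho> - \<nu>) * s)"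
        by (simp add: exp_add[symmetric] algebra_simps mult.left_commute)
      finally show ?thesis .
    qed
  qed
  have \<phi>0: "\<phi> 0 \<ge> 0" using \<rho> C by (simp add: \<phi>_def)
  have "norm (y t) \<le> (norm (f 0) + C / (\<rho> - \<nu>)) * exp (- \<nu> * t)" if "t \<ge> 0" for t
  proof -
    have "norm (f t) \<le> norm (f 0) + \<phi> t"
    proof (cases "t > 0")
      case True
      then show ?thesis using diff[OF True] \<phi>0 norm_triangle_ineq2[of "f t" "f 0"] by linarith
    next
      case False
      then show ?thesis using that \<phi>0 by simp
    qed
    also have "\<dots> \<le> (norm (f 0) + C / (\<rho> - \<nu>)) * exp ((\<rho> - \<nu>) * t)"
    proof -
      have "norm (f 0) * 1 \<le> norm (f 0) * exp ((\<rho> - \<nu>) * t)"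
        using \<rho> that by (intro mult_left_mono) auto
      then show ?thesis by (simp add: \<phi>_def distrib_right)
    qed
    finally have f_le: "norm (f t) \<le> (norm (f 0) + C / (\<rho> - \<nu>)) * exp ((\<rho> - \<nu>) * t)" .
    have "y t = exp (c * of_real t) * f t"
      by (simp add: f_def mult.assoc[symmetric] exp_minus)
    then have "norm (y t) = exp (- \<rho> * t) * norm (f t)"
      by (simp add: norm_mult \<rho>_def)
    also have "\<dots> \<le> exp (- \<rho> * t) * ((norm (f 0) + C / (\<rho> - \<nu>)) * exp ((\<rho> - \<nu>) * t))"
      using f_le by (intro mult_left_mono) auto
    also have "\<dots> = (norm (f 0) + C / (\<rho> - \<nu>)) * (exp (- \<rho> * t) * exp ((\<rho> - \<nu>) * t))"
      by (simp only: mult_ac)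
    also have "exp (- \<rho> * t) * exp ((\<rho> - \<nu>) * t) = exp (- \<nu> * t)"
      by (simp add: exp_add[symmetric] algebra_simps)
    finally show ?thesis .
  qed
  then show ?thesis by blast
qed

text \<open>Induction on the degree: split off a root \<open>c\<close> of \<open>p\<close> and apply the induction hypothesis to
  \<open>y' - c y\<close>.\<close>

lemma stable_equation_decay:
  assumes "p \<noteq> 0" "\<And>z. poly p z = 0 \<Longrightarrow> Re z < 0"
  shows "\<exists>\<mu>>0. \<forall>Y. (\<forall>k t. (Y k has_vector_derivative Y (Suc k) t) (at t)) \<longrightarrow>
           (\<forall>k t. diff_op p Y k t = 0) \<longrightarrow> (\<forall>k. \<exists>C. \<forall>t\<ge>0. norm (Y k t) \<le> C * exp (- \<mu> * t))"
  using assms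
proof (induction "degree p" arbitrary: p)
  case 0
  then obtain c where c: "p = [:c:]" "c \<noteq> 0" by (metis degree_eq_zeroE pCons_0_0)
  \<comment> \<open>A nonzero constant annihilates only the zero function, so any positive rate
    serves.\<close>
  show ?case by (intro exI[of _ 1]) (auto simp: c diff_op_pCons intro!: exI[of _ 0])
next
  case (Suc n)
  have "\<not> constant (poly p)" using Suc.hyps(2) by (simp add: constant_degree)
  then obtain c where c: "poly p c = 0" using fundamental_theorem_of_algebra by blast
  then obtain r where r: "p = [:- c, 1:] * r" using poly_eq_0_iff_dvd by (metis dvdE)
  have r0: "r \<noteq> 0" using Suc.prems(1) r by auto
  have "degree p = 1 + degree r" unfolding r using r0 by (subst degree_mult_eq) auto
  then have deg: "n = degree r" using Suc.hyps(2) by simp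
  have roots: "Re z < 0" if "poly r z = 0" for z
    using Suc.prems(2)[of z] that by (simp add: r)
  obtain \<mu> where \<mu>: "\<mu> > 0" and IH: "\<And>Y k. (\<forall>k t. (Y k has_vector_derivative Y (Suc k) t) (at t)) \<Longrightarrow>
      (\<forall>k t. diff_op r Y k t = 0) \<Longrightarrow> \<exists>C. \<forall>t\<ge>0. norm (Y k t) \<le> C * exp (- \<mu> * t)"
    using Suc.hyps(1)[OF deg r0 roots] by blast
  \<comment> \<open>Halving gives a rate strictly below \<open>- Re c\<close>. Some decay is lost
    with each root, but multiple roots, whose solutions carry powers of \<open>t\<close>, are
    covered without special treatment.\<close>
  define \<nu> where "\<nu> = min \<mu> (- Re c) / 2"
  have Re: "Re c < 0" using Suc.prems(2) c by blast
  have \<nu>: "\<nu> > 0" "\<nu> \<le> \<mu>" "\<nu> < - Re c" using \<mu> Re by (auto simp: \<nu>_def)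
  show ?case
  proof (rule exI[of _ \<nu>], intro conjI allI impI)
    fix Y
    assume deriv: "\<forall>k t. (Y k has_vector_derivative Y (Suc k) t) (at t)"
      and ann: "\<forall>k t. diff_op p Y k t = 0"
    fix k
    define Z where "Z k t = Y (Suc k) t - c * Y k t" for k t
    have "(Z k has_vector_derivative Z (Suc k) t) (at t)" for k t
      unfolding Z_def[abs_def] using deriv by (auto intro!: derivative_eq_intros)
    moreover have "diff_op r Z k t = 0" for k t
      unfolding Z_def[abs_def] using ann
      by (simp add: diff_op_shift_diff r diff_op_linear_factor del: mult_pCons_left)
    ultimately have Z: "\<exists>C. \<forall>t\<ge>0. norm (Z k t) \<le> C * exp (- \<mu> * t)" for k
      using IH by blast
    show "\<exists>C. \<forall>t\<ge>0. norm (Y k t) \<le> C * exp (- \<nu> * t)"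
    \<comment> \<open>Only \<open>k = 0\<close> uses the differential equation; the higher
      derivatives follow from \<open>Y (Suc k) = c * Y k + Z k\<close>.\<close>
    proof (induction k)
      case 0
      obtain C where "\<And>t. t \<ge> 0 \<Longrightarrow> norm (Z 0 t) \<le> C * exp (- \<mu> * t)" using Z by blast
      moreover have "(Y 0 has_vector_derivative c * Y 0 t + Z 0 t) (at t)" for t
        using deriv by (simp add: Z_def)
      ultimately show ?case using \<nu> by (intro inhomogeneous_decay)
    next
      case (Suc k)
      obtain C where C: "\<And>t. t \<ge> 0 \<Longrightarrow> norm (Z k t) \<le> C * exp (- \<mu> * t)" using Z by blast
      have C0: "C \<ge> 0" using C[of 0] norm_ge_zero[of "Z k 0"] by (simp del: norm_ge_zero)
      obtain D where D: "\<And>t. t \<ge> 0 \<Longrightarrow> norm (Y k t) \<le> D * exp (- \<nu> * t)" using Suc.IH by blast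
      have "norm (Y (Suc k) t) \<le> (norm c * D + C) * exp (- \<nu> * t)" if t: "t \<ge> 0" for t
      proof -
        have "Y (Suc k) t = c * Y k t + Z k t" by (simp add: Z_def)
        then have "norm (Y (Suc k) t) \<le> norm c * norm (Y k t) + norm (Z k t)"
          by (metis norm_mult norm_triangle_ineq)
        also have "norm c * norm (Y k t) \<le> norm c * (D * exp (- \<nu> * t))"
          using D[OF t] by (intro mult_left_mono) auto
        also have "norm (Z k t) \<le> C * exp (- \<nu> * t)"
        proof (rule order_trans[OF C[OF t]])
          show "C * exp (- \<mu> * t) \<le> C * exp (- \<nu> * t)"
            using \<nu>(2) C0 t by (intro mult_left_mono) (auto intro: mult_right_mono)
        qed
        finally show ?thesis by (simp add: algebra_simps)
      qed
      then show ?case by blast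
    qed
  qed (use \<nu> in auto)
qed

section \<open>The matrix exponential of a companion matrix\<close>

lemma matrix_power_mult_vector:
  fixes A :: "real^'n^'n"
  shows "((((**) (t *\<^sub>R A)) ^^ k) (mat 1)) *v v = t ^ k *\<^sub>R ((((*v) A) ^^ k) v)"
proof (induction k)
  case (Suc k)
  then show ?case
    by (simp add: matrix_vector_mul_assoc[symmetric] scaleR_matrix_vector_assoc[symmetric]
        matrix_vector_mult_scaleR)
qed simp

text \<open>In each component the exponential becomes a real power series in \<open>t\<close>, so
  that it can be differentiated term by term. Summability follows from a bound \<open>K\<close> for
  multiplication by the matrix.\<close>

lemma matrix_exp_mult_vector_sums:
  fixes A :: "real^'n^'n"
  shows "(\<lambda>m. ((((*v) A) ^^ m) v) $ i / fact m * t ^ m) sums ((matrix_exp (t *\<^sub>R A) *v v) $ i)"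
proof -
  define P where "P k = (((**) (t *\<^sub>R A)) ^^ k) (mat 1)" for k
  have "linear ((**) (t *\<^sub>R A) :: real^'n^'n \<Rightarrow> real^'n^'n)"
    by (rule linearI) (simp_all add: matrix_add_ldistrib matrix_scalar_ac scalar_matrix_assoc)
  then obtain K where K: "K > 0" "\<And>B :: real^'n^'n. norm ((t *\<^sub>R A) ** B) \<le> K * norm B"
    using linear_bounded_pos by blast
  have "norm (P k) \<le> K ^ k * norm (mat 1 :: real^'n^'n)" for k
  proof (induction k)
    case (Suc k)
    have "norm (P (Suc k)) \<le> K * norm (P k)" using K(2) by (simp add: P_def)
    also have "\<dots> \<le> K * (K ^ k * norm (mat 1 :: real^'n^'n))"
      using Suc K(1) by (intro mult_left_mono) auto
    finally show ?case by (simp add: mult.assoc)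
  qed (simp add: P_def)
  then have "norm ((1 / fact k) *\<^sub>R P k) \<le> (K ^ k /\<^sub>R fact k) * norm (mat 1 :: real^'n^'n)" for k
    by (simp add: field_simps)
  then have "summable (\<lambda>k. (1 / fact k) *\<^sub>R P k)"
    by (intro summable_comparison_test'[OF summable_mult2[OF summable_exp_generic]])
  then have sums: "(\<lambda>k. (1 / fact k) *\<^sub>R P k) sums matrix_exp (t *\<^sub>R A)"
    unfolding matrix_exp_def P_def by (rule summable_sums)
  have "linear (\<lambda>B :: real^'n^'n. (B *v v) $ i)"
    by (rule linearI) (simp_all add: matrix_vector_mult_add_rdistrib scaleR_matrix_vector_assoc[symmetric])
  then have "bounded_linear (\<lambda>B :: real^'n^'n. (B *v v) $ i)" by (rule linear_conv_bounded_linear[THEN iffD1])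
  from bounded_linear.sums[OF this sums] show ?thesis
    by (simp add: P_def scaleR_matrix_vector_assoc[symmetric] matrix_power_mult_vector mult.commute)
qed

lemma matrix_exp_has_derivative:
  fixes A :: "real^'n^'n"
  shows "((\<lambda>t. (matrix_exp (t *\<^sub>R A) *v v) $ i) has_field_derivative
           (matrix_exp (t *\<^sub>R A) *v (A *v v)) $ i) (at t)"
proof -
  define c where "c m = ((((*v) A) ^^ m) v) $ i / fact m" for m
  have eq: "(\<lambda>t. (matrix_exp (t *\<^sub>R A) *v v) $ i) = (\<lambda>t. \<Sum>m. c m * t ^ m)"
    using matrix_exp_mult_vector_sums[of A v i] by (auto simp: c_def fun_eq_iff sums_iff)
  have "((\<lambda>t. \<Sum>m. c m * t ^ m) has_field_derivative (\<Sum>m. diffs c m * t ^ m)) (at t)"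
    using matrix_exp_mult_vector_sums[of A v i]
    by (intro termdiffs_strong_converges_everywhere) (auto simp: c_def sums_iff)
  also have "diffs c = (\<lambda>m. ((((*v) A) ^^ m) (A *v v)) $ i / fact m)"
    by (simp add: fun_eq_iff diffs_def c_def funpow_swap1 del: of_nat_Suc)
  also have "(\<Sum>m. ((((*v) A) ^^ m) (A *v v)) $ i / fact m * t ^ m) = (matrix_exp (t *\<^sub>R A) *v (A *v v)) $ i"
    using matrix_exp_mult_vector_sums[of A "A *v v" i t] by (simp add: sums_iff)
  finally show ?thesis unfolding eq .
qed

lemma matrix_exp_0: "matrix_exp ((0 :: real) *\<^sub>R A) *v v = v"
proof -
  have "(matrix_exp (0 *\<^sub>R A) *v v) $ i = v $ i" for i
    using matrix_exp_mult_vector_sums[of A v i 0] sums_unique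
      powser_sums_zero[of "\<lambda>m. ((((*v) A) ^^ m) v) $ i / fact m"]
    by (metis (no_types, lifting) div_by_1 fact_0 funpow_0)
  then show ?thesis by (simp add: vec_eq_iff)
qed

section \<open>Enumeration of the index type by positions\<close>

lemma pos_strict_mono: "i < j \<Longrightarrow> pos i < pos (j :: 'n::{finite,linorder})"
  unfolding pos_def by (rule psubset_card_mono) auto

lemma pos_inj: "pos i = pos j \<longleftrightarrow> i = (j :: 'n::{finite,linorder})"
  by (metis less_irrefl linorder_neqE pos_strict_mono)

lemma pos_less_card: "pos (i :: 'n::{finite,linorder}) < CARD('n)"
  unfolding pos_def by (rule psubset_card_mono) auto

lemma bij_betw_pos: "bij_betw pos (UNIV :: 'n::{finite,linorder} set) {..<CARD('n)}"
proof -
  have "inj (pos :: 'n \<Rightarrow> nat)" by (auto simp: inj_def pos_inj)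
  moreover have "pos ` (UNIV :: 'n set) \<subseteq> {..<CARD('n)}" using pos_less_card by auto
  ultimately show ?thesis
    by (simp add: bij_betw_def card_image card_subset_eq)
qed

lemma pos_surj: "k < CARD('n) \<Longrightarrow> \<exists>i :: 'n::{finite,linorder}. pos i = k"
  using bij_betw_pos unfolding bij_betw_def by (metis imageE lessThan_iff)

lemma sum_pos: "(\<Sum>i\<in>(UNIV :: 'n::{finite,linorder} set). f (pos i)) = (\<Sum>j<CARD('n). f j)"
  using sum.reindex_bij_betw[OF bij_betw_pos] .

lemma Suc_pos_Max: "Suc (pos (Max (UNIV :: 'n::{finite,linorder} set))) = CARD('n)"
proof -
  have "CARD('n) - 1 < CARD('n)" by simp
  then obtain i :: 'n where i: "pos i = CARD('n) - 1" using pos_surj by blast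
  have "i \<le> Max UNIV" by simp
  then have "pos i \<le> pos (Max (UNIV :: 'n set))"
    by (metis le_less pos_strict_mono)
  with i pos_less_card[of "Max (UNIV :: 'n set)"] show ?thesis by simp
qed

section \<open>Companion matrices\<close>

context
  fixes a :: "real poly" and A :: "((real, 'n::{finite,linorder}) vec, 'n) vec"
  assumes deg_a: "degree a = CARD('n)" and lead_a: "lead_coeff a = 1"
    and A: "A = companion_matrix a"
begin

lemma companion_mult_not_Max:
  assumes "i \<noteq> Max UNIV" "pos j = Suc (pos i)"
  shows "(A *v w) $ i = w $ j"
proof -
  have "(A *v w) $ i = (\<Sum>k\<in>UNIV. if k = j then w $ k else 0)"
    unfolding matrix_vector_mult_def using assms
    by (auto simp: A companion_matrix_def pos_inj[symmetric] intro!: sum.cong)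
  then show ?thesis by simp
qed

lemma companion_mult_Max: "(A *v w) $ Max UNIV = - (\<Sum>k\<in>UNIV. coeff a (pos k) * w $ k)"
  by (simp add: matrix_vector_mult_def A companion_matrix_def sum_negf)

text \<open>All rows but the last shift the coordinates, so \<open>pos i\<close> further
  applications of \<open>A\<close> bring coordinate \<open>i\<close> to the front. The vector
  recursion thereby reduces to the scalar sequence of first coordinates.\<close>

lemma companion_power_shift:
  assumes "pos (i0 :: 'n) = 0"
  shows "((((*v) A) ^^ k) v) $ i = ((((*v) A) ^^ (k + pos i)) v) $ i0"
proof (induction "pos i" arbitrary: i k)
  case 0
  then show ?case using assms pos_inj by (metis add_0_right)
next
  case (Suc p)
  then obtain j :: 'n where j: "pos j = p" using pos_surj[of p, where 'n = 'n] pos_less_card[of i] by auto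
  have "j \<noteq> Max UNIV"
    using Suc_pos_Max[where 'n = 'n] pos_less_card[of i] Suc.hyps(2) j by auto
  then have "(A *v ((((*v) A) ^^ k) v)) $ j = ((((*v) A) ^^ k) v) $ i"
    using Suc.hyps(2) j by (intro companion_mult_not_Max) auto
  then show ?case using Suc.hyps(1)[of j "Suc k"] j Suc.hyps(2)[symmetric] by simp
qed

lemma companion_recurrence:
  assumes "pos (i0 :: 'n) = 0"
  shows "(\<Sum>j\<le>CARD('n). coeff a j * ((((*v) A) ^^ (k + j)) v) $ i0) = 0"
proof -
  let ?d = "\<lambda>k. ((((*v) A) ^^ k) v) $ i0"
  have "?d (k + CARD('n)) = ((((*v) A) ^^ Suc k) v) $ Max UNIV"
    unfolding companion_power_shift[OF assms, of "Suc k"] Suc_pos_Max[symmetric] by simp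
  also have "\<dots> = - (\<Sum>i\<in>UNIV. coeff a (pos i) * ((((*v) A) ^^ k) v) $ (i :: 'n))"
    by (simp add: companion_mult_Max)
  also have "\<dots> = - (\<Sum>i\<in>(UNIV :: 'n set). coeff a (pos i) * ?d (k + pos i))"
    by (simp add: companion_power_shift[OF assms, of k])
  also have "\<dots> = - (\<Sum>j<CARD('n). coeff a j * ?d (k + j))"
    using sum_pos[where 'n = 'n, of "\<lambda>j. coeff a j * ?d (k + j)"] by simp
  finally show ?thesis
    using lead_a by (simp add: deg_a lessThan_Suc_atMost[symmetric])
qed

text \<open>This is the Cayley-Hamilton theorem for the companion matrix, read off from the scalar
  recurrence in each coordinate.\<close>

lemma companion_annihilated: "(\<Sum>j\<le>CARD('n). coeff a j *\<^sub>R ((((*v) A) ^^ (k + j)) v)) = 0"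
proof -
  obtain i0 :: 'n where i0: "pos i0 = 0" using pos_surj[of 0] by auto
  have "(\<Sum>j\<le>CARD('n). coeff a j * ((((*v) A) ^^ (k + j)) v) $ i) = 0" for i
  proof -
    have "((((*v) A) ^^ (k + j)) v) $ i = ((((*v) A) ^^ (k + pos i + j)) v) $ i0" for j
      using companion_power_shift[OF i0, of "k + j" v i] by (simp add: ac_simps)
    then show ?thesis using companion_recurrence[OF i0, of "k + pos i" v] by simp
  qed
  then show ?thesis by (simp add: vec_eq_iff)
qed

text \<open>The eigenvector is \<open>(1, z, z^2, ...)\<close>: the shifting rows multiply it by
  \<open>z\<close> for any \<open>z\<close>, and the last row does so because \<open>z\<close> is a
  root.\<close>

lemma root_imp_eigenvalue:
  assumes "poly (map_poly complex_of_real a) z = 0"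
  shows "eigenvalue (map_matrix complex_of_real A) z"
proof -
  define v where "v = ((\<chi> i. z ^ pos i) :: (complex, 'n) vec)"
  obtain i0 :: 'n where i0: "pos i0 = 0" using pos_surj[of 0] by auto
  have "v $ i0 = 1" by (simp add: v_def i0)
  then have v0: "v \<noteq> 0" by auto
  have "(map_matrix complex_of_real A *v v) $ i = z * v $ i" for i
  proof (cases "i = Max UNIV")
    case True
    have "(map_matrix complex_of_real A *v v) $ i =
        - (\<Sum>k\<in>(UNIV :: 'n set). of_real (coeff a (pos k)) * z ^ pos k)"
      by (simp add: True matrix_vector_mult_def map_matrix_def A companion_matrix_def sum_negf v_def)
    also have "(\<Sum>k\<in>(UNIV :: 'n set). of_real (coeff a (pos k)) * z ^ pos k) =
        (\<Sum>j<CARD('n). of_real (coeff a j) * z ^ j)"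
      by (rule sum_pos)
    also have "- \<dots> = z ^ CARD('n)"
    proof -
      have "0 = (\<Sum>j\<le>CARD('n). of_real (coeff a j) * z ^ j)"
        using assms by (simp add: poly_altdef deg_a coeff_map_poly degree_map_poly)
      then show ?thesis
        using lead_a by (simp add: deg_a lessThan_Suc_atMost[symmetric] add_eq_0_iff)
    qed
    also have "\<dots> = z * v $ i"
      unfolding Suc_pos_Max[where 'n = 'n, symmetric] by (simp add: v_def True)
    finally show ?thesis .
  next
    case False
    then have "Suc (pos i) < CARD('n)"
      using Suc_pos_Max[where 'n = 'n] pos_less_card[of i] pos_inj[of i "Max UNIV"]
      by (metis less_antisym Suc_inject Suc_lessI)
    then obtain j :: 'n where j: "pos j = Suc (pos i)" using pos_surj by blast
    have "(map_matrix complex_of_real A *v v) $ i = (\<Sum>k\<in>UNIV. if k = j then v $ k else 0)"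
      unfolding matrix_vector_mult_def using False j
      by (auto simp: A companion_matrix_def map_matrix_def pos_inj[symmetric] intro!: sum.cong)
    then show ?thesis by (simp add: v_def j)
  qed
  then have "map_matrix complex_of_real A *v v = z *s v" by (simp add: vec_eq_iff)
  with v0 show ?thesis unfolding eigenvalue_def by blast
qed

text \<open>\<open>Y v 0\<close> is the first coordinate \<open>y\<close> of
  \<open>exp (t A) v\<close>, and the coordinate at position \<open>j\<close> is the
  \<open>j\<close>-th derivative of \<open>y\<close>; this turns the inner product with
  \<open>coeff_vector b\<close> into \<open>b(D) y\<close>. The vector \<open>v\<close> stays free
  because the kernel and the contribution of the initial state are both of this form.\<close>

lemma companion_output_as_diff_op:
  assumes "pos (i0 :: 'n) = 0" "degree b < CARD('n)"
  defines "Y \<equiv> \<lambda>v k t. complex_of_real ((matrix_exp (t *\<^sub>R A) *v ((((*v) A) ^^ k) v)) $ i0)"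
  shows "(Y v k has_vector_derivative Y v (Suc k) t) (at t)"
    and "diff_op (map_poly complex_of_real a) (Y v) k t = 0"
    and "diff_op (map_poly complex_of_real b) (Y v) 0 t =
           complex_of_real (coeff_vector b \<bullet> (matrix_exp (t *\<^sub>R A) *v v))"
proof -
  show "(Y v k has_vector_derivative Y v (Suc k) t) (at t)"
    unfolding Y_def
    using has_vector_derivative_of_real[OF matrix_exp_has_derivative[of A "((((*v) A) ^^ k) v)" i0 t]]
    by simp
  show "diff_op (map_poly complex_of_real a) (Y v) k t = 0"
  proof -
    have "diff_op (map_poly complex_of_real a) (Y v) k t =
        of_real (\<Sum>j\<le>CARD('n). coeff a j * (matrix_exp (t *\<^sub>R A) *v ((((*v) A) ^^ (k + j)) v)) $ i0)"
      by (simp add: diff_op_def degree_map_poly deg_a coeff_map_poly Y_def add.commute)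
    also have "(\<Sum>j\<le>CARD('n). coeff a j * (matrix_exp (t *\<^sub>R A) *v ((((*v) A) ^^ (k + j)) v)) $ i0) =
        (matrix_exp (t *\<^sub>R A) *v (\<Sum>j\<le>CARD('n). coeff a j *\<^sub>R ((((*v) A) ^^ (k + j)) v))) $ i0"
      by (simp add: linear_sum[OF matrix_vector_mul_linear] matrix_vector_mult_scaleR)
    finally show ?thesis by (simp add: companion_annihilated)
  qed
  show "diff_op (map_poly complex_of_real b) (Y v) 0 t =
      complex_of_real (coeff_vector b \<bullet> (matrix_exp (t *\<^sub>R A) *v v))"
  proof -
    have "(matrix_exp (t *\<^sub>R A) *v v) $ i = (matrix_exp (t *\<^sub>R A) *v ((((*v) A) ^^ (pos i)) v)) $ i0" for i
    proof (rule sums_unique2[OF matrix_exp_mult_vector_sums])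
      have "((((*v) A) ^^ m) ((((*v) A) ^^ (pos i)) v)) $ i0 = ((((*v) A) ^^ m) v) $ i" for m
        unfolding companion_power_shift[OF assms(1), of m v i] by (simp add: funpow_add)
      then show "(\<lambda>m. ((((*v) A) ^^ m) v) $ i / fact m * t ^ m) sums
          ((matrix_exp (t *\<^sub>R A) *v ((((*v) A) ^^ (pos i)) v)) $ i0)"
        using matrix_exp_mult_vector_sums[of A "((((*v) A) ^^ (pos i)) v)" i0 t] by simp
    qed
    then have "complex_of_real (coeff_vector b \<bullet> (matrix_exp (t *\<^sub>R A) *v v)) =
        (\<Sum>i\<in>(UNIV :: 'n set). of_real (coeff b (pos i)) * Y v (pos i) t)"
      by (simp add: inner_vec_def coeff_vector_def Y_def)
    also have "\<dots> = (\<Sum>j<CARD('n). of_real (coeff b j) * Y v j t)"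
      by (rule sum_pos)
    also have "\<dots> = (\<Sum>j\<le>CARD('n). of_real (coeff b j) * Y v j t)"
      using assms(2) by (simp add: lessThan_Suc_atMost[symmetric] coeff_eq_0)
    also have "\<dots> = diff_op (map_poly complex_of_real b) (Y v) 0 t"
      using assms(2) by (subst diff_op_eq[of _ "CARD('n)"]) (auto simp: coeff_map_poly degree_map_poly)
    finally show ?thesis ..
  qed
qed

end

section \<open>Decay of the kernel and of its antiderivative\<close>

lemma diff_op_decay:
  assumes "\<forall>k. \<exists>C. \<forall>t\<ge>0. norm (Y k t) \<le> C * exp (- \<mu> * t)"
  shows "\<exists>C. \<forall>t\<ge>0. norm (diff_op p Y k t) \<le> C * exp (- \<mu> * t)"
proof -
  obtain C where C: "\<And>k t. t \<ge> 0 \<Longrightarrow> norm (Y k t) \<le> C k * exp (- \<mu> * t)"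
    using assms by metis
  have "norm (diff_op p Y k t) \<le> (\<Sum>j\<le>degree p. norm (coeff p j) * C (j + k)) * exp (- \<mu> * t)"
    if "t \<ge> 0" for t
    unfolding diff_op_def sum_distrib_right
    by (rule sum_norm_le)
       (use C[OF that] in \<open>auto simp: norm_mult mult.assoc intro!: mult_left_mono\<close>)
  then show ?thesis by blast
qed

text \<open>\<open>\<Phi>\<close> is an explicit antiderivative of \<open>\<kappa>(t) = e\<^sup>-\<^sup>i\<^sup>\<omega>\<^sup>t g(t)\<close>, with \<open>g\<close> the kernel of the process: if
  \<open>(z - s) r(z) = a(s) b(z) - b(s) a(z)\<close> for \<open>s = i\<omega>\<close> and \<open>a(D) y = 0\<close>, then \<open>e\<^sup>-\<^sup>s\<^sup>t r(D) y\<close> has derivative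
  \<open>a(s) e\<^sup>-\<^sup>s\<^sup>t b(D) y\<close>.\<close>

lemma companion_kernel:
  fixes a b :: "real poly" and A :: "((real, 'n::{finite,linorder}) vec, 'n) vec" and \<omega> :: real
  assumes a: "degree a = CARD('n)" "lead_coeff a = 1" and b: "degree b < CARD('n)"
    and A: "A = companion_matrix a"
    and eigenvalues: "\<forall>l. eigenvalue (map_matrix complex_of_real A) l \<longrightarrow> Re l < 0"
  defines "\<kappa> \<equiv> \<lambda>t. exp (- (\<i> * of_real \<omega> * of_real t)) *
      complex_of_real (coeff_vector b \<bullet> (matrix_exp (t *\<^sub>R A) *v last_unit_vector))"
  shows "\<exists>C \<mu> \<kappa>' \<Phi>. \<mu> > 0 \<and> C > 0 \<and>
     (\<forall>t. (\<Phi> has_vector_derivative \<kappa> t) (at t)) \<and> (\<forall>t. (\<kappa> has_vector_derivative \<kappa>' t) (at t)) \<and>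
     (\<forall>t\<ge>0. norm (\<kappa> t) \<le> C * exp (- \<mu> * t)) \<and> (\<forall>t\<ge>0. norm (\<kappa>' t) \<le> C * exp (- \<mu> * t)) \<and>
     (\<forall>t\<ge>0. norm (\<Phi> t) \<le> C * exp (- \<mu> * t)) \<and> \<Phi> 0 = - transfer_function a b \<omega> \<and>
     (\<forall>v t. t \<ge> 0 \<longrightarrow> \<bar>coeff_vector b \<bullet> (matrix_exp (t *\<^sub>R A) *v v)\<bar> \<le> C * exp (- \<mu> * t) * norm v)"
proof -
  define P Q where "P = map_poly complex_of_real a" and "Q = map_poly complex_of_real b"
  define s where "s = \<i> * complex_of_real \<omega>"
  have roots: "Re z < 0" if "poly P z = 0" for z
    using eigenvalues root_imp_eigenvalue[OF a A] that by (simp add: P_def)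
  have Ps: "poly P s \<noteq> 0" using roots[of s] by (auto simp: s_def)
  have degP: "degree P = CARD('n)" by (simp add: P_def degree_map_poly a)
  have degQ: "degree Q < CARD('n)" using b by (simp add: Q_def degree_map_poly)
  have P0: "P \<noteq> 0" using degP by auto
  obtain i0 :: 'n where i0: "pos i0 = 0" using pos_surj[of 0] by auto
  define Y where "Y v k t = complex_of_real ((matrix_exp (t *\<^sub>R A) *v ((((*v) A) ^^ k) v)) $ i0)" for v k t
  have Y: "(Y v k has_vector_derivative Y v (Suc k) t) (at t)" "diff_op P (Y v) k t = 0"
    "diff_op Q (Y v) 0 t = complex_of_real (coeff_vector b \<bullet> (matrix_exp (t *\<^sub>R A) *v v))" for v k t
    using companion_output_as_diff_op[OF a A i0 b] unfolding Y_def P_def Q_def by auto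
  obtain \<mu> where \<mu>: "\<mu> > 0" and stable: "\<And>Y. (\<forall>k t. (Y k has_vector_derivative Y (Suc k) t) (at t)) \<Longrightarrow>
      (\<forall>k t. diff_op P Y k t = 0) \<Longrightarrow> \<forall>k. \<exists>C. \<forall>t\<ge>0. norm (Y k t) \<le> C * exp (- \<mu> * t)"
    using stable_equation_decay[OF P0 roots] by blast
  have dec: "\<forall>k. \<exists>C. \<forall>t\<ge>0. norm (Y v k t) \<le> C * exp (- \<mu> * t)" for v
    by (rule stable) (simp_all add: Y(1,2))
  let ?e = "last_unit_vector :: (real, 'n) vec"
  have "poly (smult (poly P s) Q - smult (poly Q s) P) s = 0" by simp
  then obtain R where R: "smult (poly P s) Q - smult (poly Q s) P = [:- s, 1:] * R"
    using poly_eq_0_iff_dvd by (metis dvdE)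
  have degR: "degree R < CARD('n)"
  proof (cases "R = 0")
    case False
    then have "Suc (degree R) = degree ([:- s, 1:] * R)" by (subst degree_mult_eq) auto
    also have "\<dots> \<le> CARD('n)"
      unfolding R[symmetric] using degP degQ
      by (intro degree_diff_le order_trans[OF degree_smult_le]) auto
    finally show ?thesis by simp
  qed simp
  \<comment> \<open>The coefficient of degree \<open>CARD('n)\<close> comes from the monic
    \<open>P\<close> alone, as \<open>Q\<close> has smaller degree.\<close>
  have coeffR: "coeff R (CARD('n) - 1) = - poly Q s"
  proof -
    have "coeff ([:- s, 1:] * R) (CARD('n)) = coeff R (CARD('n) - 1)"
      using degR by (cases "CARD('n)") (auto simp: coeff_eq_0)
    moreover have "coeff (smult (poly P s) Q - smult (poly Q s) P) (CARD('n)) = - poly Q s"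
      using degQ a by (simp add: coeff_eq_0 P_def coeff_map_poly)
    ultimately show ?thesis using R by simp
  qed
  define E where "E t = exp (- (s * of_real t))" for t :: real
  have E': "(E has_vector_derivative - s * E t) (at t)" for t
    unfolding E_def[abs_def]
    by (rule derivative_eq_intros refl has_vector_derivative_real_field | simp)+
  have normE: "norm (E t) = 1" for t by (simp add: E_def s_def)
  define \<Phi> where "\<Phi> t = E t * diff_op R (Y ?e) 0 t / poly P s" for t
  define \<kappa>' where "\<kappa>' t = E t * diff_op ([:- s, 1:] * Q) (Y ?e) 0 t" for t
  have \<kappa>_eq: "\<kappa> t = E t * diff_op Q (Y ?e) 0 t" for t
    by (simp add: \<kappa>_def E_def Y(3) s_def)
  have D: "(diff_op p (Y v) k has_vector_derivative diff_op p (Y v) (Suc k) t) (at t)" for p v k t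
    by (rule diff_op_has_vector_derivative) (rule Y(1))
  have \<Phi>': "(\<Phi> has_vector_derivative \<kappa> t) (at t)" for t
  proof -
    have "(\<Phi> has_vector_derivative (E t * diff_op R (Y ?e) (Suc 0) t + - s * E t * diff_op R (Y ?e) 0 t) / poly P s) (at t)"
      unfolding \<Phi>_def[abs_def] by (intro has_vector_derivative_divide has_vector_derivative_mult E' D)
    also have "E t * diff_op R (Y ?e) (Suc 0) t + - s * E t * diff_op R (Y ?e) 0 t =
        E t * diff_op ([:- s, 1:] * R) (Y ?e) 0 t"
      by (simp only: diff_op_linear_factor) (simp add: algebra_simps)
    also have "diff_op ([:- s, 1:] * R) (Y ?e) 0 t = poly P s * diff_op Q (Y ?e) 0 t"
    proof -
      have eq: "[:- s, 1:] * R = smult (poly P s) Q + smult (- poly Q s) P" using R by simp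
      show ?thesis unfolding eq by (simp only: diff_op_add diff_op_smult Y(2)) simp
    qed
    finally show ?thesis using Ps by (simp add: \<kappa>_eq)
  qed
  have \<kappa>': "(\<kappa> has_vector_derivative \<kappa>' t) (at t)" for t
  proof -
    have "((\<lambda>t. E t * diff_op Q (Y ?e) 0 t) has_vector_derivative
        (E t * diff_op Q (Y ?e) (Suc 0) t + - s * E t * diff_op Q (Y ?e) 0 t)) (at t)"
      by (intro has_vector_derivative_mult E' D)
    also have "E t * diff_op Q (Y ?e) (Suc 0) t + - s * E t * diff_op Q (Y ?e) 0 t = \<kappa>' t"
      unfolding \<kappa>'_def by (simp only: diff_op_linear_factor) (simp add: algebra_simps)
    finally show ?thesis unfolding \<kappa>_eq[abs_def] .
  qed
  have \<Phi>0: "\<Phi> 0 = - transfer_function a b \<omega>"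
  proof -
    \<comment> \<open>At time \<open>0\<close> the derivatives of the first coordinate are the
      coordinates of the last unit vector. Hence only the top coefficient of \<open>R\<close>, which
      is \<open>- poly Q s\<close>, survives in \<open>\<Phi> 0\<close>.\<close>
    have Y0: "Y ?e j 0 = (if j = CARD('n) - 1 then 1 else 0)" if j: "j < CARD('n)" for j
    proof -
      obtain i :: 'n where i: "pos i = j" using pos_surj[OF j] by blast
      have "((((*v) A) ^^ j) ?e) $ i0 = ?e $ i"
        using companion_power_shift[OF a A i0, of 0 ?e i] i by simp
      moreover have "i = Max UNIV \<longleftrightarrow> j = CARD('n) - 1"
        using Suc_pos_Max[where 'n = 'n] i pos_inj[of i "Max UNIV"] by auto
      ultimately show ?thesis
        unfolding Y_def matrix_exp_0 by (simp add: last_unit_vector_def axis_def)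
    qed
    have "diff_op R (Y ?e) 0 0 = (\<Sum>j\<le>CARD('n) - 1. coeff R j * Y ?e j 0)"
      using degR by (subst diff_op_eq[of _ "CARD('n) - 1"]) auto
    also have "\<dots> = (\<Sum>j\<le>CARD('n) - 1. if j = CARD('n) - 1 then coeff R j else 0)"
      by (intro sum.cong) (auto simp: Y0 le_less_trans[of _ "CARD('n) - 1"])
    also have "\<dots> = - poly Q s" using coeffR by simp
    finally show ?thesis
      by (simp add: \<Phi>_def E_def transfer_function_def P_def Q_def s_def)
  qed
  have decay: "\<exists>C. \<forall>t\<ge>0. norm (E t * diff_op p (Y ?e) 0 t) \<le> C * exp (- \<mu> * t)" for p
    using diff_op_decay[OF dec, of p ?e 0] by (simp add: norm_mult normE)
  obtain C1 where C1: "\<And>t. t \<ge> 0 \<Longrightarrow> norm (\<kappa> t) \<le> C1 * exp (- \<mu> * t)"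
    using decay[of Q] unfolding \<kappa>_eq by blast
  obtain C2 where C2: "\<And>t. t \<ge> 0 \<Longrightarrow> norm (\<kappa>' t) \<le> C2 * exp (- \<mu> * t)"
    using decay[of "[:- s, 1:] * Q"] unfolding \<kappa>'_def by blast
  obtain C3 where C3: "\<And>t. t \<ge> 0 \<Longrightarrow> norm (E t * diff_op R (Y ?e) 0 t) \<le> C3 * exp (- \<mu> * t)"
    using decay[of R] by blast
  have C3': "norm (\<Phi> t) \<le> C3 / norm (poly P s) * exp (- \<mu> * t)" if "t \<ge> 0" for t
    using C3[OF that] Ps by (simp add: \<Phi>_def norm_divide divide_right_mono)
  have "\<exists>c. \<forall>t\<ge>0. \<bar>coeff_vector b \<bullet> (matrix_exp (t *\<^sub>R A) *v v)\<bar> \<le> c * exp (- \<mu> * t)" for v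
    using diff_op_decay[OF dec, of Q v 0] unfolding Y(3) by simp
  then obtain c where c: "\<And>v t. t \<ge> 0 \<Longrightarrow> \<bar>coeff_vector b \<bullet> (matrix_exp (t *\<^sub>R A) *v v)\<bar> \<le> c v * exp (- \<mu> * t)"
    by metis
  \<comment> \<open>The constants \<open>c v\<close> depend on \<open>v\<close>; expansion in the
    standard basis makes the bound uniform.\<close>
  define C4 where "C4 = (\<Sum>k\<in>(UNIV :: 'n set). c (axis k 1))"
  have C4: "\<bar>coeff_vector b \<bullet> (matrix_exp (t *\<^sub>R A) *v v)\<bar> \<le> C4 * exp (- \<mu> * t) * norm v" if t: "t \<ge> 0" for t v
  proof -
    have "v = (\<Sum>k\<in>UNIV. v $ k *\<^sub>R axis k 1)"
      by (simp add: vec_eq_iff axis_def if_distrib cong: if_cong)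
    then have "coeff_vector b \<bullet> (matrix_exp (t *\<^sub>R A) *v v) =
        coeff_vector b \<bullet> (matrix_exp (t *\<^sub>R A) *v (\<Sum>k\<in>UNIV. v $ k *\<^sub>R axis k 1))" by simp
    also have "\<dots> = (\<Sum>k\<in>UNIV. v $ k * (coeff_vector b \<bullet> (matrix_exp (t *\<^sub>R A) *v axis k 1)))"
      by (simp add: linear_sum[OF matrix_vector_mul_linear] matrix_vector_mult_scaleR inner_sum_right)
    also have "\<bar>\<dots>\<bar> \<le> (\<Sum>k\<in>UNIV. norm v * (c (axis k 1) * exp (- \<mu> * t)))"
      using c[OF t] unfolding real_norm_def[symmetric]
      by (intro sum_norm_le) (auto simp: abs_mult component_le_norm_cart intro!: mult_mono)
    finally show ?thesis by (simp add: C4_def sum_distrib_right sum_distrib_left mult_ac)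
  qed
  define C where "C = \<bar>C1\<bar> + \<bar>C2\<bar> + \<bar>C3 / norm (poly P s)\<bar> + \<bar>C4\<bar> + 1"
  have le: "x * exp (- \<mu> * t) \<le> C * exp (- \<mu> * t)" if "x \<le> C" for x t
    using that by (intro mult_right_mono) auto
  have C_ge: "C1 \<le> C" "C2 \<le> C" "C3 / norm (poly P s) \<le> C" "C4 \<le> C" "C > 0"
    unfolding C_def by linarith+
  have "norm (\<kappa> t) \<le> C * exp (- \<mu> * t)" "norm (\<kappa>' t) \<le> C * exp (- \<mu> * t)"
    "norm (\<Phi> t) \<le> C * exp (- \<mu> * t)" if "t \<ge> 0" for t
    using C1[OF that] C2[OF that] C3'[OF that] C_ge(1-3)[THEN le, of t] by linarith+
  moreover have "\<bar>coeff_vector b \<bullet> (matrix_exp (t *\<^sub>R A) *v v)\<bar> \<le> C * exp (- \<mu> * t) * norm v" if "t \<ge> 0" for t v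
    by (rule order_trans[OF C4[OF that] mult_right_mono[OF le[OF C_ge(4)] norm_ge_zero]])
  ultimately show ?thesis
    using \<mu> \<Phi>' \<kappa>' \<Phi>0 C_ge(5)
    by - (rule exI[of _ C], rule exI[of _ \<mu>], rule exI[of _ \<kappa>'], rule exI[of _ \<Phi>], auto)
qed

section \<open>The trapezoidal rule\<close>

text \<open>The phase is split off from the weight because it is later absorbed into the
  kernel.\<close>

definition trapezoid_factor :: "nat \<Rightarrow> (nat \<Rightarrow> real) \<Rightarrow> nat \<Rightarrow> real" where
  "trapezoid_factor N x j =
     (if j = 0 then (x 1 - x 0) / 2
      else if j = N - 1 then (x (N - 1) - x (N - 2)) / 2
      else (x (j + 1) - x (j - 1)) / 2)"

lemma trapezoid_weight_eq:
  "trapezoid_weight \<omega> N x j = of_real (trapezoid_factor N x j) * exp (- (\<i> * of_real \<omega> * of_real (x j)))"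
  by (simp add: trapezoid_weight_def trapezoid_factor_def)

text \<open>Regrouping of nodes into cells: an inner node collects half the length of both adjacent
  cells, an end node that of its only one. The \<open>Suc n\<close> nodes bound \<open>n\<close>
  cells.\<close>

lemma sum_trapezoid_factor:
  fixes v :: "nat \<Rightarrow> 'b::real_vector"
  assumes "n \<ge> 1"
  shows "(\<Sum>j<Suc n. trapezoid_factor (Suc n) x j *\<^sub>R v j) =
    (\<Sum>i<n. ((x (Suc i) - x i) / 2) *\<^sub>R (v i + v (Suc i)))"
proof -
  define d where "d i = (x (Suc i) - x i) / 2" for i
  have "trapezoid_factor (Suc n) x j = (if j < n then d j else 0) + (case j of 0 \<Rightarrow> 0 | Suc i \<Rightarrow> d i)"
    if "j < Suc n" for j
  proof (cases j)
    case 0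
    then show ?thesis using assms by (simp add: trapezoid_factor_def d_def)
  next
    case (Suc i)
    show ?thesis
    proof (cases "j = n")
      case True
      with Suc have "n = Suc i" by simp
      with True Suc show ?thesis by (simp add: trapezoid_factor_def d_def)
    next
      case False
      with that Suc show ?thesis by (simp add: trapezoid_factor_def d_def field_simps)
    qed
  qed
  then have "(\<Sum>j<Suc n. trapezoid_factor (Suc n) x j *\<^sub>R v j) =
      (\<Sum>j<Suc n. (if j < n then d j else 0) *\<^sub>R v j) + (\<Sum>j<Suc n. (case j of 0 \<Rightarrow> 0 | Suc i \<Rightarrow> d i) *\<^sub>R v j)"
    unfolding sum.distrib[symmetric] scaleR_left_distrib[symmetric] by (intro sum.cong) auto
  also have "(\<Sum>j<Suc n. (if j < n then d j else 0) *\<^sub>R v j) = (\<Sum>i<n. d i *\<^sub>R v i)" by simp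
  also have "(\<Sum>j<Suc n. (case j of 0 \<Rightarrow> 0 | Suc i \<Rightarrow> d i) *\<^sub>R v j) = (\<Sum>i<n. d i *\<^sub>R v (Suc i))"
    by (subst sum.lessThan_Suc_shift) simp
  finally show ?thesis by (simp add: d_def scaleR_right_distrib sum.distrib)
qed

lemma is_grid_less: "is_grid a b n x \<Longrightarrow> i < j \<Longrightarrow> j \<le> n \<Longrightarrow> x i < x j"
proof (induction j)
  case (Suc j)
  then have "x j < x (Suc j)" by (simp add: is_grid_def)
  with Suc show ?case by (cases "i = j") auto
qed simp

lemma is_grid_le: "is_grid a b n x \<Longrightarrow> i \<le> j \<Longrightarrow> j \<le> n \<Longrightarrow> x i \<le> x j"
  using is_grid_less[of a b n x i j] by (cases "i = j") auto

lemma is_grid_bounds: "is_grid a b n x \<Longrightarrow> i \<le> n \<Longrightarrow> a \<le> x i \<and> x i \<le> b"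
  using is_grid_le[of a b n x 0 i] is_grid_le[of a b n x i n] by (auto simp: is_grid_def)

text \<open>It replaces the length of a cell by an increment of an exponential, so that sums of
  \<open>d * exp (- \<mu> * y)\<close> telescope. The factor \<open>exp \<mu>\<close> pays for
  \<open>exp (- \<mu> * d)\<close> and is where \<open>d \<le> 1\<close> enters.\<close>

lemma exp_increment_ge:
  fixes \<mu> d :: real
  assumes "\<mu> > 0" "0 \<le> d" "d \<le> 1"
  shows "d \<le> exp \<mu> / \<mu> * (1 - exp (- \<mu> * d))"
proof -
  have "\<mu> * d \<le> exp (\<mu> * d) - 1" using exp_ge_add_one_self[of "\<mu> * d"] by linarith
  then have "\<mu> * d * exp (- \<mu> * d) \<le> (exp (\<mu> * d) - 1) * exp (- \<mu> * d)"
    by (intro mult_right_mono) auto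
  also have "\<dots> = 1 - exp (- \<mu> * d)" by (simp add: algebra_simps exp_add[symmetric])
  finally have 1: "\<mu> * d * exp (- \<mu> * d) \<le> 1 - exp (- \<mu> * d)" .
  have "exp \<mu> * exp (- \<mu> * d) \<ge> 1"
    using assms by (simp add: exp_add[symmetric] algebra_simps mult_left_le)
  then have "\<mu> * d * 1 \<le> \<mu> * d * (exp \<mu> * exp (- \<mu> * d))"
    using assms by (intro mult_left_mono) auto
  also have "\<dots> \<le> exp \<mu> * (1 - exp (- \<mu> * d))"
    using mult_left_mono[OF 1, of "exp \<mu>"] by (simp add: mult_ac)
  finally show ?thesis using assms by (simp add: field_simps)
qed

text \<open>The bound is free of \<open>T\<close> and of the number of nodes. It controls the
  contribution of the initial state, which division by \<open>sqrt T\<close> then makes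
  vanish.\<close>

lemma sum_trapezoid_factor_exp:
  assumes "is_grid 0 T n x" "n \<ge> 1" "\<mu> > 0" "\<And>i. i < n \<Longrightarrow> x (Suc i) - x i \<le> 1"
  shows "(\<Sum>j<Suc n. \<bar>trapezoid_factor (Suc n) x j\<bar> * exp (- \<mu> * x j)) \<le> exp \<mu> / \<mu>"
proof -
  have nonneg: "trapezoid_factor (Suc n) x j \<ge> 0" if "j < Suc n" for j
    using assms(2) that is_grid_le[OF assms(1), of 0 1] is_grid_le[OF assms(1), of "n - 1" n]
      is_grid_le[OF assms(1), of "j - 1" "j + 1"]
    by (auto simp: trapezoid_factor_def numeral_2_eq_2)
  have "(\<Sum>j<Suc n. \<bar>trapezoid_factor (Suc n) x j\<bar> * exp (- \<mu> * x j)) =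
      (\<Sum>j<Suc n. trapezoid_factor (Suc n) x j *\<^sub>R exp (- \<mu> * x j))"
    using nonneg by (intro sum.cong) auto
  also have "\<dots> = (\<Sum>i<n. ((x (Suc i) - x i) / 2) *\<^sub>R (exp (- \<mu> * x i) + exp (- \<mu> * x (Suc i))))"
    by (rule sum_trapezoid_factor[OF assms(2)])
  also have "\<dots> \<le> (\<Sum>i<n. exp \<mu> / \<mu> * (exp (- \<mu> * x i) - exp (- \<mu> * x (Suc i))))"
  proof (rule sum_mono)
    fix i assume "i \<in> {..<n}"
    then have i: "i < n" by simp
    define d where "d = x (Suc i) - x i"
    have d: "0 \<le> d" "d \<le> 1" using is_grid_le[OF assms(1), of i "Suc i"] assms(4)[OF i] i by (auto simp: d_def)
    have e: "exp (- \<mu> * x (Suc i)) = exp (- \<mu> * x i) * exp (- \<mu> * d)"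
      by (simp add: d_def exp_add[symmetric] algebra_simps)
    have "exp (- \<mu> * d) \<le> 1" using d assms(3) by simp
    then have "exp (- \<mu> * x i) * exp (- \<mu> * d) \<le> exp (- \<mu> * x i)"
      by (simp add: mult_left_le)
    then have "(d / 2) * (exp (- \<mu> * x i) + exp (- \<mu> * x (Suc i))) \<le> (d / 2) * (2 * exp (- \<mu> * x i))"
      unfolding e using d by (intro mult_left_mono) linarith+
    also have "\<dots> = exp (- \<mu> * x i) * d" by simp
    also have "\<dots> \<le> exp (- \<mu> * x i) * (exp \<mu> / \<mu> * (1 - exp (- \<mu> * d)))"
      using exp_increment_ge[OF assms(3) d] by (intro mult_left_mono) auto
    also have "\<dots> = exp \<mu> / \<mu> * (exp (- \<mu> * x i) - exp (- \<mu> * x (Suc i)))"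
      unfolding e by (simp add: algebra_simps)
    finally show "((x (Suc i) - x i) / 2) *\<^sub>R (exp (- \<mu> * x i) + exp (- \<mu> * x (Suc i)))
        \<le> exp \<mu> / \<mu> * (exp (- \<mu> * x i) - exp (- \<mu> * x (Suc i)))"
      by (simp add: d_def)
  qed
  also have "\<dots> = exp \<mu> / \<mu> * (exp (- \<mu> * x 0) - exp (- \<mu> * x n))"
    by (simp only: sum_distrib_left[symmetric] sum_lessThan_telescope'[of "\<lambda>i. exp (- \<mu> * x i)"])
  also have "\<dots> \<le> exp \<mu> / \<mu> * 1"
    using assms(1,3) by (intro mult_left_mono) (auto simp: is_grid_def)
  finally show ?thesis by simp
qed

lemma vector_mean_value_bound:
  fixes f :: "real \<Rightarrow> 'b::real_normed_vector"
  assumes "a \<le> b" "\<And>t. a \<le> t \<Longrightarrow> t \<le> b \<Longrightarrow> (f has_vector_derivative f' t) (at t)"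
    "\<And>t. a \<le> t \<Longrightarrow> t \<le> b \<Longrightarrow> norm (f' t) \<le> B"
  shows "norm (f b - f a) \<le> B * (b - a)"
proof (cases "a = b")
  case False
  have "norm (f b - f a) \<le> B * b - B * a"
  proof (rule differentiable_bound_general[where f' = f' and \<phi>' = "\<lambda>_. B"])
    show "continuous_on {a..b} f"
      using assms(2) by (auto intro!: continuous_at_imp_continuous_on has_vector_derivative_continuous)
    show "((*) B has_vector_derivative B) (at t)" for t
      by (auto intro!: derivative_eq_intros simp: has_real_derivative_iff_has_vector_derivative[symmetric])
  qed (use assms False in \<open>auto intro!: continuous_intros\<close>)
  then show ?thesis by (simp add: algebra_simps)
qed simp

context

  \<comment> \<open>Quadrature error for an exponentially decaying kernel\<close>
  fixes \<Phi> \<kappa> \<kappa>' :: "real \<Rightarrow> complex" and C \<mu> :: real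
  assumes \<mu>: "\<mu> > 0" and C: "C > 0"
    and \<Phi>': "\<And>t. (\<Phi> has_vector_derivative \<kappa> t) (at t)"
    and \<kappa>': "\<And>t. (\<kappa> has_vector_derivative \<kappa>' t) (at t)"
    and \<kappa>_le: "\<And>t. t \<ge> 0 \<Longrightarrow> norm (\<kappa> t) \<le> C * exp (- \<mu> * t)"
    and \<kappa>'_le: "\<And>t. t \<ge> 0 \<Longrightarrow> norm (\<kappa>' t) \<le> C * exp (- \<mu> * t)"
begin

text \<open>The bound for \<open>\<kappa>'\<close> is a Lipschitz constant \<open>K\<close> of
  \<open>\<kappa>\<close> beyond \<open>a\<close>. The trapezoidal value and the integral differ
  from the left rectangle by at most \<open>K / 2\<close> and \<open>K\<close> times the squared
  length; the sum is rounded up to \<open>2 * K\<close>.\<close>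

lemma trapezoid_interval_error:
  assumes "0 \<le> a" "a \<le> b"
  shows "norm (((b - a) / 2) *\<^sub>R (\<kappa> a + \<kappa> b) - (\<Phi> b - \<Phi> a)) \<le> 2 * C * exp (- \<mu> * a) * (b - a)\<^sup>2"
proof -
  define K where "K = C * exp (- \<mu> * a)"
  have K: "K \<ge> 0" using C by (simp add: K_def)
  have lip: "norm (\<kappa> t - \<kappa> a) \<le> K * (t - a)" if "a \<le> t" for t
  proof (rule vector_mean_value_bound[OF that])
    show "(\<kappa> has_vector_derivative \<kappa>' s) (at s)" for s by (rule \<kappa>')
    fix s assume s: "a \<le> s"
    then have "norm (\<kappa>' s) \<le> C * exp (- \<mu> * s)" using assms by (intro \<kappa>'_le) simp
    also have "\<dots> \<le> K" unfolding K_def using s C \<mu> by (intro mult_left_mono) auto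
    finally show "norm (\<kappa>' s) \<le> K" .
  qed
  have "norm ((\<Phi> b - b *\<^sub>R \<kappa> a) - (\<Phi> a - a *\<^sub>R \<kappa> a)) \<le> K * (b - a) * (b - a)"
  proof (rule vector_mean_value_bound[OF assms(2)])
    show "((\<lambda>t. \<Phi> t - t *\<^sub>R \<kappa> a) has_vector_derivative (\<kappa> t - \<kappa> a)) (at t)" for t
      using \<Phi>'[of t] by (auto intro!: derivative_eq_intros)
    fix t assume t: "a \<le> t" "t \<le> b"
    have "K * (t - a) \<le> K * (b - a)" using t K by (intro mult_left_mono) auto
    with lip[OF t(1)] show "norm (\<kappa> t - \<kappa> a) \<le> K * (b - a)" by linarith
  qed
  moreover have "norm (((b - a) / 2) *\<^sub>R (\<kappa> b - \<kappa> a)) \<le> (b - a) / 2 * (K * (b - a))"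
    using lip[OF assms(2)] assms(2) by (simp add: mult_left_mono)
  moreover have "((b - a) / 2) *\<^sub>R (\<kappa> a + \<kappa> b) - (\<Phi> b - \<Phi> a) =
      ((b - a) / 2) *\<^sub>R (\<kappa> b - \<kappa> a) - ((\<Phi> b - b *\<^sub>R \<kappa> a) - (\<Phi> a - a *\<^sub>R \<kappa> a))"
    by (simp add: scaleR_conv_of_real field_simps)
  moreover have "(b - a) / 2 * (K * (b - a)) + K * (b - a) * (b - a) \<le> 2 * K * (b - a)\<^sup>2"
  proof -
    have "0 \<le> K * (b - a)\<^sup>2" using K by simp
    moreover have "(b - a) / 2 * (K * (b - a)) + K * (b - a) * (b - a) = 3 / 2 * (K * (b - a)\<^sup>2)"
      by (simp add: power2_eq_square)
    ultimately show ?thesis by linarith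
  qed
  ultimately have "norm (((b - a) / 2) *\<^sub>R (\<kappa> a + \<kappa> b) - (\<Phi> b - \<Phi> a)) \<le> 2 * K * (b - a)\<^sup>2"
    by (smt (verit) norm_triangle_ineq4)
  then show ?thesis by (simp add: K_def mult.assoc)
qed

text \<open>The errors of the single cells are bounded by the increments of a bounded nondecreasing
  function \<open>B\<close>, so that their sum telescopes.\<close>

lemma trapezoid_tail_sum:
  assumes grid: "is_grid 0 T n x" and h: "\<And>i. i < n \<Longrightarrow> x (Suc i) - x i \<le> h" "h \<le> 1"
    and u: "0 \<le> u" "u < T"
  defines "v \<equiv> \<lambda>i. if x i > u then \<kappa> (x i - u) else 0"
  shows "norm ((\<Sum>i<n. ((x (Suc i) - x i) / 2) *\<^sub>R (v i + v (Suc i))) - (\<Phi> (T - u) - \<Phi> 0))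
    \<le> (2 * C + 2 * C * exp \<mu> / \<mu>) * h"
proof -
  \<comment> \<open>Antiderivative of the kernel cut off at \<open>u\<close>: constant up to
    \<open>u\<close>, where the integrand vanishes.\<close>
  define \<Psi> where "\<Psi> y = (if y > u then \<Phi> (y - u) else \<Phi> 0)" for y
  define K where "K = 2 * C * exp \<mu> / \<mu>"
  \<comment> \<open>The jump of height \<open>2 * C * h\<close> at \<open>u\<close> pays for the
    cell containing \<open>u\<close>, where the integrand may be discontinuous; the increase beyond
    \<open>u\<close> absorbs the second order errors of the remaining cells.\<close>
  define B where "B y = (if y > u then h * (2 * C + K * (1 - exp (- \<mu> * (y - u)))) else 0)" for y
  have K: "K > 0" using C \<mu> by (simp add: K_def)
  have cell: "norm (((x (Suc i) - x i) / 2) *\<^sub>R (v i + v (Suc i)) - (\<Psi> (x (Suc i)) - \<Psi> (x i))) \<le> B (x (Suc i)) - B (x i)"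
    if i: "i < n" for i
  proof -
    define d where "d = x (Suc i) - x i"
    have d: "0 < d" "d \<le> h" "d \<le> 1"
      using is_grid_less[OF grid, of i "Suc i"] h(1)[OF i] h(2) i by (auto simp: d_def)
    consider "x (Suc i) \<le> u" | "x i \<le> u" "u < x (Suc i)" | "u < x i" by linarith
    then show ?thesis
    proof cases
      case 1
      then show ?thesis using d by (simp add: v_def \<Psi>_def B_def d_def)
    next
      case 2
      define y where "y = x (Suc i) - u"
      have y: "0 < y" "y \<le> d" using 2 by (auto simp: y_def d_def)
      have \<kappa>C: "norm (\<kappa> t) \<le> C" if "t \<ge> 0" for t
      proof -
        have "C * exp (- \<mu> * t) \<le> C * 1" using that \<mu> C by (intro mult_left_mono) auto
        with \<kappa>_le[OF that] show ?thesis by simp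
      qed
      have "norm (\<Phi> y - \<Phi> 0) \<le> C * (y - 0)"
        using y \<kappa>C by (intro vector_mean_value_bound[where f' = \<kappa>]) (auto intro: \<Phi>')
      also have "\<dots> \<le> C * h" using y d C by (intro mult_left_mono) auto
      finally have 1: "norm (\<Phi> y - \<Phi> 0) \<le> C * h" .
      have "d * norm (\<kappa> y) \<le> h * C" using \<kappa>C[of y] y d by (intro mult_mono) auto
      moreover have "d / 2 * norm (\<kappa> y) \<le> d * norm (\<kappa> y)" using d by (intro mult_right_mono) auto
      moreover have "norm ((d / 2) *\<^sub>R \<kappa> y) = d / 2 * norm (\<kappa> y)" using d by simp
      ultimately have "norm ((d / 2) *\<^sub>R \<kappa> y) \<le> h * C" by linarith
      then have "norm ((d / 2) *\<^sub>R \<kappa> y - (\<Phi> y - \<Phi> 0)) \<le> h * (2 * C)"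
        using 1 norm_triangle_ineq4[of "(d / 2) *\<^sub>R \<kappa> y" "\<Phi> y - \<Phi> 0"] by (simp add: algebra_simps)
      also have "\<dots> \<le> h * (2 * C + K * (1 - exp (- \<mu> * y)))"
        using y d K \<mu> by (intro mult_left_mono) auto
      finally show ?thesis using 2 by (simp add: v_def \<Psi>_def B_def d_def y_def)
    next
      case 3
      define y where "y = x i - u"
      have y: "0 < y" and at: "x (Suc i) - u = y + d" and gt: "u < x i" "u < x (Suc i)"
        using 3 d by (auto simp: y_def d_def)
      have e: "exp (- \<mu> * (y + d)) = exp (- \<mu> * y) * exp (- \<mu> * d)"
        by (simp add: exp_add[symmetric] algebra_simps)
      have "norm ((d / 2) *\<^sub>R (\<kappa> y + \<kappa> (y + d)) - (\<Phi> (y + d) - \<Phi> y)) \<le> 2 * C * exp (- \<mu> * y) * d\<^sup>2"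
        using trapezoid_interval_error[of y "y + d"] y d by simp
      also have "\<dots> \<le> 2 * C * exp (- \<mu> * y) * (h * (exp \<mu> / \<mu> * (1 - exp (- \<mu> * d))))"
      proof (intro mult_left_mono)
        show "d\<^sup>2 \<le> h * (exp \<mu> / \<mu> * (1 - exp (- \<mu> * d)))"
          unfolding power2_eq_square using exp_increment_ge[OF \<mu>, of d] d by (intro mult_mono) auto
      qed (use C in auto)
      also have "\<dots> = h * (K * (exp (- \<mu> * y) - exp (- \<mu> * (y + d))))"
        unfolding e by (simp add: K_def algebra_simps)
      also have "\<dots> = B (x (Suc i)) - B (x i)"
        unfolding B_def using gt by (simp add: at y_def[symmetric] algebra_simps)
      finally show ?thesis
        unfolding v_def \<Psi>_def using gt by (simp add: at y_def[symmetric] d_def[symmetric])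
    qed
  qed
  have x0: "x 0 = 0" and xn: "x n = T" using grid by (auto simp: is_grid_def)
  have telescope: "(\<Sum>i<n. \<Psi> (x (Suc i)) - \<Psi> (x i)) = \<Phi> (T - u) - \<Phi> 0"
    using sum_lessThan_telescope[of "\<lambda>i. \<Psi> (x i)" n] u by (simp add: x0 xn \<Psi>_def)
  have "(\<Sum>i<n. ((x (Suc i) - x i) / 2) *\<^sub>R (v i + v (Suc i))) - (\<Phi> (T - u) - \<Phi> 0) =
      (\<Sum>i<n. ((x (Suc i) - x i) / 2) *\<^sub>R (v i + v (Suc i)) - (\<Psi> (x (Suc i)) - \<Psi> (x i)))"
    unfolding telescope[symmetric] by (rule sum_subtractf[symmetric])
  also have "norm \<dots> \<le> (\<Sum>i<n. B (x (Suc i)) - B (x i))"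
    using cell by (intro sum_norm_le) auto
  also have "\<dots> = B T - B 0"
    by (simp only: sum_lessThan_telescope[of "\<lambda>i. B (x i)"] x0 xn)
  also have "\<dots> \<le> h * (2 * C + K)"
  proof -
    have "h > 0"
    proof -
      have "n > 0" using x0 xn u by (cases n) auto
      then show ?thesis using h(1)[of 0] is_grid_less[OF grid, of 0 1] by simp
    qed
    then have "h * (K * exp (- \<mu> * (T - u))) \<ge> 0" using K by simp
    then show ?thesis using u by (simp add: B_def algebra_simps)
  qed
  finally show ?thesis by (simp add: K_def mult.commute)
qed

end

section \<open>Time averages of squared weights\<close>

lemma sum_exp_left_endpoints:
  assumes "is_grid 0 T m u" "\<mu> > 0"
  shows "(\<Sum>l<m. (u (Suc l) - u l) * exp (- \<mu> * (T - u l))) \<le> 1 / \<mu>"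
proof -
  have "(\<Sum>l<m. (u (Suc l) - u l) * exp (- \<mu> * (T - u l))) \<le>
      (\<Sum>l<m. 1 / \<mu> * (exp (- \<mu> * (T - u (Suc l))) - exp (- \<mu> * (T - u l))))"
  proof (rule sum_mono)
    fix l
    define d where "d = u (Suc l) - u l"
    have e: "exp (- \<mu> * (T - u (Suc l))) = exp (- \<mu> * (T - u l)) * exp (\<mu> * d)"
      by (simp add: d_def exp_add[symmetric] algebra_simps)
    have "\<mu> * d \<le> exp (\<mu> * d) - 1" using exp_ge_add_one_self[of "\<mu> * d"] by linarith
    then have "exp (- \<mu> * (T - u l)) * (\<mu> * d) \<le> exp (- \<mu> * (T - u l)) * (exp (\<mu> * d) - 1)"
      by (intro mult_left_mono) auto
    then show "(u (Suc l) - u l) * exp (- \<mu> * (T - u l)) \<le>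
        1 / \<mu> * (exp (- \<mu> * (T - u (Suc l))) - exp (- \<mu> * (T - u l)))"
      unfolding e using assms(2) by (simp add: d_def field_simps)
  qed
  also have "\<dots> = 1 / \<mu> * (exp (- \<mu> * (T - u m)) - exp (- \<mu> * (T - u 0)))"
    by (simp only: sum_distrib_left[symmetric] sum_lessThan_telescope[of "\<lambda>l. exp (- \<mu> * (T - u l))"])
  also have "\<dots> \<le> 1 / \<mu> * 1"
    using assms by (intro mult_left_mono) (auto simp: is_grid_def)
  finally show ?thesis by simp
qed

lemma left_riemann_sum_error:
  fixes p Q :: "real \<Rightarrow> real"
  assumes grid: "is_grid 0 T m u" and h: "\<And>l. l < m \<Longrightarrow> u (Suc l) - u l \<le> h"
    and Q': "\<And>t. (Q has_vector_derivative p t) (at t)"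
    and lip: "\<And>s t. \<bar>p s - p t\<bar> \<le> K * \<bar>s - t\<bar>" "K \<ge> 0"
  shows "\<bar>(\<Sum>l<m. (u (Suc l) - u l) * p (u l)) - (Q T - Q 0)\<bar> \<le> K * h * T"
proof -
  have u0: "u 0 = 0" and um: "u m = T" using grid by (auto simp: is_grid_def)
  have cell: "\<bar>(u (Suc l) - u l) * p (u l) - (Q (u (Suc l)) - Q (u l))\<bar> \<le> K * h * (u (Suc l) - u l)"
    if l: "l < m" for l
  proof -
    have le: "u l \<le> u (Suc l)" using is_grid_le[OF grid, of l "Suc l"] l by simp
    have "norm ((Q (u (Suc l)) - u (Suc l) * p (u l)) - (Q (u l) - u l * p (u l))) \<le> K * h * (u (Suc l) - u l)"
    proof (rule vector_mean_value_bound[OF le])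
      show "((\<lambda>t. Q t - t * p (u l)) has_vector_derivative p t - p (u l)) (at t)" for t
        using Q'[of t] unfolding has_real_derivative_iff_has_vector_derivative[symmetric]
        by (auto intro!: derivative_eq_intros)
      fix t assume t: "u l \<le> t" "t \<le> u (Suc l)"
      have "\<bar>p t - p (u l)\<bar> \<le> K * \<bar>t - u l\<bar>" by (rule lip)
      also have "\<dots> \<le> K * h" using t h[OF l] lip(2) by (intro mult_left_mono) auto
      finally show "norm (p t - p (u l)) \<le> K * h" by simp
    qed
    then show ?thesis by (simp add: algebra_simps abs_minus_commute)
  qed
  have telescope: "(\<Sum>l<m. Q (u (Suc l)) - Q (u l)) = Q T - Q 0"
    using sum_lessThan_telescope[of "\<lambda>l. Q (u l)" m] by (simp add: u0 um)
  have "(\<Sum>l<m. (u (Suc l) - u l) * p (u l)) - (Q T - Q 0) =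
      (\<Sum>l<m. (u (Suc l) - u l) * p (u l) - (Q (u (Suc l)) - Q (u l)))"
    unfolding telescope[symmetric] by (rule sum_subtractf[symmetric])
  also have "\<bar>\<dots>\<bar> \<le> (\<Sum>l<m. K * h * (u (Suc l) - u l))"
    using cell unfolding real_norm_def[symmetric] by (intro sum_norm_le) auto
  also have "\<dots> = K * h * T"
    by (simp only: sum_distrib_left[symmetric] sum_lessThan_telescope u0 um) simp
  finally show ?thesis .
qed

text \<open>Separates the mean of the square from a part that oscillates at twice the
  frequency.\<close>

lemma Re_square: "(Re z)\<^sup>2 = (norm z)\<^sup>2 / 2 + Re (z\<^sup>2) / 2"
proof -
  have "Re (z\<^sup>2) = (Re z)\<^sup>2 - (Im z)\<^sup>2" by (simp add: power2_eq_square)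
  then show ?thesis by (simp add: cmod_power2 field_simps)
qed

text \<open>This is the long-run time average of
  \<open>(Re (\<xi> * iexp (- \<omega> * t)))\<^sup>2\<close>: at nonzero frequency the phase
  averages out, at frequency zero nothing rotates.\<close>

definition limit_variance :: "real \<Rightarrow> complex \<Rightarrow> real" where
  "limit_variance \<omega> \<xi> = (if \<omega> = 0 then (Re \<xi>)\<^sup>2 else (norm \<xi>)\<^sup>2 / 2)"

text \<open>The oscillating part of the square has a bounded antiderivative and is
  \<open>O(1 / T)\<close> after division by \<open>T\<close>; passing from the integral to the
  Riemann sum costs a Lipschitz constant times \<open>h\<close>.\<close>

lemma oscillating_square_riemann_sum:
  fixes \<xi> :: complex
  shows "\<exists>K\<ge>0. \<forall>T m u h. T > 0 \<longrightarrow> is_grid 0 T m u \<longrightarrow> (\<forall>l<m. u (Suc l) - u l \<le> h) \<longrightarrow>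
     \<bar>(\<Sum>l<m. (u (Suc l) - u l) * (Re (\<xi> * iexp (- \<omega> * u l)))\<^sup>2) / T - limit_variance \<omega> \<xi>\<bar> \<le> K * (h + 1 / T)"
proof -
  define p where "p t = (Re (\<xi> * iexp (- \<omega> * t)))\<^sup>2" for t
  define Q where "Q t = (if \<omega> = 0 then (Re \<xi>)\<^sup>2 * t else
      (norm \<xi>)\<^sup>2 / 2 * t + Re (\<xi>\<^sup>2 * iexp (- 2 * \<omega> * t) * (\<i> / (2 * of_real \<omega>))) / 2)" for t
  define L where "L = 2 * (norm \<xi>)\<^sup>2 * \<bar>\<omega>\<bar>"
  \<comment> \<open>For \<open>\<omega> = 0\<close> both terms are \<open>0\<close>, the quotient by
    the convention for division by zero. This is correct: \<open>p\<close> is then constant and the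
    Riemann sum exact.\<close>
  define K where "K = L + (norm \<xi>)\<^sup>2 / \<bar>\<omega>\<bar>"
  have L: "L \<ge> 0" and K: "K \<ge> 0" by (simp_all add: L_def K_def)
  have Q': "(Q has_vector_derivative p t) (at t)" for t
  proof (cases "\<omega> = 0")
    case True
    then show ?thesis unfolding Q_def[abs_def] p_def has_real_derivative_iff_has_vector_derivative[symmetric]
      by (auto intro!: derivative_eq_intros)
  next
    case False
    have "((\<lambda>t. \<xi>\<^sup>2 * iexp (- 2 * \<omega> * t) * (\<i> / (2 * of_real \<omega>))) has_vector_derivative
        \<xi>\<^sup>2 * iexp (- 2 * \<omega> * t)) (at t)"
      using False
      by - (rule derivative_eq_intros refl has_vector_derivative_real_field | simp)+
    then have "((\<lambda>t. Re (\<xi>\<^sup>2 * iexp (- 2 * \<omega> * t) * (\<i> / (2 * of_real \<omega>)))) has_real_derivative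
        Re (\<xi>\<^sup>2 * iexp (- 2 * \<omega> * t))) (at t)"
      unfolding has_real_derivative_iff_has_vector_derivative
      by (rule bounded_linear.has_vector_derivative[OF bounded_linear_Re])
    then have "((\<lambda>t. (norm \<xi>)\<^sup>2 / 2 * t + Re (\<xi>\<^sup>2 * iexp (- 2 * \<omega> * t) * (\<i> / (2 * of_real \<omega>))) / 2) has_real_derivative
        (norm \<xi>)\<^sup>2 / 2 * 1 + Re (\<xi>\<^sup>2 * iexp (- 2 * \<omega> * t)) / 2) (at t)"
      by (intro DERIV_add DERIV_cmult DERIV_ident DERIV_cdivide)
    then have "((\<lambda>t. (norm \<xi>)\<^sup>2 / 2 * t + Re (\<xi>\<^sup>2 * iexp (- 2 * \<omega> * t) * (\<i> / (2 * of_real \<omega>))) / 2) has_vector_derivative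
        (norm \<xi>)\<^sup>2 / 2 + Re (\<xi>\<^sup>2 * iexp (- 2 * \<omega> * t)) / 2) (at t)"
      unfolding has_real_derivative_iff_has_vector_derivative by (simp only: mult_1_right)
    moreover have "p t = (norm \<xi>)\<^sup>2 / 2 + Re (\<xi>\<^sup>2 * iexp (- 2 * \<omega> * t)) / 2"
    proof -
      have "(iexp (- \<omega> * t))\<^sup>2 = iexp (- 2 * \<omega> * t)"
        by (simp add: exp_double[symmetric] mult_ac)
      then show ?thesis
        unfolding p_def Re_square by (simp add: norm_mult power_mult_distrib)
    qed
    ultimately show ?thesis using False by (simp add: Q_def[abs_def])
  qed
  have lip: "\<bar>p s - p t\<bar> \<le> L * \<bar>s - t\<bar>" for s t
  proof -
    define c where "c t = Re (\<xi> * iexp (- \<omega> * t))" for t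
    have c: "\<bar>c t\<bar> \<le> norm \<xi>" for t
      unfolding c_def by (rule order_trans[OF abs_Re_le_cmod]) (simp add: norm_mult)
    have "\<bar>c s - c t\<bar> \<le> norm (\<xi> * (iexp (- \<omega> * s) - iexp (- \<omega> * t)))"
      unfolding c_def by (metis abs_Re_le_cmod minus_complex.simps(1) right_diff_distrib)
    also have "\<dots> \<le> norm \<xi> * \<bar>- \<omega> * s - - \<omega> * t\<bar>"
      unfolding norm_mult by (intro mult_left_mono norm_iexp_diff_le) auto
    also have "- \<omega> * s - - \<omega> * t = \<omega> * (t - s)" by (simp add: algebra_simps)
    finally have d: "\<bar>c s - c t\<bar> \<le> norm \<xi> * (\<bar>\<omega>\<bar> * \<bar>s - t\<bar>)"
      by (simp add: abs_mult abs_minus_commute)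
    have "p s - p t = (c s + c t) * (c s - c t)"
      by (simp add: p_def c_def power2_eq_square algebra_simps)
    then have "\<bar>p s - p t\<bar> = \<bar>c s + c t\<bar> * \<bar>c s - c t\<bar>" by (simp add: abs_mult)
    also have "\<dots> \<le> (2 * norm \<xi>) * (norm \<xi> * (\<bar>\<omega>\<bar> * \<bar>s - t\<bar>))"
      using c[of s] c[of t] d by (intro mult_mono) auto
    finally show ?thesis by (simp add: L_def power2_eq_square mult_ac)
  qed
  have Qdiff: "\<bar>Q T - Q 0 - limit_variance \<omega> \<xi> * T\<bar> \<le> (norm \<xi>)\<^sup>2 / \<bar>\<omega>\<bar>" for T
  proof (cases "\<omega> = 0")
    case False
    define r where "r t = Re (\<xi>\<^sup>2 * iexp (- 2 * \<omega> * t) * (\<i> / (2 * of_real \<omega>)))" for t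
    have r: "\<bar>r t\<bar> \<le> (norm \<xi>)\<^sup>2 / (2 * \<bar>\<omega>\<bar>)" for t
      unfolding r_def
      by (rule order_trans[OF abs_Re_le_cmod]) (simp add: norm_mult norm_divide norm_power)
    have "Q T - Q 0 - limit_variance \<omega> \<xi> * T = r T / 2 - r 0 / 2"
      using False by (simp add: Q_def limit_variance_def r_def)
    moreover have "(norm \<xi>)\<^sup>2 / (2 * \<bar>\<omega>\<bar>) \<le> (norm \<xi>)\<^sup>2 / \<bar>\<omega>\<bar>"
      using False by (simp add: field_simps)
    ultimately show ?thesis using r[of T] r[of 0] by linarith
  qed (simp add: Q_def limit_variance_def)
  show ?thesis
  proof (rule exI[of _ K], intro conjI allI impI)
    fix T m u h
    assume T: "(T :: real) > 0" and grid: "is_grid 0 T m u" and h: "\<forall>l<m. u (Suc l) - u l \<le> (h :: real)"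
    have h0: "h \<ge> 0"
    proof -
      have "m > 0" using grid T by (cases m) (auto simp: is_grid_def)
      then show ?thesis using h is_grid_less[OF grid, of 0 1] by (metis One_nat_def diff_gt_0_iff_gt less_imp_le less_le_trans Suc_leI zero_less_Suc order_refl zero_less_one)
    qed
    let ?S = "\<Sum>l<m. (u (Suc l) - u l) * p (u l)"
    have "\<bar>?S - (Q T - Q 0)\<bar> \<le> L * h * T"
      using left_riemann_sum_error[OF grid _ Q' lip L] h by blast
    then have "\<bar>?S - limit_variance \<omega> \<xi> * T\<bar> \<le> L * h * T + (norm \<xi>)\<^sup>2 / \<bar>\<omega>\<bar>"
      using Qdiff[of T] by linarith
    then have "\<bar>?S - limit_variance \<omega> \<xi> * T\<bar> / T \<le> (L * h * T + (norm \<xi>)\<^sup>2 / \<bar>\<omega>\<bar>) / T"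
      using T by (intro divide_right_mono) auto
    also have "\<dots> = L * h + (norm \<xi>)\<^sup>2 / \<bar>\<omega>\<bar> * (1 / T)" using T by (simp add: field_simps)
    also have "\<dots> \<le> K * h + K * (1 / T)"
      using T h0 L by (intro add_mono mult_right_mono) (auto simp: K_def)
    also have "\<bar>?S - limit_variance \<omega> \<xi> * T\<bar> / T = \<bar>?S / T - limit_variance \<omega> \<xi>\<bar>"
    proof -
      have "?S / T - limit_variance \<omega> \<xi> = (?S - limit_variance \<omega> \<xi> * T) / T"
        using T by (simp add: diff_divide_distrib)
      then show ?thesis using T by simp
    qed
    finally show "\<bar>(\<Sum>l<m. (u (Suc l) - u l) * (Re (\<xi> * iexp (- \<omega> * u l)))\<^sup>2) / T - limit_variance \<omega> \<xi>\<bar> \<le> K * (h + 1 / T)"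
      unfolding p_def by (simp add: distrib_left)
  qed (rule K)
qed

text \<open>A difference of squares is a bounded sum times a small difference. The part
  \<open>exp (- \<mu> * (T - u l))\<close> is a boundary layer at \<open>T\<close>: weighted by the
  cell lengths it sums to at most \<open>1 / \<mu>\<close>, hence contributes
  \<open>O(1 / T)\<close>. \<open>K\<close> is chosen before the grid and so serves every
  refinement.\<close>

lemma kernel_square_riemann_sum:
  fixes \<zeta> H :: complex and C \<mu> \<omega> :: real
  assumes C: "C \<ge> 0" and \<mu>: "\<mu> > 0"
  shows "\<exists>K\<ge>0. \<forall>T m u h G. T > 0 \<longrightarrow> is_grid 0 T m u \<longrightarrow> (\<forall>l<m. u (Suc l) - u l \<le> h) \<longrightarrow> h \<le> 1 \<longrightarrow>
     (\<forall>l<m. norm (G l - iexp (- \<omega> * u l) * H) \<le> C * (h + exp (- \<mu> * (T - u l)))) \<longrightarrow>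
     \<bar>(\<Sum>l<m. (u (Suc l) - u l) * (Re (\<zeta> * G l))\<^sup>2) / T - limit_variance \<omega> (\<zeta> * H)\<bar> \<le> K * (h + 1 / T)"
proof -
  obtain K1 where K1: "K1 \<ge> 0" and riemann: "\<And>T m u h. T > 0 \<Longrightarrow> is_grid 0 T m u \<Longrightarrow>
      (\<forall>l<m. u (Suc l) - u l \<le> h) \<Longrightarrow>
      \<bar>(\<Sum>l<m. (u (Suc l) - u l) * (Re (\<zeta> * H * iexp (- \<omega> * u l)))\<^sup>2) / T - limit_variance \<omega> (\<zeta> * H)\<bar> \<le> K1 * (h + 1 / T)"
    using oscillating_square_riemann_sum[of "\<zeta> * H" \<omega>] by blast
  \<comment> \<open>As \<open>h \<le> 1\<close> and the exponential is at most \<open>1\<close>, a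
    weight and its limit add up to at most \<open>2 * norm H + 2 * C\<close> in norm.\<close>
  define K2 where "K2 = (norm \<zeta>)\<^sup>2 * (2 * norm H + 2 * C) * C"
  have K2: "K2 \<ge> 0" using C by (simp add: K2_def)
  define K where "K = K1 + K2 * (1 + 1 / \<mu>)"
  show ?thesis
  proof (rule exI[of _ K], intro conjI allI impI)
    show "K \<ge> 0" using K1 K2 \<mu> by (simp add: K_def)
    fix T m u h G
    assume T: "(T :: real) > 0" and grid: "is_grid 0 T m u" and h: "\<forall>l<m. u (Suc l) - u l \<le> (h :: real)" and h1: "h \<le> 1"
      and G: "\<forall>l<m. norm (G l - iexp (- \<omega> * u l) * H) \<le> C * (h + exp (- \<mu> * (T - u l)))"
    define E where "E l = iexp (- \<omega> * u l) * H" for l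
    have u0: "u 0 = 0" and um: "u m = T" using grid by (auto simp: is_grid_def)
    have h0: "h \<ge> 0"
    proof -
      have "m > 0" using u0 um T by (cases m) auto
      then show ?thesis using h is_grid_less[OF grid, of 0 1] by force
    qed
    have summand: "\<bar>(Re (\<zeta> * G l))\<^sup>2 - (Re (\<zeta> * E l))\<^sup>2\<bar> \<le> K2 * (h + exp (- \<mu> * (T - u l)))" if l: "l < m" for l
    proof -
      have nE: "norm (E l) = norm H" by (simp add: E_def norm_mult)
      have le: "norm (G l - E l) \<le> C * (h + exp (- \<mu> * (T - u l)))" using G l by (simp add: E_def)
      have "u l \<le> T" using is_grid_bounds[OF grid, of l] l by simp
      then have "exp (- \<mu> * (T - u l)) \<le> 1" using \<mu> by simp
      then have "h + exp (- \<mu> * (T - u l)) \<le> 2" using h1 by linarith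
      then have "C * (h + exp (- \<mu> * (T - u l))) \<le> C * 2" using C by (intro mult_left_mono) auto
      with le have le2: "norm (G l - E l) \<le> 2 * C" by simp
      have "\<bar>Re (\<zeta> * G l) - Re (\<zeta> * E l)\<bar> \<le> norm (\<zeta> * (G l - E l))"
        by (metis abs_Re_le_cmod minus_complex.simps(1) right_diff_distrib)
      also have "\<dots> \<le> norm \<zeta> * (C * (h + exp (- \<mu> * (T - u l))))"
        unfolding norm_mult using le by (intro mult_left_mono) auto
      finally have 1: "\<bar>Re (\<zeta> * G l) - Re (\<zeta> * E l)\<bar> \<le> norm \<zeta> * (C * (h + exp (- \<mu> * (T - u l))))" .
      have "\<bar>Re (\<zeta> * G l) + Re (\<zeta> * E l)\<bar> \<le> norm (\<zeta> * (G l + E l))"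
        by (metis abs_Re_le_cmod plus_complex.simps(1) distrib_left)
      also have "\<dots> \<le> norm \<zeta> * (2 * norm H + 2 * C)"
        unfolding norm_mult
      proof (intro mult_left_mono)
        have "G l + E l = (G l - E l) + 2 * E l" by simp
        then have "norm (G l + E l) \<le> norm (G l - E l) + norm (2 * E l)"
          by (metis norm_triangle_ineq)
        then show "norm (G l + E l) \<le> 2 * norm H + 2 * C" using le2 nE by (simp add: norm_mult)
      qed simp
      finally have 2: "\<bar>Re (\<zeta> * G l) + Re (\<zeta> * E l)\<bar> \<le> norm \<zeta> * (2 * norm H + 2 * C)" .
      have "(Re (\<zeta> * G l))\<^sup>2 - (Re (\<zeta> * E l))\<^sup>2 = (Re (\<zeta> * G l) + Re (\<zeta> * E l)) * (Re (\<zeta> * G l) - Re (\<zeta> * E l))"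
        by (simp add: power2_eq_square algebra_simps)
      then have "\<bar>(Re (\<zeta> * G l))\<^sup>2 - (Re (\<zeta> * E l))\<^sup>2\<bar> \<le>
          (norm \<zeta> * (2 * norm H + 2 * C)) * (norm \<zeta> * (C * (h + exp (- \<mu> * (T - u l)))))"
        unfolding abs_mult using 1 2 C by (auto intro!: mult_mono simp: abs_mult)
      then show ?thesis by (simp add: K2_def power2_eq_square mult_ac)
    qed
    have du: "0 \<le> u (Suc l) - u l" if "l < m" for l
      using is_grid_le[OF grid, of l "Suc l"] that by simp
    have "\<bar>(\<Sum>l<m. (u (Suc l) - u l) * (Re (\<zeta> * G l))\<^sup>2) - (\<Sum>l<m. (u (Suc l) - u l) * (Re (\<zeta> * E l))\<^sup>2)\<bar> =
        \<bar>\<Sum>l<m. (u (Suc l) - u l) * ((Re (\<zeta> * G l))\<^sup>2 - (Re (\<zeta> * E l))\<^sup>2)\<bar>"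
      by (simp add: sum_subtractf[symmetric] right_diff_distrib)
    also have "\<dots> \<le> (\<Sum>l<m. (u (Suc l) - u l) * (K2 * (h + exp (- \<mu> * (T - u l)))))"
      unfolding real_norm_def[symmetric] using du summand
      by (intro sum_norm_le) (auto simp: abs_mult intro!: mult_mono)
    also have "\<dots> = K2 * (h * (\<Sum>l<m. u (Suc l) - u l) + (\<Sum>l<m. (u (Suc l) - u l) * exp (- \<mu> * (T - u l))))"
      unfolding sum_distrib_left sum.distrib[symmetric] by (intro sum.cong) (auto simp: algebra_simps)
    also have "(\<Sum>l<m. u (Suc l) - u l) = T"
      using sum_lessThan_telescope[of u m] by (simp add: u0 um)
    also have "K2 * (h * T + (\<Sum>l<m. (u (Suc l) - u l) * exp (- \<mu> * (T - u l)))) \<le> K2 * (h * T + 1 / \<mu>)"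
      using K2 sum_exp_left_endpoints[OF grid \<mu>] by (intro mult_left_mono) auto
    finally have "\<bar>(\<Sum>l<m. (u (Suc l) - u l) * (Re (\<zeta> * G l))\<^sup>2) - (\<Sum>l<m. (u (Suc l) - u l) * (Re (\<zeta> * E l))\<^sup>2)\<bar> / T
        \<le> K2 * (h * T + 1 / \<mu>) / T"
      using T by (intro divide_right_mono) auto
    then have "\<bar>(\<Sum>l<m. (u (Suc l) - u l) * (Re (\<zeta> * G l))\<^sup>2) / T - (\<Sum>l<m. (u (Suc l) - u l) * (Re (\<zeta> * E l))\<^sup>2) / T\<bar>
        \<le> K2 * (h * T + 1 / \<mu>) / T"
      using T by (simp add: diff_divide_distrib[symmetric])
    also have "\<dots> = K2 * (h + 1 / \<mu> * (1 / T))" using T by (simp add: field_simps)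
    also have "\<dots> \<le> K2 * ((1 + 1 / \<mu>) * (h + 1 / T))"
      using K2 h0 T \<mu> by (intro mult_left_mono) (auto simp: algebra_simps)
    finally have "\<bar>(\<Sum>l<m. (u (Suc l) - u l) * (Re (\<zeta> * G l))\<^sup>2) / T - (\<Sum>l<m. (u (Suc l) - u l) * (Re (\<zeta> * E l))\<^sup>2) / T\<bar>
        \<le> K2 * (1 + 1 / \<mu>) * (h + 1 / T)" by (simp only: mult.assoc)
    moreover have "\<bar>(\<Sum>l<m. (u (Suc l) - u l) * (Re (\<zeta> * E l))\<^sup>2) / T - limit_variance \<omega> (\<zeta> * H)\<bar> \<le> K1 * (h + 1 / T)"
      using riemann[OF T grid h] by (simp add: E_def mult_ac)
    ultimately show "\<bar>(\<Sum>l<m. (u (Suc l) - u l) * (Re (\<zeta> * G l))\<^sup>2) / T - limit_variance \<omega> (\<zeta> * H)\<bar> \<le> K * (h + 1 / T)"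
      unfolding K_def distrib_right by linarith
  qed
qed

section \<open>Increments of a square integrable Levy process\<close>

lemma additive_multiple:
  fixes f :: "real \<Rightarrow> 'b::real_vector"
  assumes add: "\<And>s t. 0 \<le> s \<Longrightarrow> 0 \<le> t \<Longrightarrow> s + t \<le> 1 \<Longrightarrow> f (s + t) = f s + f t"
    and s: "0 \<le> s" "real k * s \<le> 1"
  shows "f (real k * s) = real k *\<^sub>R f s"
  using s
proof (induction k)
  case 0
  show ?case using add[of 0 0] by simp
next
  case (Suc k)
  have le: "real k * s + s \<le> 1" using Suc.prems by (simp add: algebra_simps)
  then have "f (real k * s + s) = f (real k * s) + f s" using Suc.prems by (intro add) auto
  moreover have "real k * s \<le> 1" using le Suc.prems by linarith
  ultimately show ?case using Suc by (simp add: algebra_simps)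
qed

text \<open>Cauchy's functional equation: multiples of \<open>1 / n\<close> are handled by
  additivity, the remainder by smallness at \<open>0\<close>. The domain is bounded because the
  principal logarithm is additive only while the values stay near \<open>1\<close>. Variance, mean
  and logarithm of the characteristic function are the instances.\<close>

lemma additive_on_unit_interval:
  fixes f :: "real \<Rightarrow> 'b::real_normed_vector"
  assumes add: "\<And>s t. 0 \<le> s \<Longrightarrow> 0 \<le> t \<Longrightarrow> s + t \<le> 1 \<Longrightarrow> f (s + t) = f s + f t"
    and small: "\<And>\<epsilon>. \<epsilon> > 0 \<Longrightarrow> \<exists>\<delta>>0. \<forall>s. 0 \<le> s \<and> s < \<delta> \<and> s \<le> 1 \<longrightarrow> norm (f s) < \<epsilon>"
    and t: "0 \<le> t" "t \<le> 1"
  shows "f t = t *\<^sub>R f 1"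
proof -
  note multiple = additive_multiple[of f, OF add]
  have "norm (f t - t *\<^sub>R f 1) \<le> \<epsilon>" if \<epsilon>: "\<epsilon> > 0" for \<epsilon>
  proof -
    obtain \<delta> where \<delta>: "\<delta> > 0" "\<And>s. 0 \<le> s \<Longrightarrow> s < \<delta> \<Longrightarrow> s \<le> 1 \<Longrightarrow> norm (f s) < \<epsilon> / 2"
      using small[of "\<epsilon> / 2"] \<epsilon> by auto
    obtain n :: nat where n: "real n > max (1 / \<delta>) (2 * norm (f 1) / \<epsilon>)"
      using reals_Archimedean2 by blast
    have n_pos: "real n > 0" using n \<delta>(1) by (smt (verit) divide_pos_pos)
    have n1: "1 / real n < \<delta>" using n n_pos \<delta>(1) by (simp add: field_simps)
    have n2: "norm (f 1) / real n \<le> \<epsilon> / 2" using n n_pos \<epsilon> by (simp add: field_simps)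
    define k where "k = nat \<lfloor>t * n\<rfloor>"
    have k: "real k \<le> t * n" "t * n < real k + 1" using t n_pos by (auto simp: k_def)
    define r where "r = t - real k * (1 / n)"
    have rt: "r \<le> t" using n_pos by (simp add: r_def)
    have "real k / n \<le> t" "t < (real k + 1) / n"
      using k n_pos by (auto simp: pos_divide_le_eq pos_less_divide_eq)
    then have r: "0 \<le> r" "r < 1 / n" by (auto simp: r_def add_divide_distrib)
    have kn: "real k * (1 / n) \<le> 1" using r(1) t(2) by (simp add: r_def)
    have "f t = f (real k * (1 / n) + r)" by (simp add: r_def)
    also have "\<dots> = f (real k * (1 / n)) + f r" using r t n_pos by (intro add) (auto simp: r_def)
    also have "f (real k * (1 / n)) = real k *\<^sub>R f (1 / n)" using kn n_pos by (intro multiple) auto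
    finally have 1: "f t = real k *\<^sub>R f (1 / n) + f r" .
    have "f 1 = real n *\<^sub>R f (1 / n)" using multiple[of "1 / n" n] n_pos by simp
    then have "f (1 / n) = (1 / n) *\<^sub>R f 1" using n_pos by simp
    then have "f t - t *\<^sub>R f 1 = f r - r *\<^sub>R f 1" unfolding 1 by (simp add: r_def algebra_simps)
    also have "norm \<dots> \<le> norm (f r) + r * norm (f 1)"
      using norm_triangle_ineq4[of "f r" "r *\<^sub>R f 1"] r by simp
    also have "norm (f r) < \<epsilon> / 2" using r rt n1 t by (intro \<delta>(2)) auto
    also have "r * norm (f 1) \<le> 1 / n * norm (f 1)" using r by (intro mult_right_mono) auto
    also have "\<dots> \<le> \<epsilon> / 2" using n2 by simp
    finally show ?thesis by simp
  qed
  then have "norm (f t - t *\<^sub>R f 1) \<le> 0" by (rule field_le_epsilon[where y = 0, simplified])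
  then show ?thesis by simp
qed

section \<open>Independence and stationarity of increments\<close>

context levy_process
begin

lemma space_filtration: "0 \<le> t \<Longrightarrow> space (F t) = space M"
  and sets_filtration: "0 \<le> t \<Longrightarrow> sets (F t) \<subseteq> events"
  using subalg by (auto simp: subalgebra_def)

lemma measurable_filtration_mono:
  assumes "U \<in> borel_measurable (F s)" "0 \<le> s" "s \<le> t"
  shows "U \<in> borel_measurable (F t)"
  using assms mono[OF assms(2,3)] space_filtration[of s] space_filtration[of t]
  by (auto simp: measurable_def)

lemma measurable_filtration_space:
  assumes "U \<in> borel_measurable (F s)" "0 \<le> s"
  shows "random_variable borel U"
  using assms sets_filtration[of s] space_filtration[of s] by (auto simp: measurable_def)

lemma measurable_L [measurable]: "0 \<le> t \<Longrightarrow> random_variable borel (L t)"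
  using adapted measurable_filtration_space by blast

text \<open>A variable known at time \<open>s\<close> generates a sub-sigma-algebra of
  \<open>F s\<close>, of which the increment is independent.\<close>

lemma indep_var_increment:
  assumes U: "U \<in> borel_measurable (F s)" and st: "0 \<le> s" "s \<le> t"
  shows "indep_var borel U borel (\<lambda>w. L t w - L s w)"
  unfolding indep_var_eq
proof (intro conjI)
  show "random_variable borel U" using U st(1) by (rule measurable_filtration_space)
  show "random_variable borel (\<lambda>w. L t w - L s w)"
    using st by (intro borel_measurable_diff measurable_L) auto
  have "indep_sets (case_bool (sets (F s)) (sets (vimage_algebra (space M) (\<lambda>w. L t w - L s w) borel))) UNIV"
    using indep_increments[OF st] by (simp add: indep_set_def)
  then show "indep_set (sigma_sets (space M) {U -` A \<inter> space M |A. A \<in> sets borel})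
     (sigma_sets (space M) {(\<lambda>w. L t w - L s w) -` A \<inter> space M |A. A \<in> sets borel})"
    unfolding indep_set_def
  proof (rule indep_sets_mono_sets)
    fix i :: bool
    have "sigma_sets (space M) {U -` A \<inter> space M |A. A \<in> sets borel} \<subseteq> sets (F s)"
    proof (rule sets.sigma_sets_subset')
      show "space M \<in> sets (F s)" using sets.top[of "F s"] by (simp add: space_filtration[OF st(1)])
      show "{U -` A \<inter> space M |A. A \<in> sets borel} \<subseteq> sets (F s)"
        using measurable_sets[OF U] by (auto simp: space_filtration[OF st(1)])
    qed
    then show "case_bool (sigma_sets (space M) {U -` A \<inter> space M |A. A \<in> sets borel})
        (sigma_sets (space M) {(\<lambda>w. L t w - L s w) -` A \<inter> space M |A. A \<in> sets borel}) i
        \<subseteq> case_bool (sets (F s)) (sets (vimage_algebra (space M) (\<lambda>w. L t w - L s w) borel)) i"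
      by (cases i) (auto simp: sets_vimage_algebra)
  qed
qed

lemma increment_expectation_eq:
  fixes g :: "real \<Rightarrow> 'b::{banach, second_countable_topology}"
  assumes st: "0 \<le> s" "s \<le> t" and g: "g \<in> borel_measurable borel"
  shows "(\<integral>w. g (L t w - L s w) \<partial>M) = (\<integral>w. g (L (t - s) w) \<partial>M)"
proof -
  have "(\<integral>w. g (L t w - L s w) \<partial>M) = integral\<^sup>L (distr M borel (\<lambda>w. L t w - L s w)) g"
    using st g by (subst integral_distr) auto
  also have "\<dots> = (\<integral>w. g (L (t - s) w) \<partial>M)"
    unfolding stationary_increments[OF st] using st g by (subst integral_distr) auto
  finally show ?thesis .
qed

lemma increment_integrable_iff:
  fixes g :: "real \<Rightarrow> 'b::{banach, second_countable_topology}"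
  assumes st: "0 \<le> s" "s \<le> t" and g: "g \<in> borel_measurable borel"
  shows "integrable M (\<lambda>w. g (L t w - L s w)) \<longleftrightarrow> integrable M (\<lambda>w. g (L (t - s) w))"
proof -
  have "integrable M (\<lambda>w. g (L t w - L s w)) \<longleftrightarrow> integrable (distr M borel (\<lambda>w. L t w - L s w)) g"
    using st g by (subst integrable_distr_eq) auto
  also have "\<dots> \<longleftrightarrow> integrable M (\<lambda>w. g (L (t - s) w))"
    unfolding stationary_increments[OF st] using st g by (subst integrable_distr_eq) auto
  finally show ?thesis .
qed

end

text \<open>On the event \<open>\<bar>B\<bar> \<le> r\<close>, whose probability is positive for large \<open>r\<close>, the square of \<open>A\<close> is
  controlled by that of \<open>A + B\<close>; by independence the restriction to this event costs only a factor.\<close>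

lemma (in prob_space) square_integrable_summand:
  fixes A B :: "'a \<Rightarrow> real"
  assumes indep: "indep_var borel A borel B" and int: "integrable M (\<lambda>w. (A w + B w)\<^sup>2)"
  shows "integrable M (\<lambda>w. (A w)\<^sup>2)"
proof -
  have [measurable]: "random_variable borel A" "random_variable borel B"
    using indep by (auto dest: indep_var_rv1 indep_var_rv2)
  obtain r where r: "prob {w \<in> space M. norm (B w) > r} < 1"
    using norm_tail_tight[of B 1] by auto
  let ?E = "{w \<in> space M. \<bar>B w\<bar> \<le> r}"
  have "prob ?E = 1 - prob {w \<in> space M. norm (B w) > r}"
    by (subst prob_compl[symmetric]) (auto intro!: arg_cong[where f = prob])
  with r have E: "prob ?E > 0" by simp
  define X where "X = case_bool (\<lambda>w. ennreal ((A w)\<^sup>2)) (\<lambda>w. indicator {x. \<bar>x\<bar> \<le> r} (B w) :: ennreal)"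
  have "indep_var borel ((\<lambda>x. ennreal (x\<^sup>2)) \<circ> A) borel ((\<lambda>x. indicator {x. \<bar>x\<bar> \<le> r} x :: ennreal) \<circ> B)"
    using indep by (rule indep_var_compose) auto
  then have "indep_vars (\<lambda>_. borel) X UNIV"
    unfolding indep_var_def X_def comp_def by (rule indep_vars_cong[THEN iffD1, rotated -1]) (auto split: bool.splits)
  then have "(\<integral>\<^sup>+w. (\<Prod>i\<in>UNIV. X i w) \<partial>M) = (\<Prod>i\<in>UNIV. \<integral>\<^sup>+w. X i w \<partial>M)"
    by (intro indep_vars_nn_integral) auto
  then have "(\<integral>\<^sup>+w. ennreal ((A w)\<^sup>2) \<partial>M) * (\<integral>\<^sup>+w. indicator {x. \<bar>x\<bar> \<le> r} (B w) \<partial>M) =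
      (\<integral>\<^sup>+w. ennreal ((A w)\<^sup>2) * indicator {x. \<bar>x\<bar> \<le> r} (B w) \<partial>M)"
    by (simp add: UNIV_bool X_def mult.commute)
  also have "\<dots> \<le> (\<integral>\<^sup>+w. ennreal (2 * (A w + B w)\<^sup>2 + 2 * r\<^sup>2) \<partial>M)"
  proof (rule nn_integral_mono)
    fix w
    \<comment> \<open>The difference of the two sides is
      \<open>(A w + 2 * B w)\<^sup>2\<close>.\<close>
    have "(A w)\<^sup>2 \<le> 2 * (A w + B w)\<^sup>2 + 2 * (B w)\<^sup>2"
      using zero_le_power2[of "A w + 2 * B w"] by (simp add: power2_eq_square algebra_simps)
    moreover have "(B w)\<^sup>2 \<le> r\<^sup>2" if "\<bar>B w\<bar> \<le> r"
      using that by (simp add: abs_le_square_iff[symmetric])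
    ultimately have "(A w)\<^sup>2 \<le> 2 * (A w + B w)\<^sup>2 + 2 * r\<^sup>2" if "\<bar>B w\<bar> \<le> r"
      using that by fastforce
    then have "ennreal ((A w)\<^sup>2) \<le> ennreal (2 * (A w + B w)\<^sup>2 + 2 * r\<^sup>2)" if "\<bar>B w\<bar> \<le> r"
      using that by (intro ennreal_leI)
    then show "ennreal ((A w)\<^sup>2) * indicator {x. \<bar>x\<bar> \<le> r} (B w) \<le> ennreal (2 * (A w + B w)\<^sup>2 + 2 * r\<^sup>2)"
      by (simp add: indicator_def del: ennreal_plus)
  qed
  also have "\<dots> < \<infinity>"
    using int by (subst nn_integral_eq_integral) auto
  also have "(\<integral>\<^sup>+w. indicator {x. \<bar>x\<bar> \<le> r} (B w) \<partial>M) = emeasure M ?E"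
  proof -
    have "(\<integral>\<^sup>+w. indicator {x. \<bar>x\<bar> \<le> r} (B w) \<partial>M) = (\<integral>\<^sup>+w. indicator ?E w \<partial>M)"
      by (intro nn_integral_cong) (auto split: split_indicator)
    also have "\<dots> = emeasure M ?E" by (rule nn_integral_indicator) measurable
    finally show ?thesis .
  qed
  finally have "(\<integral>\<^sup>+w. ennreal ((A w)\<^sup>2) \<partial>M) < \<infinity>"
    using E by (auto simp: emeasure_eq_measure ennreal_mult_less_top less_top[symmetric] ennreal_eq_0_iff)
  then show ?thesis by (simp add: integrable_iff_bounded)
qed

section \<open>Moments of a square integrable Levy process\<close>

locale square_integrable_levy_process = levy_process +
  fixes v :: real
  assumes integrable_L1: "integrable M (L 1)" and mean_L1: "expectation (L 1) = 0"
    and square_integrable_L1: "integrable M (\<lambda>w. (L 1 w)\<^sup>2)" and second_moment_L1: "expectation (\<lambda>w. (L 1 w)\<^sup>2) = v"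
begin

lemma v_nonneg: "v \<ge> 0"
  unfolding second_moment_L1[symmetric] by simp

text \<open>\<open>L 1\<close> is the sum of \<open>L t\<close> and an independent increment, so
  square integrability passes to earlier times.\<close>

lemma square_integrable_L:
  assumes "0 \<le> t" "t \<le> 1"
  shows "integrable M (\<lambda>w. (L t w)\<^sup>2)"
proof (rule square_integrable_summand)
  show "indep_var borel (L t) borel (\<lambda>w. L 1 w - L t w)"
    using assms adapted by (intro indep_var_increment) auto
qed (use square_integrable_L1 in simp)

lemma integrable_L: "0 \<le> t \<Longrightarrow> t \<le> 1 \<Longrightarrow> integrable M (L t)"
  by (rule square_integrable_imp_integrable) (auto simp: square_integrable_L)

lemma mean_additive:
  assumes "0 \<le> s" "0 \<le> t" "s + t \<le> 1"
  shows "expectation (L (s + t)) = expectation (L s) + expectation (L t)"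
    and "expectation (\<lambda>w. (L (s + t) w)\<^sup>2) =
      expectation (\<lambda>w. (L s w)\<^sup>2) + 2 * expectation (L s) * expectation (L t) + expectation (\<lambda>w. (L t w)\<^sup>2)"
proof -
  define D where "D w = L (s + t) w - L s w" for w
  have ex: "expectation D = expectation (L t)" "expectation (\<lambda>w. (D w)\<^sup>2) = expectation (\<lambda>w. (L t w)\<^sup>2)"
    using increment_expectation_eq[of s "s + t" "\<lambda>x. x"] increment_expectation_eq[of s "s + t" "\<lambda>x. x\<^sup>2"] assms
    by (auto simp: D_def[abs_def])
  have int: "integrable M D" "integrable M (\<lambda>w. (D w)\<^sup>2)"
    using increment_integrable_iff[of s "s + t" "\<lambda>x. x"] increment_integrable_iff[of s "s + t" "\<lambda>x. x\<^sup>2"] assms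
      integrable_L[of t] square_integrable_L[of t] by (auto simp: D_def[abs_def])
  have intL: "integrable M (L s)" "integrable M (\<lambda>w. (L s w)\<^sup>2)"
    using integrable_L[of s] square_integrable_L[of s] assms by auto
  have indep: "indep_var borel (L s) borel D"
    unfolding D_def[abs_def] using assms adapted by (intro indep_var_increment) auto
  have prod: "integrable M (\<lambda>w. L s w * D w)" "expectation (\<lambda>w. L s w * D w) = expectation (L s) * expectation D"
    using indep_var_integrable[OF indep intL(1) int(1)] indep_var_lebesgue_integral[OF indep intL(1) int(1)] by auto
  have L_eq: "L (s + t) w = L s w + D w" for w by (simp add: D_def)
  show "expectation (L (s + t)) = expectation (L s) + expectation (L t)"
    unfolding L_eq[abs_def] ex(1)[symmetric] using intL int by (intro Bochner_Integration.integral_add)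
  have "expectation (\<lambda>w. (L (s + t) w)\<^sup>2) = expectation (\<lambda>w. (L s w)\<^sup>2 + 2 * (L s w * D w) + (D w)\<^sup>2)"
    unfolding L_eq by (simp add: power2_sum algebra_simps)
  also have "\<dots> = expectation (\<lambda>w. (L s w)\<^sup>2) + 2 * expectation (\<lambda>w. L s w * D w) + expectation (\<lambda>w. (D w)\<^sup>2)"
    using intL int prod by simp
  finally show "expectation (\<lambda>w. (L (s + t) w)\<^sup>2) =
      expectation (\<lambda>w. (L s w)\<^sup>2) + 2 * expectation (L s) * expectation (L t) + expectation (\<lambda>w. (L t w)\<^sup>2)"
    using prod ex by simp
qed

text \<open>Unlike the second moment, the variance is additive before the means are known to vanish.
  Being nonnegative it is then monotone, and \<open>V s \<le> V (1 / n) = v / n\<close> gives the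
  smallness at \<open>0\<close> that linearity requires.\<close>

lemma variance_L:
  assumes "0 \<le> t" "t \<le> 1"
  shows "variance (L t) = t * v"
proof -
  define V where "V t = expectation (\<lambda>w. (L t w)\<^sup>2) - (expectation (L t))\<^sup>2" for t
  have V_eq: "V t = variance (L t)" if "0 \<le> t" "t \<le> 1" for t
    unfolding V_def using integrable_L[OF that] square_integrable_L[OF that] by (simp add: variance_eq)
  have add: "V (s + t) = V s + V t" if "0 \<le> s" "0 \<le> t" "s + t \<le> 1" for s t
    unfolding V_def mean_additive[OF that] by (simp add: power2_sum)
  have V1: "V 1 = v" by (simp add: V_def second_moment_L1 mean_L1)
  have nonneg: "V s \<ge> 0" if "0 \<le> s" "s \<le> 1" for s
    unfolding V_eq[OF that] by (rule variance_positive)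
  note multiple = additive_multiple[of V, OF add]
  have "V t = t *\<^sub>R V 1"
  proof (rule additive_on_unit_interval[OF add _ assms])
    fix \<epsilon> :: real assume \<epsilon>: "\<epsilon> > 0"
    obtain n :: nat where n: "real n > max 1 (v / \<epsilon>)" using reals_Archimedean2 by blast
    then have n_pos: "real n > 0" by simp
    have "V s < \<epsilon>" if "0 \<le> s" "s < 1 / n" for s
    proof -
      have "1 / n \<le> 1" using n by simp
      then have "V (s + (1 / n - s)) = V s + V (1 / n - s)" using that by (intro add) auto
      moreover have "V (1 / n - s) \<ge> 0" using that \<open>1 / n \<le> 1\<close> by (intro nonneg) auto
      moreover have "real n * V (1 / n) = v" using multiple[of "1 / n" n] n_pos V1 by simp
      ultimately have "real n * V s \<le> v" using n_pos by (smt (verit) mult_left_mono add_diff_cancel_left' diff_add_cancel)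
      also have "v < real n * \<epsilon>" using n \<epsilon> by (simp add: field_simps)
      finally show ?thesis using n_pos by simp
    qed
    moreover have "1 / real n > 0" using n_pos by simp
    ultimately show "\<exists>\<delta>>0. \<forall>s. 0 \<le> s \<and> s < \<delta> \<and> s \<le> 1 \<longrightarrow> norm (V s) < \<epsilon>"
      using nonneg by (intro exI[of _ "1 / real n"]) auto
  qed
  then show ?thesis using V_eq[OF assms] V1 by simp
qed

text \<open>Smallness of the mean at \<open>0\<close> comes from stochastic continuity. Were the
  mean at least \<open>\<epsilon>\<close> in absolute value, \<open>L s\<close> would be away from
  \<open>0\<close> or away from its mean, yet both events have probability below one half for small
  \<open>s\<close>.\<close>

lemma mean_L:
  assumes "0 \<le> t" "t \<le> 1"
  shows "expectation (L t) = 0"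
proof -
  have "expectation (L t) = t *\<^sub>R expectation (L 1)"
  proof (rule additive_on_unit_interval[OF mean_additive(1) _ assms])
    fix \<epsilon> :: real assume \<epsilon>: "\<epsilon> > 0"
    have "((\<lambda>s. prob {w \<in> space M. norm (L s w - L 0 w) > \<epsilon> / 2}) \<longlongrightarrow> 0) (at 0 within {0..})"
      using stochastically_continuous[of 0, unfolded converges_in_prob_def, rule_format, of "\<epsilon> / 2"] \<epsilon> by simp
    then have "\<forall>\<^sub>F s in at 0 within {0..}. prob {w \<in> space M. norm (L s w - L 0 w) > \<epsilon> / 2} < 1 / 2"
      by (rule order_tendstoD) simp
    then obtain \<delta> where \<delta>: "\<delta> > 0" "\<And>s. 0 < s \<Longrightarrow> s < \<delta> \<Longrightarrow> prob {w \<in> space M. norm (L s w - L 0 w) > \<epsilon> / 2} < 1 / 2"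
      unfolding eventually_at by (auto simp: dist_real_def)
    \<comment> \<open>For such \<open>s\<close> Chebyshev's bound
      \<open>4 * (s * v) / \<epsilon>\<^sup>2\<close> is below \<open>1 / 2\<close>;
      \<open>v + 1\<close> avoids division by zero.\<close>
    define \<delta>' where "\<delta>' = min \<delta> (\<epsilon>\<^sup>2 / (8 * (v + 1)))"
    have \<delta>': "\<delta>' > 0" using \<delta>(1) \<epsilon> v_nonneg by (simp add: \<delta>'_def)
    have "norm (expectation (L s)) < \<epsilon>" if s: "0 \<le> s" "s < \<delta>'" "s \<le> 1" for s
    proof (cases "s = 0")
      case True
      have "expectation (L 0) = expectation (\<lambda>_. 0 :: real)"
        using start by (intro integral_cong_AE) auto
      then show ?thesis using True \<epsilon> by simp
    next
      case False
      with s have s0: "0 < s" by simp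
      have [measurable]: "random_variable borel (L s)" "random_variable borel (L 0)" using s by auto
      define m where "m = expectation (L s)"
      have P1: "prob {w \<in> space M. norm (L s w - L 0 w) > \<epsilon> / 2} < 1 / 2"
        using s0 s by (intro \<delta>(2)) (auto simp: \<delta>'_def)
      have "prob {w \<in> space M. \<epsilon> / 2 \<le> \<bar>L s w - m\<bar>} \<le> variance (L s) / (\<epsilon> / 2)\<^sup>2"
        unfolding m_def using \<epsilon> s by (intro Chebyshev_inequality square_integrable_L) auto
      also have "\<dots> = 4 * (s * v) / \<epsilon>\<^sup>2" using s variance_L[of s] by (simp add: power_divide)
      also have "\<dots> < 1 / 2"
      proof -
        have "s < \<epsilon>\<^sup>2 / (8 * (v + 1))" using s by (simp add: \<delta>'_def)
        then have "8 * (s * (v + 1)) < \<epsilon>\<^sup>2" using v_nonneg by (simp add: field_simps)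
        then have "8 * (s * v) < \<epsilon>\<^sup>2" using s0 by (simp add: algebra_simps)
        then show ?thesis using \<epsilon> by (simp add: field_simps)
      qed
      finally have P2: "prob {w \<in> space M. \<epsilon> / 2 \<le> \<bar>L s w - m\<bar>} < 1 / 2" .
      show ?thesis
      proof (rule ccontr)
        assume "\<not> norm (expectation (L s)) < \<epsilon>"
        then have m: "\<bar>m\<bar> \<ge> \<epsilon>" by (simp add: m_def)
        let ?A = "{w \<in> space M. norm (L s w - L 0 w) > \<epsilon> / 2}" and ?B = "{w \<in> space M. \<epsilon> / 2 \<le> \<bar>L s w - m\<bar>}"
        have "AE w in M. w \<in> ?A \<union> ?B" using start AE_space
        proof eventually_elim
          case (elim w)
          have "\<epsilon> / 2 < \<bar>L s w\<bar> \<or> \<epsilon> / 2 \<le> \<bar>L s w - m\<bar>" using m by arith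
          with elim show ?case by auto
        qed
        then have "prob (?A \<union> ?B) = 1" by (intro prob_eq_1[THEN iffD2]) auto
        moreover have "prob (?A \<union> ?B) \<le> prob ?A + prob ?B" by (intro measure_Un_le) auto
        ultimately show False using P1 P2 by linarith
      qed
    qed
    with \<delta>' show "\<exists>\<delta>>0. \<forall>s. 0 \<le> s \<and> s < \<delta> \<and> s \<le> 1 \<longrightarrow> norm (expectation (L s)) < \<epsilon>" by blast
  qed
  then show ?thesis by (simp add: mean_L1)
qed

lemma second_moment_L:
  assumes "0 \<le> t" "t \<le> 1"
  shows "expectation (\<lambda>w. (L t w)\<^sup>2) = t * v"
  using variance_L[OF assms] by (simp add: mean_L[OF assms])

lemma increment_moments:
  assumes "0 \<le> s" "s \<le> t" "t - s \<le> 1"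
  shows "integrable M (\<lambda>w. L t w - L s w)" "expectation (\<lambda>w. L t w - L s w) = 0"
    "integrable M (\<lambda>w. (L t w - L s w)\<^sup>2)" "expectation (\<lambda>w. (L t w - L s w)\<^sup>2) = (t - s) * v"
  using assms increment_expectation_eq[of s t "\<lambda>x. x"] increment_expectation_eq[of s t "\<lambda>x. x\<^sup>2"]
    increment_integrable_iff[of s t "\<lambda>x. x"] increment_integrable_iff[of s t "\<lambda>x. x\<^sup>2"]
    integrable_L[of "t - s"] square_integrable_L[of "t - s"] mean_L[of "t - s"] second_moment_L[of "t - s"]
  by auto

end

section \<open>Sums of independent increments\<close>

context levy_process
begin

lemma partial_sum_measurable:
  assumes grid: "is_grid 0 T m u" and k: "k \<le> m"
  shows "(\<lambda>w. \<Sum>l<k. c l * (L (u (Suc l)) w - L (u l) w)) \<in> borel_measurable (F (u k))"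
proof (intro borel_measurable_sum borel_measurable_times borel_measurable_const borel_measurable_diff)
  fix l assume "l \<in> {..<k}"
  then show "L (u (Suc l)) \<in> borel_measurable (F (u k))" "L (u l) \<in> borel_measurable (F (u k))"
    using k is_grid_bounds[OF grid, of l] is_grid_bounds[OF grid, of "Suc l"]
      is_grid_le[OF grid, of l k] is_grid_le[OF grid, of "Suc l" k]
    by (auto intro!: measurable_filtration_mono[OF adapted])
qed

lemma partial_sum_indep:
  assumes grid: "is_grid 0 T m u" and k: "k < m"
  shows "indep_var borel (\<lambda>w. \<Sum>l<k. c l * (L (u (Suc l)) w - L (u l) w))
    borel (\<lambda>w. L (u (Suc k)) w - L (u k) w)"
  using k is_grid_bounds[OF grid, of k] is_grid_le[OF grid, of k "Suc k"]
  by (intro indep_var_increment partial_sum_measurable[OF grid]) auto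

text \<open>The partial sum is known at time \<open>u k\<close>, hence independent of the next
  increment, whose law depends only on its length.\<close>

lemma char_sum_increments:
  assumes grid: "is_grid 0 T m u" and k: "k \<le> m"
  shows "(\<integral>w. iexp (\<Sum>l<k. c l * (L (u (Suc l)) w - L (u l) w)) \<partial>M) =
    (\<Prod>l<k. \<integral>w. iexp (c l * L (u (Suc l) - u l) w) \<partial>M)"
  using k
proof (induction k)
  case 0
  show ?case using prob_space by simp
next
  case (Suc k)
  then have k: "k < m" by simp
  define S where "S w = (\<Sum>l<k. c l * (L (u (Suc l)) w - L (u l) w))" for w
  define D where "D w = L (u (Suc k)) w - L (u k) w" for w
  have u: "0 \<le> u k" "u k \<le> u (Suc k)"
    using k is_grid_bounds[OF grid, of k] is_grid_le[OF grid, of k "Suc k"] by auto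
  have indep: "indep_var borel S borel D"
    unfolding S_def[abs_def] D_def[abs_def] by (rule partial_sum_indep[OF grid k])
  then have [measurable]: "random_variable borel S" "random_variable borel D"
    by (auto dest: indep_var_rv1 indep_var_rv2)
  have "indep_var borel ((\<lambda>x. iexp x) \<circ> S) borel ((\<lambda>x. iexp (c k * x)) \<circ> D)"
    using indep by (rule indep_var_compose) auto
  then have indep': "indep_var borel (\<lambda>w. iexp (S w)) borel (\<lambda>w. iexp (c k * D w))" by (simp add: comp_def)
  have "(\<integral>w. iexp (\<Sum>l<Suc k. c l * (L (u (Suc l)) w - L (u l) w)) \<partial>M) =
      (\<integral>w. iexp (S w) * iexp (c k * D w) \<partial>M)"
    by (simp add: S_def D_def exp_add[symmetric] distrib_left)
  also have "\<dots> = (\<integral>w. iexp (S w) \<partial>M) * (\<integral>w. iexp (c k * D w) \<partial>M)"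
    by (rule indep_var_lebesgue_integral[OF indep']) (auto intro!: integrable_iexp)
  also have "(\<integral>w. iexp (c k * D w) \<partial>M) = (\<integral>w. iexp (c k * L (u (Suc k) - u k) w) \<partial>M)"
    unfolding D_def using u by (intro increment_expectation_eq[of _ _ "\<lambda>x. iexp (c k * x)"]) auto
  finally show ?case using Suc.IH k by (simp add: S_def)
qed

end

context square_integrable_levy_process
begin

text \<open>The isometry for step functions: the partial sum is independent of the next increment,
  which has mean \<open>0\<close>, so the mixed term vanishes.\<close>

lemma second_moment_sum_increments:
  assumes grid: "is_grid 0 T m u" and mesh: "\<And>l. l < m \<Longrightarrow> u (Suc l) - u l \<le> 1" and k: "k \<le> m"
  shows "integrable M (\<lambda>w. (\<Sum>l<k. c l * (L (u (Suc l)) w - L (u l) w))\<^sup>2) \<and>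
    expectation (\<lambda>w. (\<Sum>l<k. c l * (L (u (Suc l)) w - L (u l) w))\<^sup>2) = v * (\<Sum>l<k. (u (Suc l) - u l) * (c l)\<^sup>2)"
  using k
proof (induction k)
  case (Suc k)
  then have k: "k < m" by simp
  define S where "S w = (\<Sum>l<k. c l * (L (u (Suc l)) w - L (u l) w))" for w
  define D where "D w = L (u (Suc k)) w - L (u k) w" for w
  have u: "0 \<le> u k" "u k \<le> u (Suc k)"
    using k is_grid_bounds[OF grid, of k] is_grid_le[OF grid, of k "Suc k"] by auto
  have indep: "indep_var borel S borel D"
    unfolding S_def[abs_def] D_def[abs_def] by (rule partial_sum_indep[OF grid k])
  then have [measurable]: "random_variable borel S" by (auto dest: indep_var_rv1)
  have S2: "integrable M (\<lambda>w. (S w)\<^sup>2)" "expectation (\<lambda>w. (S w)\<^sup>2) = v * (\<Sum>l<k. (u (Suc l) - u l) * (c l)\<^sup>2)"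
    using Suc.IH k by (auto simp: S_def)
  have S1: "integrable M S" by (rule square_integrable_imp_integrable) (auto simp: S2)
  note D = increment_moments[OF u mesh[OF k], folded D_def]
  have prod: "integrable M (\<lambda>w. S w * D w)" "expectation (\<lambda>w. S w * D w) = 0"
    using indep_var_integrable[OF indep S1 D(1)] indep_var_lebesgue_integral[OF indep S1 D(1)] D(2) by auto
  have eq: "(\<Sum>l<Suc k. c l * (L (u (Suc l)) w - L (u l) w))\<^sup>2 = (S w)\<^sup>2 + 2 * c k * (S w * D w) + (c k)\<^sup>2 * (D w)\<^sup>2" for w
    by (simp add: S_def D_def power2_sum power_mult_distrib)
  have "expectation (\<lambda>w. (S w)\<^sup>2 + 2 * c k * (S w * D w) + (c k)\<^sup>2 * (D w)\<^sup>2) =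
      expectation (\<lambda>w. (S w)\<^sup>2) + 2 * c k * expectation (\<lambda>w. S w * D w) + (c k)\<^sup>2 * expectation (\<lambda>w. (D w)\<^sup>2)"
    using S2(1) D(3) prod(1) by simp
  also have "\<dots> = v * (\<Sum>l<Suc k. (u (Suc l) - u l) * (c l)\<^sup>2)"
    unfolding S2(2) D(4) prod(2) by (simp add: distrib_left mult_ac)
  finally show ?case unfolding eq using S2(1) D(3) prod(1) by simp
qed (simp add: prob_space)

section \<open>The characteristic exponent\<close>

definition char_L :: "real \<Rightarrow> real \<Rightarrow> complex" where
  "char_L \<theta> t = (\<integral>w. iexp (\<theta> * L t w) \<partial>M)"

lemma char_L_mult:
  assumes "0 \<le> s" "0 \<le> t"
  shows "char_L \<theta> (s + t) = char_L \<theta> s * char_L \<theta> t"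
proof -
  define D where "D w = L (s + t) w - L s w" for w
  have indep: "indep_var borel (L s) borel D"
    unfolding D_def[abs_def] using assms adapted by (intro indep_var_increment) auto
  then have [measurable]: "random_variable borel D" "random_variable borel (L s)"
    by (auto dest: indep_var_rv1 indep_var_rv2)
  have "indep_var borel ((\<lambda>x. iexp (\<theta> * x)) \<circ> L s) borel ((\<lambda>x. iexp (\<theta> * x)) \<circ> D)"
    using indep by (rule indep_var_compose) auto
  then have indep': "indep_var borel (\<lambda>w. iexp (\<theta> * L s w)) borel (\<lambda>w. iexp (\<theta> * D w))" by (simp add: comp_def)
  have "char_L \<theta> (s + t) = (\<integral>w. iexp (\<theta> * L s w) * iexp (\<theta> * D w) \<partial>M)"
    unfolding char_L_def by (simp add: D_def exp_add[symmetric] right_diff_distrib distrib_left)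
  also have "\<dots> = (\<integral>w. iexp (\<theta> * L s w) \<partial>M) * (\<integral>w. iexp (\<theta> * D w) \<partial>M)"
    by (rule indep_var_lebesgue_integral[OF indep']) (auto intro!: integrable_iexp)
  also have "(\<integral>w. iexp (\<theta> * D w) \<partial>M) = char_L \<theta> t"
    unfolding D_def char_L_def using assms
    by (subst increment_expectation_eq[of _ _ "\<lambda>x. iexp (\<theta> * x)"]) auto
  finally show ?thesis by (simp add: char_L_def)
qed

text \<open>The mean vanishes, so the linear term may be subtracted inside the integral and the
  second order Taylor bound applies.\<close>

lemma char_L_near_1:
  assumes "0 \<le> t" "t \<le> 1"
  shows "norm (char_L \<theta> t - 1) \<le> \<theta>\<^sup>2 * v * t / 2"
proof -
  have [measurable]: "random_variable borel (L t)" using assms by simp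
  have int: "integrable M (\<lambda>w. iexp (\<theta> * L t w))" by (rule integrable_iexp) auto
  have intL: "integrable M (\<lambda>w. \<i> * (\<theta> * L t w))" using integrable_L[OF assms] by simp
  have "char_L \<theta> t - 1 = (\<integral>w. iexp (\<theta> * L t w) - (1 + \<i> * (\<theta> * L t w)) \<partial>M)"
    using int intL mean_L[OF assms] by (simp add: char_L_def prob_space)
  also have "norm \<dots> \<le> (\<integral>w. norm (iexp (\<theta> * L t w) - (1 + \<i> * (\<theta> * L t w))) \<partial>M)"
    by (rule integral_norm_bound)
  also have "\<dots> \<le> (\<integral>w. \<theta>\<^sup>2 / 2 * (L t w)\<^sup>2 \<partial>M)"
  proof (rule integral_mono)
    show "integrable M (\<lambda>w. norm (iexp (\<theta> * L t w) - (1 + \<i> * (\<theta> * L t w))))"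
      using int intL by (intro integrable_norm Bochner_Integration.integrable_diff Bochner_Integration.integrable_add) auto
    show "norm (iexp (\<theta> * L t w) - (1 + \<i> * (\<theta> * L t w))) \<le> \<theta>\<^sup>2 / 2 * (L t w)\<^sup>2" for w
      using iexp_approx1[of "\<theta> * L t w" 1] by (simp add: power2_eq_square mult_ac)
  qed (use square_integrable_L[OF assms] in auto)
  also have "\<dots> = \<theta>\<^sup>2 * v * t / 2" using second_moment_L[OF assms] by simp
  finally show ?thesis .
qed

text \<open>For small \<open>\<theta>\<close> the numbers \<open>char_L \<theta> t\<close>, \<open>0 \<le> t \<le> 1\<close>, stay near \<open>1\<close>, so that their principal
  logarithms are additive in \<open>t\<close>, hence linear.\<close>

lemma char_L_eq_exp:
  assumes \<theta>: "\<theta>\<^sup>2 * v \<le> 1 / 4" and t: "0 \<le> t" "t \<le> 1"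
  shows "char_L \<theta> t = exp (t *\<^sub>R Ln (char_L \<theta> 1))"
proof -
  define f where "f t = Ln (char_L \<theta> t)" for t
  have near: "norm (char_L \<theta> s - 1) \<le> 1 / 8 * s" if "0 \<le> s" "s \<le> 1" for s
  proof -
    have "\<theta>\<^sup>2 * v * s / 2 \<le> 1 / 4 * s / 2" using \<theta> that by (intro divide_right_mono mult_right_mono) auto
    with char_L_near_1[OF that, of \<theta>] show ?thesis by linarith
  qed
  have f_le: "norm (f s) \<le> 1 / 4 * s" if "0 \<le> s" "s \<le> 1" for s
  proof -
    have "norm (char_L \<theta> s - 1) < 1 / 2" using near[OF that] that by linarith
    then have "norm (Ln (1 + (char_L \<theta> s - 1))) \<le> 2 * norm (char_L \<theta> s - 1)" by (rule norm_Ln_le)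
    with near[OF that] show ?thesis by (simp add: f_def)
  qed
  have exp_f: "exp (f s) = char_L \<theta> s" if "0 \<le> s" "s \<le> 1" for s
  proof -
    have "char_L \<theta> s \<noteq> 0" using near[OF that] that by auto
    then show ?thesis by (simp add: f_def)
  qed
  have "f t = t *\<^sub>R f 1"
  proof (rule additive_on_unit_interval[OF _ _ t])
    fix s t :: real assume st: "0 \<le> s" "0 \<le> t" "s + t \<le> 1"
    have "norm (f s + f t) \<le> 1 / 4 * s + 1 / 4 * t"
      using f_le[of s] f_le[of t] st norm_triangle_ineq[of "f s" "f t"] by linarith
    \<comment> \<open>The imaginary part of the sum stays below \<open>pi\<close>, so the branch cut
      is not reached and \<open>Ln\<close> inverts \<open>exp\<close> there.\<close>
    then have "\<bar>Im (f s + f t)\<bar> \<le> 1"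
      using abs_Im_le_cmod[of "f s + f t"] st by linarith
    then have "Ln (exp (f s + f t)) = f s + f t"
      using pi_gt3 by (intro Ln_exp) auto
    moreover have "exp (f s + f t) = char_L \<theta> (s + t)"
      using st by (simp add: exp_add exp_f char_L_mult)
    ultimately show "f (s + t) = f s + f t" by (simp add: f_def)
  next
    fix \<epsilon> :: real assume "\<epsilon> > 0"
    then have "norm (f s) < \<epsilon>" if "0 \<le> s" "s < \<epsilon>" "s \<le> 1" for s
      using f_le[of s] that by linarith
    with \<open>\<epsilon> > 0\<close> show "\<exists>\<delta>>0. \<forall>s. 0 \<le> s \<and> s < \<delta> \<and> s \<le> 1 \<longrightarrow> norm (f s) < \<epsilon>" by blast
  qed
  then show ?thesis using exp_f[OF t] by (simp add: f_def)
qed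

text \<open>Two moments suffice: the Taylor remainder is the expectation \<open>R\<close> of a
  minimum that is dominated by \<open>6 * (L 1 w)\<^sup>2\<close> and tends to \<open>0\<close>
  pointwise. Passing to the logarithm adds an error of order \<open>\<theta>^4\<close>.\<close>

lemma char_exponent_expansion:
  assumes "\<epsilon> > 0"
  shows "\<exists>\<eta>>0. \<forall>\<theta>. \<bar>\<theta>\<bar> < \<eta> \<longrightarrow> \<theta>\<^sup>2 * v \<le> 1 / 4 \<and> norm (Ln (char_L \<theta> 1) + v / 2 * \<theta>\<^sup>2) \<le> \<epsilon> * \<theta>\<^sup>2"
proof -
  have [measurable]: "random_variable borel (L 1)" by simp
  define R where "R \<theta> = expectation (\<lambda>w. min (6 * (L 1 w)\<^sup>2) (\<bar>\<theta>\<bar> * \<bar>L 1 w\<bar> ^ 3))" for \<theta>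
  have char: "char (distr M borel (L 1)) \<theta> = char_L \<theta> 1" for \<theta>
    by (simp add: char_def char_L_def integral_distr)
  have approx: "norm (char_L \<theta> 1 - (1 - \<theta>\<^sup>2 * v / 2)) \<le> \<theta>\<^sup>2 / 6 * R \<theta>" for \<theta>
    unfolding R_def char[symmetric]
    by (rule char_approx3'[where X = "L 1"])
       (auto simp: integrable_L1 square_integrable_L1 mean_L1 second_moment_L1 variance_eq)
  have "((\<lambda>\<theta>. R \<theta>) \<longlongrightarrow> expectation (\<lambda>w. 0)) (at 0)"
    unfolding R_def tendsto_at_iff_sequentially comp_def
  proof (intro allI impI)
    fix X :: "nat \<Rightarrow> real" assume X: "X \<longlonglongrightarrow> 0"
    show "(\<lambda>i. expectation (\<lambda>w. min (6 * (L 1 w)\<^sup>2) (\<bar>X i\<bar> * \<bar>L 1 w\<bar> ^ 3))) \<longlonglongrightarrow> expectation (\<lambda>w. 0)"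
    proof (rule integral_dominated_convergence[where w = "\<lambda>w. 6 * (L 1 w)\<^sup>2"])
      show "AE w in M. (\<lambda>i. min (6 * (L 1 w)\<^sup>2) (\<bar>X i\<bar> * \<bar>L 1 w\<bar> ^ 3)) \<longlonglongrightarrow> 0"
      proof (rule AE_I2)
        fix w
        have "(\<lambda>i. min (6 * (L 1 w)\<^sup>2) (\<bar>X i\<bar> * \<bar>L 1 w\<bar> ^ 3)) \<longlonglongrightarrow> min (6 * (L 1 w)\<^sup>2) (\<bar>0\<bar> * \<bar>L 1 w\<bar> ^ 3)"
          by (intro tendsto_intros X)
        moreover have "min (6 * (L 1 w)\<^sup>2) (\<bar>0\<bar> * \<bar>L 1 w\<bar> ^ 3) = 0" by (simp add: min_absorb2)
        ultimately show "(\<lambda>i. min (6 * (L 1 w)\<^sup>2) (\<bar>X i\<bar> * \<bar>L 1 w\<bar> ^ 3)) \<longlonglongrightarrow> 0" by (simp only:)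
      qed
      show "integrable M (\<lambda>w. 6 * (L 1 w)\<^sup>2)" using square_integrable_L1 by simp
      show "AE w in M. norm (min (6 * (L 1 w)\<^sup>2) (\<bar>X i\<bar> * \<bar>L 1 w\<bar> ^ 3)) \<le> 6 * (L 1 w)\<^sup>2" for i
        by (rule AE_I2) (auto simp: min_def)
    qed auto
  qed
  then have "\<forall>\<^sub>F \<theta> in at 0. R \<theta> < \<epsilon>"
    using assms by (intro order_tendstoD(2)[where y = 0]) auto
  then obtain \<delta> where \<delta>: "\<delta> > 0" "\<And>\<theta>. \<theta> \<noteq> 0 \<Longrightarrow> \<bar>\<theta>\<bar> < \<delta> \<Longrightarrow> R \<theta> < \<epsilon>"
    unfolding eventually_at by (auto simp: dist_real_def)
  \<comment> \<open>\<open>\<delta>\<close> makes \<open>R \<theta>\<close> less than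
    \<open>\<epsilon>\<close>, the second bound gives
    \<open>\<theta>\<^sup>2 * v \<le> 1 / 4\<close>, and the square root controls
    \<open>Ln (1 + z) - z\<close>.\<close>
  define \<eta> where "\<eta> = min \<delta> (min (1 / (2 * (v + 1))) (min 1 (sqrt (\<epsilon> / (v\<^sup>2 + 1)))))"
  have v2: "v\<^sup>2 + 1 > 0" by (simp add: add_nonneg_pos)
  have \<eta>: "\<eta> > 0" using \<delta>(1) v_nonneg assms v2 by (simp add: \<eta>_def)
  show ?thesis
  proof (rule exI[of _ \<eta>], intro conjI allI impI)
    fix \<theta> :: real assume \<theta>: "\<bar>\<theta>\<bar> < \<eta>"
    have "\<theta>\<^sup>2 = \<bar>\<theta>\<bar> * \<bar>\<theta>\<bar>" by (simp add: power2_eq_square)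
    also have "\<dots> \<le> 1 / (2 * (v + 1)) * (1 / (2 * (v + 1)))"
      using \<theta> v_nonneg by (intro mult_mono) (auto simp: \<eta>_def)
    finally have sq: "\<theta>\<^sup>2 \<le> 1 / (4 * (v + 1)\<^sup>2)" by (simp add: power2_eq_square algebra_simps)
    have "\<theta>\<^sup>2 * v \<le> 1 / (4 * (v + 1)\<^sup>2) * v" using sq v_nonneg by (intro mult_right_mono)
    also have "\<dots> \<le> 1 / (4 * (v + 1)\<^sup>2) * (v + 1)\<^sup>2"
      using v_nonneg by (intro mult_left_mono) (auto simp: power2_eq_square algebra_simps)
    also have "\<dots> = 1 / 4" using v_nonneg by simp
    finally show small: "\<theta>\<^sup>2 * v \<le> 1 / 4" .
    show "norm (Ln (char_L \<theta> 1) + v / 2 * \<theta>\<^sup>2) \<le> \<epsilon> * \<theta>\<^sup>2"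
    proof (cases "\<theta> = 0")
      case True
      then show ?thesis by (simp add: char_L_def prob_space)
    next
      case False
      define z where "z = char_L \<theta> 1 - 1"
      have z: "norm z \<le> \<theta>\<^sup>2 * v / 2" using char_L_near_1[of 1 \<theta>] by (simp add: z_def)
      have z1: "norm z \<le> 1 / 8" using z small by simp
      have "norm (Ln (1 + z) - z) \<le> (norm z)\<^sup>2 / (1 - norm z)"
        using z1 by (intro Ln_approx_linear) simp
      also have "\<dots> \<le> (norm z)\<^sup>2 / (1 / 2)" using z1 by (intro divide_left_mono) auto
      also have "\<dots> \<le> (\<theta>\<^sup>2 * v / 2)\<^sup>2 / (1 / 2)" using z by (intro divide_right_mono power_mono) auto
      also have "\<dots> = v\<^sup>2 / 2 * \<theta>\<^sup>2 * \<theta>\<^sup>2" by (simp add: power2_eq_square)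
      also have "\<dots> \<le> \<epsilon> / 2 * \<theta>\<^sup>2"
      proof (intro mult_right_mono)
        have "\<bar>\<theta>\<bar> \<le> sqrt (\<epsilon> / (v\<^sup>2 + 1))" using \<theta> by (simp add: \<eta>_def)
        then have "\<bar>\<theta>\<bar>\<^sup>2 \<le> (sqrt (\<epsilon> / (v\<^sup>2 + 1)))\<^sup>2" by (intro power_mono) auto
        then have "\<theta>\<^sup>2 \<le> \<epsilon> / (v\<^sup>2 + 1)" using assms v2 by simp
        then have "v\<^sup>2 * \<theta>\<^sup>2 \<le> v\<^sup>2 * (\<epsilon> / (v\<^sup>2 + 1))" by (intro mult_left_mono) auto
        also have "\<dots> \<le> \<epsilon>" using assms v2 by (simp add: field_simps)
        finally show "v\<^sup>2 / 2 * \<theta>\<^sup>2 \<le> \<epsilon> / 2" by simp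
      qed simp
      finally have 1: "norm (Ln (1 + z) - z) \<le> \<epsilon> / 2 * \<theta>\<^sup>2" .
      have "norm (z + v / 2 * \<theta>\<^sup>2) = norm (char_L \<theta> 1 - (1 - \<theta>\<^sup>2 * v / 2))"
        by (simp add: z_def algebra_simps)
      also have "\<dots> \<le> \<theta>\<^sup>2 / 6 * R \<theta>" by (rule approx)
      also have "\<dots> \<le> \<theta>\<^sup>2 / 6 * \<epsilon>"
        using \<delta>(2)[OF False] \<theta> by (intro mult_left_mono) (auto simp: \<eta>_def)
      also have "\<dots> \<le> \<epsilon> / 2 * \<theta>\<^sup>2"
        using assms by (simp add: field_simps)
      finally have 2: "norm (z + v / 2 * \<theta>\<^sup>2) \<le> \<epsilon> / 2 * \<theta>\<^sup>2" .
      have "Ln (char_L \<theta> 1) + v / 2 * \<theta>\<^sup>2 = (Ln (1 + z) - z) + (z + v / 2 * \<theta>\<^sup>2)"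
        by (simp add: z_def)
      then show ?thesis using 1 2 norm_triangle_ineq[of "Ln (1 + z) - z" "z + v / 2 * \<theta>\<^sup>2"] by simp
    qed
  qed (rule \<eta>)
qed

text \<open>This plays the part of Lindeberg's condition. The exponent of an increment is exactly
  its length times \<open>Ln (char_L (c l) 1)\<close>, so errors are weighted by lengths and the
  bound holds for any number of increments, provided the coefficients are small.\<close>

lemma char_sum_increments_expansion:
  assumes "\<epsilon> > 0"
  shows "\<exists>\<eta>>0. \<forall>T m u c. is_grid 0 T m u \<longrightarrow> (\<forall>l<m. u (Suc l) - u l \<le> 1) \<longrightarrow> (\<forall>l<m. \<bar>c l\<bar> < \<eta>) \<longrightarrow>
    (\<exists>z. (\<integral>w. iexp (\<Sum>l<m. c l * (L (u (Suc l)) w - L (u l) w)) \<partial>M) = exp z \<and>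
      norm (z + v / 2 * (\<Sum>l<m. (u (Suc l) - u l) * (c l)\<^sup>2)) \<le> \<epsilon> * (\<Sum>l<m. (u (Suc l) - u l) * (c l)\<^sup>2))"
proof -
  obtain \<eta> where \<eta>: "\<eta> > 0"
    "\<And>\<theta>. \<bar>\<theta>\<bar> < \<eta> \<Longrightarrow> \<theta>\<^sup>2 * v \<le> 1 / 4"
    "\<And>\<theta>. \<bar>\<theta>\<bar> < \<eta> \<Longrightarrow> norm (Ln (char_L \<theta> 1) + v / 2 * \<theta>\<^sup>2) \<le> \<epsilon> * \<theta>\<^sup>2"
    using char_exponent_expansion[OF assms] by blast
  show ?thesis
  proof (rule exI[of _ \<eta>], intro conjI allI impI)
    fix T m u c
    assume grid: "is_grid 0 T m u" and mesh: "\<forall>l<m. u (Suc l) - u l \<le> 1" and c: "\<forall>l<m. \<bar>c l\<bar> < \<eta>"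
    have du: "0 \<le> u (Suc l) - u l" if "l < m" for l
      using is_grid_le[OF grid, of l "Suc l"] that by simp
    define z where "z = (\<Sum>l<m. (u (Suc l) - u l) *\<^sub>R Ln (char_L (c l) 1))"
    have "(\<integral>w. iexp (\<Sum>l<m. c l * (L (u (Suc l)) w - L (u l) w)) \<partial>M) = (\<Prod>l<m. char_L (c l) (u (Suc l) - u l))"
      unfolding char_L_def by (rule char_sum_increments[OF grid]) simp
    also have "\<dots> = (\<Prod>l<m. exp ((u (Suc l) - u l) *\<^sub>R Ln (char_L (c l) 1)))"
      using \<eta>(2) c mesh du by (intro prod.cong) (auto intro!: char_L_eq_exp)
    also have "\<dots> = exp z" by (simp add: z_def exp_sum)
    finally have 1: "(\<integral>w. iexp (\<Sum>l<m. c l * (L (u (Suc l)) w - L (u l) w)) \<partial>M) = exp z" .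
    have "z + v / 2 * (\<Sum>l<m. (u (Suc l) - u l) * (c l)\<^sup>2) =
        (\<Sum>l<m. (u (Suc l) - u l) *\<^sub>R (Ln (char_L (c l) 1) + v / 2 * (c l)\<^sup>2))"
      by (simp add: z_def sum.distrib scaleR_right_distrib sum_distrib_left)
         (simp add: scaleR_conv_of_real mult_ac)
    also have "norm \<dots> \<le> (\<Sum>l<m. (u (Suc l) - u l) * (\<epsilon> * (c l)\<^sup>2))"
      using \<eta>(3) c du by (intro sum_norm_le) (auto intro!: mult_left_mono)
    also have "\<dots> = \<epsilon> * (\<Sum>l<m. (u (Suc l) - u l) * (c l)\<^sup>2)"
      by (simp add: sum_distrib_left mult_ac)
    finally show "\<exists>z. (\<integral>w. iexp (\<Sum>l<m. c l * (L (u (Suc l)) w - L (u l) w)) \<partial>M) = exp z \<and>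
      norm (z + v / 2 * (\<Sum>l<m. (u (Suc l) - u l) * (c l)\<^sup>2)) \<le> \<epsilon> * (\<Sum>l<m. (u (Suc l) - u l) * (c l)\<^sup>2)"
      using 1 by blast
  qed (rule \<eta>(1))
qed

end

section \<open>Riemann sums of the stochastic integrals\<close>

lemma (in prob_space) converges_in_prob_bounded_linear:
  fixes Z :: "'i \<Rightarrow> 'a \<Rightarrow> 'v::euclidean_space" and f :: "'v \<Rightarrow> 'u::euclidean_space"
  assumes conv: "converges_in_prob M Z Z' G" and f: "bounded_linear f"
    and [measurable]: "\<And>i. random_variable borel (Z i)" "random_variable borel Z'"
  shows "converges_in_prob M (\<lambda>i w. f (Z i w)) (\<lambda>w. f (Z' w)) G"
  unfolding converges_in_prob_def
proof (intro allI impI)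
  fix \<epsilon> :: real assume \<epsilon>: "\<epsilon> > 0"
  interpret f: bounded_linear f by fact
  obtain K where K: "K > 0" "\<And>z. norm (f z) \<le> norm z * K" using f.pos_bounded by blast
  have lim: "((\<lambda>i. prob {w \<in> space M. norm (Z i w - Z' w) > \<epsilon> / K}) \<longlongrightarrow> 0) G"
    using conv \<epsilon> K(1) unfolding converges_in_prob_def by simp
  have "prob {w \<in> space M. norm (f (Z i w) - f (Z' w)) > \<epsilon>} \<le> prob {w \<in> space M. norm (Z i w - Z' w) > \<epsilon> / K}" for i
  proof (rule finite_measure_mono)
    show "{w \<in> space M. norm (f (Z i w) - f (Z' w)) > \<epsilon>} \<subseteq> {w \<in> space M. norm (Z i w - Z' w) > \<epsilon> / K}"
    proof
      fix w assume w: "w \<in> {w \<in> space M. norm (f (Z i w) - f (Z' w)) > \<epsilon>}"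
      then have "\<epsilon> < norm (Z i w - Z' w) * K"
        using K(2)[of "Z i w - Z' w"] by (simp add: f.diff)
      with w K(1) show "w \<in> {w \<in> space M. norm (Z i w - Z' w) > \<epsilon> / K}" by (simp add: field_simps)
    qed
  qed measurable
  then show "((\<lambda>i. prob {w \<in> space M. norm (f (Z i w) - f (Z' w)) > \<epsilon>}) \<longlongrightarrow> 0) G"
    by (intro tendsto_sandwich[OF _ _ tendsto_const lim]) auto
qed

lemma (in prob_space) converges_in_prob_add:
  fixes Z W :: "'i \<Rightarrow> 'a \<Rightarrow> 'v::euclidean_space"
  assumes Z: "converges_in_prob M Z Z' G" and W: "converges_in_prob M W W' G"
    and [measurable]: "\<And>i. random_variable borel (Z i)" "random_variable borel Z'"
      "\<And>i. random_variable borel (W i)" "random_variable borel W'"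
  shows "converges_in_prob M (\<lambda>i w. Z i w + W i w) (\<lambda>w. Z' w + W' w) G"
  unfolding converges_in_prob_def
proof (intro allI impI)
  fix \<epsilon> :: real assume \<epsilon>: "\<epsilon> > 0"
  let ?P = "\<lambda>i. {w \<in> space M. norm (Z i w - Z' w) > \<epsilon> / 2}" and ?Q = "\<lambda>i. {w \<in> space M. norm (W i w - W' w) > \<epsilon> / 2}"
  have "((\<lambda>i. prob (?P i)) \<longlongrightarrow> 0) G" "((\<lambda>i. prob (?Q i)) \<longlongrightarrow> 0) G"
    using Z[unfolded converges_in_prob_def, rule_format, of "\<epsilon> / 2"]
      W[unfolded converges_in_prob_def, rule_format, of "\<epsilon> / 2"] \<epsilon> by auto
  then have lim: "((\<lambda>i. prob (?P i) + prob (?Q i)) \<longlongrightarrow> 0) G"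
    using tendsto_add by fastforce
  have "prob {w \<in> space M. norm ((Z i w + W i w) - (Z' w + W' w)) > \<epsilon>} \<le> prob (?P i) + prob (?Q i)" for i
  proof -
    have "{w \<in> space M. norm ((Z i w + W i w) - (Z' w + W' w)) > \<epsilon>} \<subseteq> ?P i \<union> ?Q i"
    proof
      fix w assume w: "w \<in> {w \<in> space M. norm ((Z i w + W i w) - (Z' w + W' w)) > \<epsilon>}"
      then have "\<epsilon> < norm (Z i w - Z' w) + norm (W i w - W' w)"
        using norm_diff_triangle_ineq[of "Z i w" "W i w" "Z' w" "W' w"] by simp
      with w show "w \<in> ?P i \<union> ?Q i" by auto
    qed
    then have "prob {w \<in> space M. norm ((Z i w + W i w) - (Z' w + W' w)) > \<epsilon>} \<le> prob (?P i \<union> ?Q i)"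
      by (rule finite_measure_mono) measurable
    also have "\<dots> \<le> prob (?P i) + prob (?Q i)" by (rule measure_Un_le) measurable
    finally show ?thesis .
  qed
  then show "((\<lambda>i. prob {w \<in> space M. norm ((Z i w + W i w) - (Z' w + W' w)) > \<epsilon>}) \<longlongrightarrow> 0) G"
    by (intro tendsto_sandwich[OF _ _ tendsto_const lim]) auto
qed

lemma (in prob_space) converges_in_prob_sum:
  fixes Z :: "'j \<Rightarrow> 'i \<Rightarrow> 'a \<Rightarrow> 'v::euclidean_space"
  assumes "finite J" "\<And>j. j \<in> J \<Longrightarrow> converges_in_prob M (Z j) (Z' j) G"
    and "\<And>j i. j \<in> J \<Longrightarrow> random_variable borel (Z j i)" "\<And>j. j \<in> J \<Longrightarrow> random_variable borel (Z' j)"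
  shows "converges_in_prob M (\<lambda>i w. \<Sum>j\<in>J. Z j i w) (\<lambda>w. \<Sum>j\<in>J. Z' j w) G"
  using assms
proof (induction rule: finite_induct)
  case empty
  then show ?case by (simp add: converges_in_prob_def)
next
  case (insert k J)
  have "converges_in_prob M (\<lambda>i w. Z k i w + (\<Sum>j\<in>J. Z j i w)) (\<lambda>w. Z' k w + (\<Sum>j\<in>J. Z' j w)) G"
    using insert by (intro converges_in_prob_add borel_measurable_sum) auto
  then show ?case using insert.hyps by simp
qed

text \<open>Index \<open>l\<close> is part \<open>l mod m\<close> of cell \<open>l div m\<close>, so
  node \<open>j\<close> reappears at \<open>j * m\<close>. At the last node of a grid with
  \<open>n\<close> cells the value \<open>x (Suc n)\<close> beyond the grid is multiplied by
  \<open>0\<close>.\<close>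

definition refine_grid :: "(nat \<Rightarrow> real) \<Rightarrow> nat \<Rightarrow> nat \<Rightarrow> real" where
  "refine_grid x m l = x (l div m) + real (l mod m) / real m * (x (Suc (l div m)) - x (l div m))"

lemma refine_grid_step:
  assumes "m > 0"
  shows "refine_grid x m (Suc l) - refine_grid x m l = (x (Suc (l div m)) - x (l div m)) / m"
proof (cases "Suc (l mod m) = m")
  case True
  then have next_cell: "Suc l div m = Suc (l div m)" "Suc l mod m = 0"
    by (simp_all add: div_Suc mod_Suc)
  have "real (l mod m) = real m - 1" using True assms by linarith
  then have last: "real (l mod m) / real m = 1 - 1 / real m" using assms by (simp add: diff_divide_distrib)
  show ?thesis
    unfolding refine_grid_def next_cell last by (simp add: algebra_simps diff_divide_distrib)
next
  case False
  then have "Suc l div m = l div m" "Suc l mod m = Suc (l mod m)"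
    using assms by (simp_all add: div_Suc mod_Suc)
  then show ?thesis
    unfolding refine_grid_def by (simp add: algebra_simps add_divide_distrib diff_divide_distrib)
qed

lemma is_grid_refine:
  assumes grid: "is_grid a b n x" and m: "m > 0" and j: "j \<le> n"
  shows "is_grid a (x j) (j * m) (refine_grid x m)"
  unfolding is_grid_def
proof (intro conjI allI impI)
  show "refine_grid x m 0 = a" using grid by (simp add: refine_grid_def is_grid_def)
  show "refine_grid x m (j * m) = x j" using m by (simp add: refine_grid_def)
  fix l assume "l < j * m"
  then have "l div m < n" using j m by (simp add: less_mult_imp_div_less order_less_le_trans)
  then have "x (Suc (l div m)) - x (l div m) > 0" using grid by (simp add: is_grid_def)
  then have "refine_grid x m (Suc l) - refine_grid x m l > 0"
    unfolding refine_grid_step[OF m] using m by simp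
  then show "refine_grid x m l < refine_grid x m (Suc l)" by simp
qed

lemma refine_grid_step_le:
  assumes grid: "is_grid a b n x" and m: "m > 0" and h: "\<And>i. i < n \<Longrightarrow> x (Suc i) - x i \<le> h"
    and l: "l < n * m"
  shows "refine_grid x m (Suc l) - refine_grid x m l \<le> h / m"
proof -
  have "l div m < n" using l by (simp add: less_mult_imp_div_less)
  then show ?thesis unfolding refine_grid_step[OF m] using h m by (simp add: divide_right_mono)
qed

text \<open>Cells are assigned to the integral up to \<open>x j\<close> by index in the Riemann sums
  and by time in the kernel estimate. The inequality is strict because left end points are used: the
  cell starting at \<open>x j\<close> lies outside.\<close>

lemma refine_grid_less_iff:
  assumes grid: "is_grid a b n x" and m: "m > 0" and j: "j \<le> n" and l: "l < n * m"
  shows "refine_grid x m l < x j \<longleftrightarrow> l < j * m"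
proof -
  have g: "is_grid a (x n) (n * m) (refine_grid x m)" by (rule is_grid_refine[OF grid m order_refl])
  have xj: "refine_grid x m (j * m) = x j" using m by (simp add: refine_grid_def)
  have jn: "j * m \<le> n * m" using j by simp
  show ?thesis
    using is_grid_less[OF g, of l "j * m"] is_grid_le[OF g, of "j * m" l] jn l xj
    by (metis less_imp_le linorder_not_less)
qed

context levy_process
begin

text \<open>All integrals start at \<open>0\<close> and use the same refinement, so the sum up to
  \<open>x j\<close> runs over the first \<open>j * Suc k\<close> increments of the longest one.
  Interchanging the sums gives each increment a weighted sum of the kernels as its
  coefficient.\<close>

lemma weighted_integrals_riemann_sum:
  fixes f :: "nat \<Rightarrow> real \<Rightarrow> real^'n" and \<beta> :: "real^'n" and \<alpha> :: "nat \<Rightarrow> complex"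
  assumes grid: "is_grid 0 T n x"
    and Z: "\<And>j. j \<le> n \<Longrightarrow> has_stoch_integral M L (f j) 0 (x j) (Z j)"
  shows "converges_in_prob M
    (\<lambda>k w. \<Sum>l<n * Suc k. of_real (L (refine_grid x (Suc k) (Suc l)) w - L (refine_grid x (Suc k) l) w) *
       (\<Sum>j<Suc n. \<alpha> j * of_real (if l < j * Suc k then \<beta> \<bullet> f j (refine_grid x (Suc k) l) else 0)))
    (\<lambda>w. \<Sum>j<Suc n. \<alpha> j * of_real (\<beta> \<bullet> Z j w)) sequentially"
proof -
  define u where "u k = refine_grid x (Suc k)" for k
  define R where "R j k w = (\<Sum>l<j * Suc k. (L (u k (Suc l)) w - L (u k l) w) *\<^sub>R f j (u k l))" for j k w
  have gridu: "is_grid 0 (x j) (j * Suc k) (u k)" if "j \<le> n" for j k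
    unfolding u_def by (rule is_grid_refine[OF grid _ that]) simp
  have R_conv: "converges_in_prob M (R j) (Z j) sequentially" if j: "j \<le> n" for j
  proof -
    have "\<forall>\<^sub>F k in sequentially. \<forall>i<j * Suc k. u k (Suc i) - u k i < \<delta>" if \<delta>: "\<delta> > 0" for \<delta>
    proof -
      \<comment> \<open>Including the index \<open>n\<close> keeps the set nonempty; a maximum that
        is too large does no harm.\<close>
      define h where "h = Max ((\<lambda>i. x (Suc i) - x i) ` {..n})"
      have h: "x (Suc i) - x i \<le> h" if "i < n" for i
        unfolding h_def using that by (intro Max_ge) auto
      have "((\<lambda>k. h / real (Suc k)) \<longlonglongrightarrow> 0)"
        by (intro LIMSEQ_Suc[where f = "\<lambda>k. h / real k"] lim_const_over_n)
      then have "\<forall>\<^sub>F k in sequentially. h / real (Suc k) < \<delta>"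
        using \<delta> by (rule order_tendstoD(2))
      then show ?thesis
      proof eventually_elim
        case (elim k)
        show ?case
        proof (intro allI impI)
          fix i assume "i < j * Suc k"
          also have "\<dots> \<le> n * Suc k" using j by (intro mult_right_mono) auto
          finally have "i < n * Suc k" .
          then have "u k (Suc i) - u k i \<le> h / real (Suc k)"
            unfolding u_def by (intro refine_grid_step_le[OF grid _ h]) auto
          with elim show "u k (Suc i) - u k i < \<delta>" by linarith
        qed
      qed
    qed
    then show ?thesis
      using Z[OF j, unfolded has_stoch_integral_def, THEN conjunct2, rule_format, of "\<lambda>k. j * Suc k" u] gridu[OF j]
      unfolding R_def by blast
  qed
  have Z_meas: "random_variable borel (Z j)" if "j \<le> n" for j
    using Z[OF that] by (simp add: has_stoch_integral_def)
  have R_meas: "random_variable borel (R j k)" if j: "j \<le> n" for j k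
    unfolding R_def
  proof (intro borel_measurable_sum borel_measurable_scaleR borel_measurable_const borel_measurable_diff measurable_L)
    fix l assume "l \<in> {..<j * Suc k}"
    then show "0 \<le> u k (Suc l)" "0 \<le> u k l"
      using is_grid_bounds[OF gridu[OF j, of k], of l] is_grid_bounds[OF gridu[OF j, of k], of "Suc l"] by auto
  qed
  have lin: "bounded_linear (\<lambda>v. \<alpha> j * complex_of_real (\<beta> \<bullet> v))" for j
    by (intro bounded_linear_compose[OF bounded_linear_mult_right]
        bounded_linear_compose[OF bounded_linear_of_real] bounded_linear_inner_right)
  have "converges_in_prob M (\<lambda>k w. \<Sum>j<Suc n. \<alpha> j * of_real (\<beta> \<bullet> R j k w))
      (\<lambda>w. \<Sum>j<Suc n. \<alpha> j * of_real (\<beta> \<bullet> Z j w)) sequentially"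
  proof (rule converges_in_prob_sum)
    fix j assume "j \<in> {..<Suc n}"
    then have j: "j \<le> n" by simp
    show "converges_in_prob M (\<lambda>k w. \<alpha> j * of_real (\<beta> \<bullet> R j k w)) (\<lambda>w. \<alpha> j * of_real (\<beta> \<bullet> Z j w)) sequentially"
      by (rule converges_in_prob_bounded_linear[OF R_conv[OF j] lin R_meas[OF j] Z_meas[OF j]])
    note [measurable] = R_meas[OF j] Z_meas[OF j]
    show "random_variable borel (\<lambda>w. \<alpha> j * of_real (\<beta> \<bullet> R j k w))" for k by measurable
    show "random_variable borel (\<lambda>w. \<alpha> j * of_real (\<beta> \<bullet> Z j w))" by measurable
  qed simp
  moreover have "(\<Sum>j<Suc n. \<alpha> j * of_real (\<beta> \<bullet> R j k w)) =
      (\<Sum>l<n * Suc k. of_real (L (u k (Suc l)) w - L (u k l) w) *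
         (\<Sum>j<Suc n. \<alpha> j * of_real (if l < j * Suc k then \<beta> \<bullet> f j (u k l) else 0)))" for k w
  proof -
    have expand: "\<alpha> j * of_real (\<beta> \<bullet> R j k w) = (\<Sum>l<n * Suc k. of_real (L (u k (Suc l)) w - L (u k l) w) *
        (\<alpha> j * of_real (if l < j * Suc k then \<beta> \<bullet> f j (u k l) else 0)))" if "j \<le> n" for j
    proof -
      have "j * Suc k \<le> n * Suc k" using that by (intro mult_right_mono) auto
      then have "(\<Sum>l<j * Suc k. of_real (L (u k (Suc l)) w - L (u k l) w) * (\<alpha> j * of_real (\<beta> \<bullet> f j (u k l)))) =
          (\<Sum>l<n * Suc k. of_real (L (u k (Suc l)) w - L (u k l) w) *
            (\<alpha> j * of_real (if l < j * Suc k then \<beta> \<bullet> f j (u k l) else 0)))"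
        by (intro sum.mono_neutral_cong_left) auto
      then show ?thesis
        by (simp add: R_def inner_sum_right sum_distrib_left mult_ac)
    qed
    have "(\<Sum>j<Suc n. \<alpha> j * of_real (\<beta> \<bullet> R j k w)) =
        (\<Sum>j<Suc n. \<Sum>l<n * Suc k. of_real (L (u k (Suc l)) w - L (u k l) w) *
          (\<alpha> j * of_real (if l < j * Suc k then \<beta> \<bullet> f j (u k l) else 0)))"
      by (rule sum.cong[OF refl]) (simp only: lessThan_iff less_Suc_eq_le expand)
    also have "\<dots> = (\<Sum>l<n * Suc k. \<Sum>j<Suc n. of_real (L (u k (Suc l)) w - L (u k l) w) *
          (\<alpha> j * of_real (if l < j * Suc k then \<beta> \<bullet> f j (u k l) else 0)))"
      by (rule sum.swap)
    finally show ?thesis by (simp only: sum_distrib_left)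
  qed
  ultimately show ?thesis by (simp only: u_def)
qed

end

section \<open>Convergence of the trapezoidal Fourier transform\<close>

context square_integrable_levy_process
begin

lemma increments_second_moment_tail:
  assumes grid: "is_grid 0 T m u" and mesh: "\<And>l. l < m \<Longrightarrow> u (Suc l) - u l \<le> 1"
    and q: "(\<Sum>l<m. (u (Suc l) - u l) * (c l)\<^sup>2) \<le> q" and R: "R > 0"
  shows "prob {w \<in> space M. R \<le> \<bar>\<Sum>l<m. c l * (L (u (Suc l)) w - L (u l) w)\<bar>} \<le> v * q / R\<^sup>2"
proof -
  let ?S = "\<lambda>w. \<Sum>l<m. c l * (L (u (Suc l)) w - L (u l) w)"
  have S: "integrable M (\<lambda>w. (?S w)\<^sup>2)" "expectation (\<lambda>w. (?S w)\<^sup>2) = v * (\<Sum>l<m. (u (Suc l) - u l) * (c l)\<^sup>2)"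
    using second_moment_sum_increments[OF grid mesh order_refl] by auto
  have "{w \<in> space M. R \<le> \<bar>?S w\<bar>} = {w \<in> space M. R\<^sup>2 \<le> (?S w)\<^sup>2}"
    using R by (auto simp: abs_le_square_iff[symmetric])
  then have "prob {w \<in> space M. R \<le> \<bar>?S w\<bar>} \<le> expectation (\<lambda>w. (?S w)\<^sup>2) / R\<^sup>2"
    using integral_Markov_inequality_measure[OF S(1) sets.empty_sets, of "R\<^sup>2"] R by simp
  also have "\<dots> \<le> v * q / R\<^sup>2"
    unfolding S(2) using q v_nonneg by (intro divide_right_mono mult_left_mono) auto
  finally show ?thesis .
qed

text \<open>\<open>c\<close> are the coefficients of the increments in
  \<open>Re (\<zeta> * W T w)\<close> and \<open>q\<close> is their sum of squares weighted by
  length. Bounded \<open>G\<close> makes the coefficients \<open>O(1 / sqrt T)\<close>, so the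
  expansion of the exponent applies, and \<open>q\<close> converges as a time average. Arbitrary
  complex \<open>\<zeta>\<close> cover all real linear functionals of the plane.\<close>

lemma step_integrals_char_tendsto:
  fixes G :: "real \<Rightarrow> nat \<Rightarrow> complex" and u :: "real \<Rightarrow> nat \<Rightarrow> real" and m :: "real \<Rightarrow> nat" and h :: "real \<Rightarrow> real"
  assumes C: "C \<ge> 0" and \<mu>: "\<mu> > 0" and h: "(h \<longlongrightarrow> 0) at_top"
    and ev: "\<forall>\<^sub>F T in at_top. is_grid 0 T (m T) (u T) \<and> (\<forall>l<m T. u T (Suc l) - u T l \<le> h T) \<and>
      (\<forall>l<m T. norm (G T l - iexp (- \<omega> * u T l) * H) \<le> C * (h T + exp (- \<mu> * (T - u T l))))"
  defines "W \<equiv> \<lambda>T w. of_real (1 / sqrt T) * (\<Sum>l<m T. of_real (L (u T (Suc l)) w - L (u T l) w) * G T l)"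
  shows "((\<lambda>T. \<integral>w. iexp (Re (\<zeta> * W T w)) \<partial>M) \<longlongrightarrow> exp (- of_real (v / 2 * limit_variance \<omega> (\<zeta> * H)))) at_top"
    and "\<epsilon> > 0 \<Longrightarrow> \<exists>R. \<forall>\<^sub>F T in at_top. prob {w \<in> space M. norm (W T w) > R} < \<epsilon>"
    and "\<forall>\<^sub>F T in at_top. random_variable borel (W T)"
proof -
  define c where "c \<zeta> T l = Re (\<zeta> * G T l) / sqrt T" for \<zeta> T l
  define q where "q \<zeta> T = (\<Sum>l<m T. (u T (Suc l) - u T l) * (c \<zeta> T l)\<^sup>2)" for \<zeta> T
  have h1: "\<forall>\<^sub>F T in at_top. h T < 1" using h by (rule order_tendstoD) simp
  have good: "\<forall>\<^sub>F T in at_top. T > 0 \<and> is_grid 0 T (m T) (u T) \<and> (\<forall>l<m T. u T (Suc l) - u T l \<le> h T) \<and> h T \<le> 1 \<and>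
      (\<forall>l<m T. norm (G T l - iexp (- \<omega> * u T l) * H) \<le> C * (h T + exp (- \<mu> * (T - u T l))))"
    using ev h1 eventually_gt_at_top[of 0] by eventually_elim auto
  have ReW: "Re (\<zeta> * W T w) = (\<Sum>l<m T. c \<zeta> T l * (L (u T (Suc l)) w - L (u T l) w))" for \<zeta> T w
  proof -
    have "\<zeta> * W T w = (\<Sum>l<m T. of_real ((L (u T (Suc l)) w - L (u T l) w) / sqrt T) * (\<zeta> * G T l))"
      by (simp add: W_def sum_distrib_left mult_ac divide_inverse)
    moreover have "Re (of_real r * z) = r * Re z" for r z by simp
    ultimately show ?thesis
      by (simp only: Re_sum) (simp add: c_def mult_ac)
  qed
  have q_lim: "(q \<zeta> \<longlongrightarrow> limit_variance \<omega> (\<zeta> * H)) at_top" for \<zeta>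
  proof -
    obtain K where K: "K \<ge> 0" and bound: "\<And>T m u h G. T > 0 \<Longrightarrow> is_grid 0 T m u \<Longrightarrow> (\<forall>l<m. u (Suc l) - u l \<le> h) \<Longrightarrow> h \<le> 1 \<Longrightarrow>
       (\<forall>l<m. norm (G l - iexp (- \<omega> * u l) * H) \<le> C * (h + exp (- \<mu> * (T - u l)))) \<Longrightarrow>
       \<bar>(\<Sum>l<m. (u (Suc l) - u l) * (Re (\<zeta> * G l))\<^sup>2) / T - limit_variance \<omega> (\<zeta> * H)\<bar> \<le> K * (h + 1 / T)"
      using kernel_square_riemann_sum[OF C \<mu>, of \<omega> H \<zeta>] by blast
    have "((\<lambda>T. K * (h T + 1 / T)) \<longlongrightarrow> K * (0 + 0)) at_top"
      by (intro tendsto_intros h tendsto_divide_0[OF tendsto_const] filterlim_at_top_imp_at_infinity filterlim_ident)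
    then have lim: "((\<lambda>T. K * (h T + 1 / T)) \<longlongrightarrow> 0) at_top" by simp
    have "\<forall>\<^sub>F T in at_top. norm (q \<zeta> T - limit_variance \<omega> (\<zeta> * H)) \<le> K * (h T + 1 / T)"
      using good
    proof eventually_elim
      case (elim T)
      have "q \<zeta> T = (\<Sum>l<m T. (u T (Suc l) - u T l) * (Re (\<zeta> * G T l))\<^sup>2) / T"
        using elim by (simp add: q_def c_def power_divide sum_divide_distrib)
      then show ?case using bound[of T "m T" "u T" "h T" "G T"] elim by simp
    qed
    then have "((\<lambda>T. q \<zeta> T - limit_variance \<omega> (\<zeta> * H)) \<longlongrightarrow> 0) at_top"
      using lim by (rule Lim_null_comparison)
    then show ?thesis by (rule LIM_zero_cancel)
  qed
  have c_small: "\<forall>\<^sub>F T in at_top. \<forall>l<m T. \<bar>c \<zeta> T l\<bar> < \<eta>" if \<eta>: "\<eta> > 0" for \<zeta> \<eta>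
  proof -
    define B where "B = norm \<zeta> * (norm H + 2 * C)"
    have "((\<lambda>T. B / sqrt T) \<longlongrightarrow> 0) at_top"
      by (intro tendsto_divide_0[OF tendsto_const] filterlim_at_top_imp_at_infinity sqrt_at_top)
    then have "\<forall>\<^sub>F T in at_top. B / sqrt T < \<eta>" using \<eta> by (rule order_tendstoD)
    then show ?thesis using good
    proof eventually_elim
      case (elim T)
      show ?case
      proof (intro allI impI)
        fix l assume l: "l < m T"
        have "u T l \<le> T" using is_grid_bounds[of 0 T "m T" "u T" l] elim l by simp
        then have "exp (- \<mu> * (T - u T l)) \<le> 1" using \<mu> by simp
        then have "h T + exp (- \<mu> * (T - u T l)) \<le> 2" using elim by linarith
        then have "C * (h T + exp (- \<mu> * (T - u T l))) \<le> C * 2" using C by (intro mult_left_mono) auto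
        then have "norm (G T l - iexp (- \<omega> * u T l) * H) \<le> 2 * C" using elim l by fastforce
        moreover have "norm (iexp (- \<omega> * u T l) * H) = norm H" by (simp add: norm_mult)
        ultimately have "norm (G T l) \<le> norm H + 2 * C"
          using norm_triangle_sub[of "G T l" "iexp (- \<omega> * u T l) * H"] by linarith
        then have "norm (\<zeta> * G T l) \<le> B" unfolding B_def norm_mult by (intro mult_left_mono) auto
        then have "\<bar>Re (\<zeta> * G T l)\<bar> \<le> B" using abs_Re_le_cmod[of "\<zeta> * G T l"] by linarith
        then have "\<bar>c \<zeta> T l\<bar> \<le> B / sqrt T" using elim by (simp add: c_def divide_right_mono)
        with elim show "\<bar>c \<zeta> T l\<bar> < \<eta>" by linarith
      qed
    qed
  qed
  show "((\<lambda>T. \<integral>w. iexp (Re (\<zeta> * W T w)) \<partial>M) \<longlongrightarrow> exp (- of_real (v / 2 * limit_variance \<omega> (\<zeta> * H)))) at_top"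
  proof (rule tendstoI)
    fix \<delta> :: real assume \<delta>: "\<delta> > 0"
    define V where "V = limit_variance \<omega> (\<zeta> * H)"
    have V: "V \<ge> 0" by (simp add: V_def limit_variance_def)
    have "isCont exp (- complex_of_real (v / 2 * V))" by (rule isCont_exp)
    then obtain \<gamma> where \<gamma>: "\<gamma> > 0"
      "\<And>z. dist z (- complex_of_real (v / 2 * V)) < \<gamma> \<Longrightarrow> dist (exp z) (exp (- complex_of_real (v / 2 * V))) < \<delta>"
      using \<delta> unfolding continuous_at by (metis LIM_def \<delta> dist_self)
    \<comment> \<open>\<open>q \<zeta> T\<close> is eventually below \<open>V + 1\<close>, so the
      expansion costs at most \<open>\<gamma> / 2\<close>; the other half is left for the distance
      of \<open>q \<zeta> T\<close> from \<open>V\<close>.\<close>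
    define \<epsilon>' where "\<epsilon>' = \<gamma> / (2 * (V + 1))"
    have \<epsilon>': "\<epsilon>' > 0" using \<gamma> V by (simp add: \<epsilon>'_def)
    obtain \<eta> where \<eta>: "\<eta> > 0" and expansion: "\<And>T m u c. is_grid 0 T m u \<Longrightarrow> (\<forall>l<m. u (Suc l) - u l \<le> 1) \<Longrightarrow> (\<forall>l<m. \<bar>c l\<bar> < \<eta>) \<Longrightarrow>
      (\<exists>z. (\<integral>w. iexp (\<Sum>l<m. c l * (L (u (Suc l)) w - L (u l) w)) \<partial>M) = exp z \<and>
        norm (z + v / 2 * (\<Sum>l<m. (u (Suc l) - u l) * (c l)\<^sup>2)) \<le> \<epsilon>' * (\<Sum>l<m. (u (Suc l) - u l) * (c l)\<^sup>2))"
      using char_sum_increments_expansion[OF \<epsilon>'] by blast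
    have "\<forall>\<^sub>F T in at_top. q \<zeta> T < V + 1"
      using q_lim[of \<zeta>] by (rule order_tendstoD) (simp add: V_def)
    moreover have "\<forall>\<^sub>F T in at_top. dist (q \<zeta> T) V < \<gamma> / (v + 1)"
      using q_lim[of \<zeta>] \<gamma> v_nonneg unfolding V_def by (intro tendstoD) auto
    ultimately show "\<forall>\<^sub>F T in at_top. dist (\<integral>w. iexp (Re (\<zeta> * W T w)) \<partial>M) (exp (- of_real (v / 2 * limit_variance \<omega> (\<zeta> * H)))) < \<delta>"
      using good c_small[OF \<eta>, of \<zeta>]
    proof eventually_elim
      case (elim T)
      have "\<exists>z. (\<integral>w. iexp (\<Sum>l<m T. c \<zeta> T l * (L (u T (Suc l)) w - L (u T l) w)) \<partial>M) = exp z \<and>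
          norm (z + v / 2 * q \<zeta> T) \<le> \<epsilon>' * q \<zeta> T"
        unfolding q_def using elim by (intro expansion) force+
      then obtain z where z: "(\<integral>w. iexp (Re (\<zeta> * W T w)) \<partial>M) = exp z" "norm (z + v / 2 * q \<zeta> T) \<le> \<epsilon>' * q \<zeta> T"
        unfolding ReW by blast
      have "\<epsilon>' * q \<zeta> T \<le> \<epsilon>' * (V + 1)" using elim \<epsilon>' by (intro mult_left_mono) auto
      also have "\<dots> = \<gamma> / 2" using V by (simp add: \<epsilon>'_def field_simps)
      finally have 1: "norm (z + v / 2 * q \<zeta> T) \<le> \<gamma> / 2" using z(2) by linarith
      have "\<bar>v / 2 * (q \<zeta> T - V)\<bar> = v / 2 * \<bar>q \<zeta> T - V\<bar>" using v_nonneg by (simp add: abs_mult)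
      also have "\<dots> \<le> (v + 1) / 2 * \<bar>q \<zeta> T - V\<bar>" by (intro mult_right_mono) auto
      also have "\<dots> < \<gamma> / 2"
        using elim v_nonneg by (simp add: dist_real_def field_simps)
      finally have 2: "norm (complex_of_real (v / 2 * (q \<zeta> T - V))) < \<gamma> / 2" by (simp only: norm_of_real)
      have "z - - complex_of_real (v / 2 * V) = (z + v / 2 * q \<zeta> T) - complex_of_real (v / 2 * (q \<zeta> T - V))"
        by (simp add: field_simps)
      then have "norm (z - - complex_of_real (v / 2 * V)) \<le>
          norm (z + v / 2 * q \<zeta> T) + norm (complex_of_real (v / 2 * (q \<zeta> T - V)))"
        by (simp only: norm_triangle_ineq4)
      then have "dist z (- complex_of_real (v / 2 * V)) < \<gamma>"
        unfolding dist_norm using 1 2 by linarith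
      then show ?case unfolding z(1) using \<gamma>(2) by (simp add: V_def)
    qed
  qed
  show "\<forall>\<^sub>F T in at_top. random_variable borel (W T)"
    using good
  proof eventually_elim
    case (elim T)
    then have grid: "is_grid 0 T (m T) (u T)" by simp
    have "random_variable borel (L (u T l))" if "l \<le> m T" for l
      using is_grid_bounds[OF grid that] by (intro measurable_L) simp
    then show ?case unfolding W_def
      by (intro borel_measurable_times borel_measurable_const borel_measurable_sum borel_measurable_of_real borel_measurable_diff) auto
  qed
  show "\<exists>R. \<forall>\<^sub>F T in at_top. prob {w \<in> space M. norm (W T w) > R} < \<epsilon>" if \<epsilon>: "\<epsilon> > 0"
  proof -
    \<comment> \<open>The factors \<open>1\<close> and \<open>- \<i>\<close> select the real and the
      imaginary part; \<open>Q\<close> eventually exceeds both sums of squares.\<close>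
    define Q where "Q = limit_variance \<omega> H + limit_variance \<omega> (- \<i> * H) + 1"
    have lv: "limit_variance \<omega> z \<ge> 0" for z by (simp add: limit_variance_def)
    have Q: "Q > 0" using lv[of H] lv[of "- \<i> * H"] by (simp add: Q_def)
    define R where "R = sqrt (8 * (v + 1) * Q / \<epsilon>) + 1"
    have "8 * (v + 1) * Q / \<epsilon> > 0" using v_nonneg Q \<epsilon> by simp
    then have R: "R > 0" "R\<^sup>2 > 8 * (v + 1) * Q / \<epsilon>"
      by (auto simp: R_def power2_sum add_pos_nonneg)
    have le: "v * Q / (R / 2)\<^sup>2 < \<epsilon> / 2"
    proof -
      have "8 * (v * Q) \<le> 8 * (v + 1) * Q" using Q by (simp add: algebra_simps)
      also have "\<dots> < \<epsilon> * R\<^sup>2" using R \<epsilon> by (simp add: field_simps)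
      finally show ?thesis using R(1) by (simp add: power_divide field_simps)
    qed
    have "\<forall>\<^sub>F T in at_top. q 1 T < Q" "\<forall>\<^sub>F T in at_top. q (- \<i>) T < Q"
      using q_lim[of 1] q_lim[of "- \<i>"] lv[of H] lv[of "- \<i> * H"]
      by (auto simp: Q_def intro!: order_tendstoD(2))
    then have "\<forall>\<^sub>F T in at_top. prob {w \<in> space M. norm (W T w) > R} < \<epsilon>"
      using good
    proof eventually_elim
      case (elim T)
      then have grid: "is_grid 0 T (m T) (u T)" by simp
      have mesh: "u T (Suc l) - u T l \<le> 1" if "l < m T" for l using elim that by force
      have meas: "random_variable borel (L (u T l))" if "l \<le> m T" for l
        using is_grid_bounds[OF grid that] by (intro measurable_L) simp
      have [measurable]: "random_variable borel (\<lambda>w. Re (\<zeta> * W T w))" for \<zeta>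
        unfolding ReW using meas
        by (intro borel_measurable_sum borel_measurable_times borel_measurable_const borel_measurable_diff) auto
      have tail: "prob {w \<in> space M. R / 2 \<le> \<bar>Re (\<zeta> * W T w)\<bar>} < \<epsilon> / 2" if "q \<zeta> T < Q" for \<zeta>
        unfolding ReW using le that R(1)
        by (intro le_less_trans[OF increments_second_moment_tail[OF grid mesh, where q = Q]]) (auto simp: q_def)
      let ?A = "{w \<in> space M. R / 2 \<le> \<bar>Re (1 * W T w)\<bar>}" and ?B = "{w \<in> space M. R / 2 \<le> \<bar>Re (- \<i> * W T w)\<bar>}"
      have "{w \<in> space M. norm (W T w) > R} \<subseteq> ?A \<union> ?B"
      proof
        fix w assume w: "w \<in> {w \<in> space M. norm (W T w) > R}"
        then have "R < \<bar>Re (W T w)\<bar> + \<bar>Im (W T w)\<bar>" using cmod_le[of "W T w"] by simp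
        then have "R / 2 \<le> \<bar>Re (W T w)\<bar> \<or> R / 2 \<le> \<bar>Im (W T w)\<bar>" by linarith
        with w show "w \<in> ?A \<union> ?B" by auto
      qed
      then have "prob {w \<in> space M. norm (W T w) > R} \<le> prob (?A \<union> ?B)"
        by (rule finite_measure_mono) measurable
      also have "\<dots> \<le> prob ?A + prob ?B" by (rule measure_Un_le) measurable
      also have "\<dots> < \<epsilon>" using tail[of 1] tail[of "- \<i>"] elim by linarith
      finally show ?case .
    qed
    then show ?thesis by blast
  qed
qed

end

section \<open>The mesh and the trapezoidal weights of the kernel\<close>

lemma h_max_ge:
  assumes "i < N - 1"
  shows "x (Suc i) - x i \<le> h_max N x"
  unfolding h_max_def using assms by (intro Max_ge) (auto intro!: image_eqI[of _ _ i])

text \<open>There is at least one grid point, so the cube of the mesh is dominated by the product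
  that tends to \<open>0\<close>; the mesh is positive because of its first cell.\<close>

lemma h_max_tendsto_0:
  assumes N: "\<And>T. T > 0 \<Longrightarrow> N T \<ge> 2" and grid: "\<And>T. T > 0 \<Longrightarrow> is_grid 0 T (N T - 1) (x T)"
    and mesh: "((\<lambda>T. real (N T) * (h_max (N T) (x T)) ^ 3) \<longlongrightarrow> 0) at_top"
  shows "((\<lambda>T. h_max (N T) (x T)) \<longlongrightarrow> 0) at_top"
proof (rule tendstoI)
  fix \<epsilon> :: real assume \<epsilon>: "\<epsilon> > 0"
  then have "\<forall>\<^sub>F T in at_top. real (N T) * (h_max (N T) (x T)) ^ 3 < \<epsilon> ^ 3"
    by (intro order_tendstoD(2)[OF mesh]) simp
  then show "\<forall>\<^sub>F T in at_top. dist (h_max (N T) (x T)) 0 < \<epsilon>"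
    using eventually_gt_at_top[of 0]
  proof eventually_elim
    case (elim T)
    then have N2: "N T \<ge> 2" and g: "is_grid 0 T (N T - 1) (x T)" using N grid by auto
    have "x T 0 < x T (Suc 0)" using is_grid_less[OF g, of 0 "Suc 0"] N2 by simp
    moreover have "x T (Suc 0) - x T 0 \<le> h_max (N T) (x T)" using N2 by (intro h_max_ge) simp
    ultimately have pos: "h_max (N T) (x T) > 0" by linarith
    then have "1 * (h_max (N T) (x T)) ^ 3 \<le> real (N T) * (h_max (N T) (x T)) ^ 3"
      using N2 by (intro mult_right_mono) auto
    with elim have "(h_max (N T) (x T)) ^ 3 < \<epsilon> ^ 3" by simp
    then have "h_max (N T) (x T) < \<epsilon>" by (rule power_less_imp_less_base) (use \<epsilon> in simp)
    with pos show ?case by (simp add: dist_real_def)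
  qed
qed

lemma trapezoid_fourier_measurable:
  assumes "\<And>j. j < N \<Longrightarrow> Y (x j) \<in> borel_measurable M"
  shows "trapezoid_fourier \<omega> T N x Y \<in> borel_measurable M"
  unfolding trapezoid_fourier_def[abs_def] using assms
  by (intro borel_measurable_times borel_measurable_const borel_measurable_sum borel_measurable_of_real) auto

text \<open>The phase at \<open>x\<close> is the phase at \<open>u\<close> times that at
  \<open>x - u\<close>: the first factors out, the second turns \<open>g\<close> into
  \<open>\<kappa>\<close>, and the quadrature bound applies beyond \<open>u\<close>. The term
  \<open>\<Phi> (T - u)\<close> is the loss from stopping at \<open>T\<close> and gives the
  exponential.\<close>

lemma trapezoid_kernel_sum:
  fixes a b :: "real poly" and A :: "((real, 'n::{finite,linorder}) vec, 'n) vec"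
    and \<Phi> \<kappa> \<kappa>' :: "real \<Rightarrow> complex"
  assumes \<mu>: "\<mu> > 0" and C: "C > 0"
    and \<Phi>': "\<And>t. (\<Phi> has_vector_derivative \<kappa> t) (at t)"
    and \<kappa>': "\<And>t. (\<kappa> has_vector_derivative \<kappa>' t) (at t)"
    and \<kappa>_le: "\<And>t. t \<ge> 0 \<Longrightarrow> norm (\<kappa> t) \<le> C * exp (- \<mu> * t)"
    and \<kappa>'_le: "\<And>t. t \<ge> 0 \<Longrightarrow> norm (\<kappa>' t) \<le> C * exp (- \<mu> * t)"
    and \<Phi>_le: "\<And>t. t \<ge> 0 \<Longrightarrow> norm (\<Phi> t) \<le> C * exp (- \<mu> * t)"
    and \<kappa>_eq: "\<And>t. \<kappa> t = exp (- (\<i> * of_real \<omega> * of_real t)) * of_real (g t)"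
    and grid: "is_grid 0 T n x" and n: "n \<ge> 1" and h: "\<And>i. i < n \<Longrightarrow> x (Suc i) - x i \<le> h" "h \<le> 1"
    and u: "0 \<le> u" "u < T"
  shows "norm ((\<Sum>j<Suc n. trapezoid_weight \<omega> (Suc n) x j * of_real (if x j > u then g (x j - u) else 0)) -
      iexp (- \<omega> * u) * (- \<Phi> 0)) \<le> (2 * C + 2 * C * exp \<mu> / \<mu> + C) * (h + exp (- \<mu> * (T - u)))"
proof -
  define w where "w i = (if x i > u then \<kappa> (x i - u) else 0)" for i
  define D where "D = (\<Sum>i<n. ((x (Suc i) - x i) / 2) *\<^sub>R (w i + w (Suc i)))"
  have summand: "trapezoid_weight \<omega> (Suc n) x j * of_real (if x j > u then g (x j - u) else 0) =
      iexp (- \<omega> * u) * (trapezoid_factor (Suc n) x j *\<^sub>R w j)" for j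
  proof -
    have "exp (- (\<i> * of_real \<omega> * of_real (x j))) =
        iexp (- \<omega> * u) * exp (- (\<i> * of_real \<omega> * of_real (x j - u)))"
      by (simp add: exp_add[symmetric] algebra_simps)
    then show ?thesis
      by (simp add: trapezoid_weight_eq w_def \<kappa>_eq scaleR_conv_of_real mult_ac)
  qed
  have "(\<Sum>j<Suc n. trapezoid_weight \<omega> (Suc n) x j * of_real (if x j > u then g (x j - u) else 0)) =
      iexp (- \<omega> * u) * D"
    unfolding summand sum_distrib_left[symmetric] D_def by (simp only: sum_trapezoid_factor[OF n])
  also have "iexp (- \<omega> * u) * D - iexp (- \<omega> * u) * (- \<Phi> 0) = iexp (- \<omega> * u) * (D + \<Phi> 0)"
    by (simp add: algebra_simps)
  also have "norm \<dots> = norm (D + \<Phi> 0)" by (simp add: norm_mult)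
  also have "D + \<Phi> 0 = (D - (\<Phi> (T - u) - \<Phi> 0)) + \<Phi> (T - u)" by simp
  also have "norm \<dots> \<le> (2 * C + 2 * C * exp \<mu> / \<mu>) * h + C * exp (- \<mu> * (T - u))"
  proof (rule norm_triangle_mono)
    show "norm (D - (\<Phi> (T - u) - \<Phi> 0)) \<le> (2 * C + 2 * C * exp \<mu> / \<mu>) * h"
      unfolding D_def w_def
      by (rule trapezoid_tail_sum[OF \<mu> C \<Phi>' \<kappa>' \<kappa>_le \<kappa>'_le grid h u])
    show "norm (\<Phi> (T - u)) \<le> C * exp (- \<mu> * (T - u))" using u by (intro \<Phi>_le) simp
  qed
  also have "\<dots> \<le> (2 * C + 2 * C * exp \<mu> / \<mu> + C) * h + (2 * C + 2 * C * exp \<mu> / \<mu> + C) * exp (- \<mu> * (T - u))"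
  proof (rule add_mono; rule mult_right_mono)
    show "0 \<le> h" using h(1)[of 0] n is_grid_less[OF grid, of 0 1] by simp
    have "2 * C * exp \<mu> / \<mu> \<ge> 0" using C \<mu> by simp
    then show "2 * C + 2 * C * exp \<mu> / \<mu> \<le> 2 * C + 2 * C * exp \<mu> / \<mu> + C"
      "C \<le> 2 * C + 2 * C * exp \<mu> / \<mu> + C" using C by linarith+
  qed simp
  finally show ?thesis by (simp only: distrib_left)
qed

context square_integrable_levy_process
begin

text \<open>The law of a finite sum of increments is accessible, that of the integral only through
  limits. \<open>W\<close> is therefore a Riemann sum over a refinement depending on
  \<open>T\<close>, divided by \<open>sqrt T\<close>.\<close>

lemma trapezoid_fourier_approximation:
  fixes X :: "real \<Rightarrow> 'a \<Rightarrow> (real, 'n::{finite,linorder}) vec" and a b :: "real poly"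
    and A :: "((real, 'n) vec, 'n) vec" and \<omega> :: real
  assumes a: "degree a = CARD('n)" "lead_coeff a = 1" and b: "degree b < CARD('n)"
    and A: "A = companion_matrix a"
    and eigenvalues: "\<forall>l. eigenvalue (map_matrix complex_of_real A) l \<longrightarrow> Re l < 0"
    and X: "state_process M L A last_unit_vector X"
    and N: "\<forall>T>0. N T \<ge> 2"
    and grid: "\<forall>T>0. is_grid 0 T (N T - 1) (x T)"
    and mesh: "((\<lambda>T. real (N T) * (h_max (N T) (x T)) ^ 3) \<longlongrightarrow> 0) at_top"
  defines "\<T> \<equiv> \<lambda>T. trapezoid_fourier \<omega> T (N T) (x T) (\<lambda>t w. coeff_vector b \<bullet> X t w)"
  shows "\<exists>W. (\<forall>\<zeta>. ((\<lambda>T. \<integral>w. iexp (Re (\<zeta> * W T w)) \<partial>M) \<longlongrightarrow>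
        exp (- of_real (v / 2 * limit_variance \<omega> (\<zeta> * transfer_function a b \<omega>)))) at_top) \<and>
      (\<forall>\<epsilon>>0. \<exists>R. \<forall>\<^sub>F T in at_top. prob {w \<in> space M. norm (W T w) > R} < \<epsilon>) \<and>
      (\<forall>\<^sub>F T in at_top. random_variable borel (W T)) \<and>
      converges_in_prob M (\<lambda>T w. \<T> T w - W T w) (\<lambda>_. 0) at_top"
proof -
  note N = N[rule_format] and grid = grid[rule_format]
  define \<beta> :: "(real, 'n) vec" where "\<beta> = coeff_vector b"
  define g where "g t = \<beta> \<bullet> (matrix_exp (t *\<^sub>R A) *v last_unit_vector)" for t
  define \<kappa> where "\<kappa> t = exp (- (\<i> * of_real \<omega> * of_real t)) * complex_of_real (g t)" for t
  obtain C \<mu> \<kappa>' \<Phi> where kernel: "\<mu> > 0" "C > 0"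
      "\<forall>t. (\<Phi> has_vector_derivative \<kappa> t) (at t)" "\<forall>t. (\<kappa> has_vector_derivative \<kappa>' t) (at t)"
      "\<forall>t\<ge>0. norm (\<kappa> t) \<le> C * exp (- \<mu> * t)" "\<forall>t\<ge>0. norm (\<kappa>' t) \<le> C * exp (- \<mu> * t)"
      "\<forall>t\<ge>0. norm (\<Phi> t) \<le> C * exp (- \<mu> * t)"
    and \<Phi>0: "\<Phi> 0 = - transfer_function a b \<omega>"
    and init: "\<forall>y t. t \<ge> 0 \<longrightarrow> \<bar>\<beta> \<bullet> (matrix_exp (t *\<^sub>R A) *v y)\<bar> \<le> C * exp (- \<mu> * t) * norm y"
    using companion_kernel[OF a b A eigenvalues, of \<omega>]
    by - (elim exE conjE, rule that[unfolded \<kappa>_def[abs_def] g_def[abs_def] \<beta>_def]; assumption)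
  note \<mu> = kernel(1) and C = kernel(2) and \<Phi>' = kernel(3)[rule_format] and \<kappa>' = kernel(4)[rule_format]
    and \<kappa>_le = kernel(5)[rule_format] and \<kappa>'_le = kernel(6)[rule_format] and \<Phi>_le = kernel(7)[rule_format]
    and init_le = init[rule_format]
  define n where "n T = N T - 1" for T
  have n: "n T \<ge> 1" "N T = Suc (n T)" if "T > 0" for T using N[OF that] by (auto simp: n_def)
  have gridn: "is_grid 0 T (n T) (x T)" if "T > 0" for T using grid[OF that] by (simp add: n_def)
  define h where "h T = h_max (N T) (x T)" for T
  have h_lim: "(h \<longlongrightarrow> 0) at_top" unfolding h_def[abs_def] by (rule h_max_tendsto_0[OF N grid mesh])
  have step: "x T (Suc i) - x T i \<le> h T" if "i < n T" for T i
    unfolding h_def using that by (intro h_max_ge) (simp add: n_def)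
  have X_meas: "random_variable borel (X t)" if "t \<ge> 0" for t
    using X that by (simp add: state_process_def)
  obtain Z where Z: "\<And>t. t \<ge> 0 \<Longrightarrow> has_stoch_integral M L (\<lambda>u. matrix_exp ((t - u) *\<^sub>R A) *v last_unit_vector) 0 t (Z t)"
    "\<And>t. t \<ge> 0 \<Longrightarrow> AE w in M. X t w = matrix_exp (t *\<^sub>R A) *v X 0 w + Z t w"
  proof -
    have "\<forall>t. \<exists>Z. t \<ge> 0 \<longrightarrow> has_stoch_integral M L (\<lambda>u. matrix_exp ((t - u) *\<^sub>R A) *v last_unit_vector) 0 t Z \<and>
        (AE w in M. X t w = matrix_exp (t *\<^sub>R A) *v X 0 w + Z w)"
      using X unfolding state_process_def by blast
    from choice[OF this] show thesis using that by blast
  qed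
  define \<alpha> where "\<alpha> T j = trapezoid_weight \<omega> (N T) (x T) j" for T j
  define u where "u T k = refine_grid (x T) (Suc k)" for T k
  define G where "G T k l = (\<Sum>j<Suc (n T). \<alpha> T j * of_real (if l < j * Suc k then g (x T j - u T k l) else 0))" for T k l
  define S where "S T k w = (\<Sum>l<n T * Suc k. of_real (L (u T k (Suc l)) w - L (u T k l) w) * G T k l)" for T k w
  define S' where "S' T w = (\<Sum>j<Suc (n T). \<alpha> T j * of_real (\<beta> \<bullet> Z (x T j) w))" for T w
  have S_conv: "converges_in_prob M (S T) (S' T) sequentially" if T: "T > 0" for T
    unfolding S_def[abs_def] S'_def G_def g_def u_def
    by (rule weighted_integrals_riemann_sum[OF gridn[OF T], where
          f = "\<lambda>j u. matrix_exp ((x T j - u) *\<^sub>R A) *v last_unit_vector"])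
       (use is_grid_bounds[OF gridn[OF T]] in \<open>auto intro!: Z(1)\<close>)
  \<comment> \<open>Diagonal choice: the Riemann sums converge for each fixed \<open>T\<close>, so a
    refinement is selected for every \<open>T\<close> with an error that vanishes as
    \<open>T\<close> grows.\<close>
  have "\<exists>k. prob {w \<in> space M. norm (S T k w - S' T w) > 1 / T} < 1 / T" if T: "T > 0" for T
  proof -
    have "(\<lambda>k. prob {w \<in> space M. norm (S T k w - S' T w) > 1 / T}) \<longlonglongrightarrow> 0"
      using S_conv[OF T] T unfolding converges_in_prob_def by simp
    then have "\<forall>\<^sub>F k in sequentially. prob {w \<in> space M. norm (S T k w - S' T w) > 1 / T} < 1 / T"
      using T by (intro order_tendstoD) auto
    then show ?thesis by (rule eventually_happens'[OF sequentially_bot])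
  qed
  then obtain k where k: "\<And>T. T > 0 \<Longrightarrow> prob {w \<in> space M. norm (S T (k T) w - S' T w) > 1 / T} < 1 / T"
    by metis
  define C' where "C' = 2 * C + 2 * C * exp \<mu> / \<mu> + C"
  have C': "C' \<ge> 0" using C \<mu> by (simp add: C'_def)
  have h1: "\<forall>\<^sub>F T in at_top. h T < 1" using h_lim by (rule order_tendstoD) simp
  have ev: "\<forall>\<^sub>F T in at_top. is_grid 0 T (n T * Suc (k T)) (u T (k T)) \<and>
      (\<forall>l<n T * Suc (k T). u T (k T) (Suc l) - u T (k T) l \<le> h T) \<and>
      (\<forall>l<n T * Suc (k T). norm (G T (k T) l - iexp (- \<omega> * u T (k T) l) * transfer_function a b \<omega>)
         \<le> C' * (h T + exp (- \<mu> * (T - u T (k T) l))))"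
    using h1 eventually_gt_at_top[of 0]
  proof eventually_elim
    case (elim T)
    then have T: "T > 0" and hT: "h T \<le> 1" by auto
    have xn: "x T (n T) = T" using gridn[OF T] by (simp add: is_grid_def)
    have gridu: "is_grid 0 T (n T * Suc (k T)) (u T (k T))"
      using is_grid_refine[OF gridn[OF T], of "Suc (k T)" "n T"] xn by (simp add: u_def)
    have h0: "h T \<ge> 0" using step[of 0 T] n(1)[OF T] is_grid_less[OF gridn[OF T], of 0 1] by simp
    show ?case
    proof (intro conjI allI impI gridu)
      fix l assume l: "l < n T * Suc (k T)"
      have "u T (k T) (Suc l) - u T (k T) l \<le> h T / real (Suc (k T))"
        unfolding u_def by (rule refine_grid_step_le[OF gridn[OF T] _ step l]) simp
      also have "\<dots> \<le> h T / 1" using h0 by (intro divide_left_mono) auto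
      finally show "u T (k T) (Suc l) - u T (k T) l \<le> h T" by simp
      have "G T (k T) l = (\<Sum>j<Suc (n T). trapezoid_weight \<omega> (Suc (n T)) (x T) j *
          of_real (if x T j > u T (k T) l then g (x T j - u T (k T) l) else 0))"
        unfolding G_def \<alpha>_def n(2)[OF T]
      proof (rule sum.cong[OF refl])
        fix j assume "j \<in> {..<Suc (n T)}"
        then have "u T (k T) l < x T j \<longleftrightarrow> l < j * Suc (k T)"
          unfolding u_def by (intro refine_grid_less_iff[OF gridn[OF T] _ _ l]) auto
        then show "trapezoid_weight \<omega> (Suc (n T)) (x T) j * of_real (if l < j * Suc (k T) then g (x T j - u T (k T) l) else 0) =
            trapezoid_weight \<omega> (Suc (n T)) (x T) j * of_real (if x T j > u T (k T) l then g (x T j - u T (k T) l) else 0)"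
          by (simp only:)
      qed
      moreover have "0 \<le> u T (k T) l" "u T (k T) l < T"
        using is_grid_bounds[OF gridu, of l] is_grid_less[OF gridu, of l "n T * Suc (k T)"] l gridu
        by (auto simp: is_grid_def)
      ultimately show "norm (G T (k T) l - iexp (- \<omega> * u T (k T) l) * transfer_function a b \<omega>)
          \<le> C' * (h T + exp (- \<mu> * (T - u T (k T) l)))"
        using trapezoid_kernel_sum[OF \<mu> C \<Phi>' \<kappa>' \<kappa>_le \<kappa>'_le \<Phi>_le \<kappa>_def gridn[OF T] n(1)[OF T] step hT]
        unfolding \<Phi>0 C'_def by simp
    qed
  qed
  define W where "W T w = of_real (1 / sqrt T) * S T (k T) w" for T w
  note limits = step_integrals_char_tendsto[OF C' \<mu> h_lim ev, folded S_def, folded W_def]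
  have "converges_in_prob M (\<lambda>T w. \<T> T w - W T w) (\<lambda>_. 0) at_top"
    unfolding converges_in_prob_def
  proof (intro allI impI)
    fix \<epsilon> :: real assume \<epsilon>: "\<epsilon> > 0"
    \<comment> \<open>\<open>C\<close> is the decay constant for the initial state,
      \<open>exp \<mu> / \<mu>\<close> bounds the exponentially weighted sum of the trapezoidal
      factors.\<close>
    define K where "K = C * exp \<mu> / \<mu>"
    have K: "K > 0" using C \<mu> by (simp add: K_def)
    have X0[measurable]: "random_variable borel (X 0)" by (rule X_meas) simp
    have bound: "\<forall>\<^sub>F T in at_top. prob {w \<in> space M. norm (\<T> T w - W T w - 0) > \<epsilon>} \<le>
        prob {w \<in> space M. norm (X 0 w) > \<epsilon> / (2 * K) * sqrt T} + 1 / T"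
      \<comment> \<open>For these \<open>T\<close> one has \<open>sqrt T \<ge> 1\<close> and
        \<open>1 / T \<le> \<epsilon> / 2\<close>: the Riemann error takes at most half of
        \<open>\<epsilon>\<close>, the initial state may take the other half.\<close>
      using h1 eventually_ge_at_top[of "max 1 (2 / \<epsilon>)"]
    proof eventually_elim
      case (elim T)
      then have T: "T > 0" and T1: "T \<ge> 1" and T2: "1 / T \<le> \<epsilon> / 2" and hT: "h T \<le> 1"
        using \<epsilon> by (auto simp: field_simps)
      have sqrtT: "sqrt T \<ge> 1" using T1 by simp
      have x_nonneg: "x T j \<ge> 0" if "j < Suc (n T)" for j using is_grid_bounds[OF gridn[OF T], of j] that by simp
      note [measurable] = measurable_L
      have Z_meas: "random_variable borel (Z (x T j))" if "j < Suc (n T)" for j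
        using Z(1)[OF x_nonneg[OF that]] by (simp add: has_stoch_integral_def)
      have S'_meas [measurable]: "random_variable borel (S' T)"
        unfolding S'_def[abs_def]
      proof (rule borel_measurable_sum)
        fix j assume "j \<in> {..<Suc (n T)}"
        then have [measurable]: "random_variable borel (Z (x T j))" by (intro Z_meas) simp
        show "random_variable borel (\<lambda>w. \<alpha> T j * of_real (\<beta> \<bullet> Z (x T j) w))" by measurable
      qed
      have u_nonneg: "u T (k T) l \<ge> 0" if "l \<le> n T * Suc (k T)" for l
        using is_grid_bounds[OF is_grid_refine[OF gridn[OF T], of "Suc (k T)" "n T"] that] by (simp add: u_def)
      have S_meas [measurable]: "random_variable borel (S T (k T))"
        unfolding S_def[abs_def] using u_nonneg
        by (intro borel_measurable_sum borel_measurable_times borel_measurable_of_real borel_measurable_diff measurable_L) auto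
      define I where "I w = (\<Sum>j<Suc (n T). \<alpha> T j * of_real (\<beta> \<bullet> (matrix_exp (x T j *\<^sub>R A) *v X 0 w)))" for w
      have I_le: "norm (I w) \<le> K * norm (X 0 w)" for w
      proof -
        have "norm (I w) \<le> (\<Sum>j<Suc (n T). (\<bar>trapezoid_factor (Suc (n T)) (x T) j\<bar> * exp (- \<mu> * x T j)) * (C * norm (X 0 w)))"
          unfolding I_def
        proof (rule sum_norm_le)
          fix j assume "j \<in> {..<Suc (n T)}"
          then have j: "x T j \<ge> 0" by (intro x_nonneg) simp
          have "norm (\<alpha> T j) = \<bar>trapezoid_factor (Suc (n T)) (x T) j\<bar>"
            by (simp add: \<alpha>_def n(2)[OF T] trapezoid_weight_eq norm_mult)
          then have "norm (\<alpha> T j * of_real (\<beta> \<bullet> (matrix_exp (x T j *\<^sub>R A) *v X 0 w))) \<le>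
              \<bar>trapezoid_factor (Suc (n T)) (x T) j\<bar> * (C * exp (- \<mu> * x T j) * norm (X 0 w))"
            using init_le[OF j, of "X 0 w"] by (simp add: norm_mult mult_left_mono)
          then show "norm (\<alpha> T j * of_real (\<beta> \<bullet> (matrix_exp (x T j *\<^sub>R A) *v X 0 w))) \<le>
              (\<bar>trapezoid_factor (Suc (n T)) (x T) j\<bar> * exp (- \<mu> * x T j)) * (C * norm (X 0 w))"
            by (simp only: mult_ac)
        qed
        also have "\<dots> = (\<Sum>j<Suc (n T). \<bar>trapezoid_factor (Suc (n T)) (x T) j\<bar> * exp (- \<mu> * x T j)) * (C * norm (X 0 w))"
          by (rule sum_distrib_right[symmetric])
        also have "\<dots> \<le> exp \<mu> / \<mu> * (C * norm (X 0 w))"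
          using C step hT
          by (intro mult_right_mono sum_trapezoid_factor_exp[OF gridn[OF T] n(1)[OF T] \<mu>]) (auto intro: order_trans)
        finally show ?thesis by (simp add: K_def mult_ac)
      qed
      \<comment> \<open>The state formula holds almost surely at each time; for finitely many grid
        points one null set suffices.\<close>
      have "AE w in M. \<forall>j\<in>{..<Suc (n T)}. X (x T j) w = matrix_exp (x T j *\<^sub>R A) *v X 0 w + Z (x T j) w"
        using x_nonneg Z(2) by (intro AE_finite_allI) auto
      then have decomp: "AE w in M. \<T> T w - W T w = of_real (1 / sqrt T) * (I w + (S' T w - S T (k T) w))"
      proof eventually_elim
        case (elim w)
        have "(\<Sum>j<N T. trapezoid_weight \<omega> (N T) (x T) j * of_real (coeff_vector b \<bullet> X (x T j) w)) =
            (\<Sum>j<Suc (n T). \<alpha> T j * of_real (\<beta> \<bullet> (matrix_exp (x T j *\<^sub>R A) *v X 0 w)) + \<alpha> T j * of_real (\<beta> \<bullet> Z (x T j) w))"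
          unfolding n(2)[OF T] \<alpha>_def \<beta>_def[symmetric]
          using elim by (intro sum.cong) (auto simp: inner_add_right distrib_left)
        also have "\<dots> = I w + S' T w" unfolding I_def S'_def by (rule sum.distrib)
        finally show ?case
          by (simp add: \<T>_def trapezoid_fourier_def W_def algebra_simps)
      qed
      let ?P = "{w \<in> space M. norm (X 0 w) > \<epsilon> / (2 * K) * sqrt T}" and ?Q = "{w \<in> space M. norm (S T (k T) w - S' T w) > 1 / T}"
      have "AE w in M. w \<in> {w \<in> space M. norm (\<T> T w - W T w - 0) > \<epsilon>} \<longrightarrow> w \<in> ?P \<union> ?Q"
        using decomp AE_space
      proof eventually_elim
        case (elim w)
        show ?case
        proof (rule impI, rule ccontr)
          assume big: "w \<in> {w \<in> space M. norm (\<T> T w - W T w - 0) > \<epsilon>}" and "w \<notin> ?P \<union> ?Q"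
          then have 1: "norm (X 0 w) \<le> \<epsilon> / (2 * K) * sqrt T" and 2: "norm (S T (k T) w - S' T w) \<le> 1 / T"
            using elim by auto
          have "norm (I w) \<le> K * (\<epsilon> / (2 * K) * sqrt T)"
            using I_le[of w] mult_left_mono[OF 1, of K] K by linarith
          also have "\<dots> = \<epsilon> / 2 * sqrt T" using K by simp
          finally have "norm (I w) \<le> \<epsilon> / 2 * sqrt T" .
          moreover have "norm (S' T w - S T (k T) w) \<le> \<epsilon> / 2 * sqrt T"
          proof -
            have "\<epsilon> / 2 * 1 \<le> \<epsilon> / 2 * sqrt T" using sqrtT \<epsilon> by (intro mult_left_mono) auto
            then show ?thesis using 2 T2 by (simp add: norm_minus_commute)
          qed
          ultimately have "norm (I w + (S' T w - S T (k T) w)) \<le> \<epsilon> * sqrt T"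
            using norm_triangle_ineq[of "I w" "S' T w - S T (k T) w"] by (simp add: field_simps)
          then have "1 / sqrt T * norm (I w + (S' T w - S T (k T) w)) \<le> 1 / sqrt T * (\<epsilon> * sqrt T)"
            using sqrtT by (intro mult_left_mono) auto
          also have "\<dots> = \<epsilon>" using sqrtT by simp
          finally have "norm (\<T> T w - W T w) \<le> \<epsilon>"
            unfolding elim(1) norm_mult norm_of_real using sqrtT by simp
          with big show False by simp
        qed
      qed
      then have "prob {w \<in> space M. norm (\<T> T w - W T w - 0) > \<epsilon>} \<le> prob (?P \<union> ?Q)"
        by (rule finite_measure_mono_AE) measurable
      also have "\<dots> \<le> prob ?P + prob ?Q" by (rule measure_Un_le) measurable
      also have "\<dots> \<le> prob ?P + 1 / T" using k[OF T] by simp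
      finally show ?case .
    qed
    have "((\<lambda>T. prob {w \<in> space M. norm (X 0 w) > \<epsilon> / (2 * K) * sqrt T} + 1 / T) \<longlongrightarrow> 0) at_top"
    proof (rule tendsto_add_zero)
      show "((\<lambda>T :: real. 1 / T) \<longlongrightarrow> 0) at_top"
        by (intro tendsto_divide_0[OF tendsto_const] filterlim_at_top_imp_at_infinity filterlim_ident)
      have "((\<lambda>R. prob {w \<in> space M. norm (X 0 w) > R}) \<longlongrightarrow> 0) at_top"
      proof (rule tendstoI)
        fix \<delta> :: real assume "\<delta> > 0"
        then obtain R0 where "\<forall>R\<ge>R0. prob {w \<in> space M. norm (X 0 w) > R} < \<delta>"
          using norm_tail_tight[OF X0] by blast
        then show "\<forall>\<^sub>F R in at_top. dist (prob {w \<in> space M. norm (X 0 w) > R}) 0 < \<delta>"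
          unfolding eventually_at_top_linorder by (auto simp: dist_real_def)
      qed
      moreover have "filterlim (\<lambda>T. \<epsilon> / (2 * K) * sqrt T) at_top at_top"
        using \<epsilon> K by (intro filterlim_tendsto_pos_mult_at_top[OF tendsto_const] sqrt_at_top) auto
      ultimately show "((\<lambda>T. prob {w \<in> space M. norm (X 0 w) > \<epsilon> / (2 * K) * sqrt T}) \<longlongrightarrow> 0) at_top"
        by (rule filterlim_compose)
    qed
    then show "((\<lambda>T. prob {w \<in> space M. norm (\<T> T w - W T w - 0) > \<epsilon>}) \<longlongrightarrow> 0) at_top"
      by (rule tendsto_sandwich[OF _ bound tendsto_const, rotated]) simp
  qed
  with limits show ?thesis by (intro exI[of _ W]) blast
qed

text \<open>\<open>\<tau>\<close> is an isometric embedding of the plane: the vector of real and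
  imaginary part at nonzero frequency, the identity at frequency zero. Linear functionals of
  \<open>\<tau> z\<close> take the form \<open>Re (\<zeta> * z)\<close>, for which the limits of
  \<open>W\<close> are known.\<close>

lemma trapezoid_fourier_converges_in_distr:
  fixes \<tau> :: "complex \<Rightarrow> 'v::euclidean_space"
  assumes \<tau>: "bounded_linear \<tau>" "\<And>z. norm (\<tau> z) = norm z"
    and \<mu>: "prob_space \<mu>" "sets \<mu> = sets borel"
    and char: "\<And>\<theta>. \<exists>\<zeta>. (\<forall>z. \<theta> \<bullet> \<tau> z = Re (\<zeta> * z)) \<and>
      (\<integral>z. iexp (\<theta> \<bullet> z) \<partial>\<mu>) = exp (- of_real (v / 2 * limit_variance \<omega> (\<zeta> * H)))"
    and W: "\<And>\<zeta>. ((\<lambda>T. \<integral>w. iexp (Re (\<zeta> * W T w)) \<partial>M) \<longlongrightarrow>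
        exp (- of_real (v / 2 * limit_variance \<omega> (\<zeta> * H)))) at_top"
      "\<And>\<epsilon>. \<epsilon> > 0 \<Longrightarrow> \<exists>R. \<forall>\<^sub>F T in at_top. prob {w \<in> space M. norm (W T w) > R} < \<epsilon>"
      "\<forall>\<^sub>F T in at_top. random_variable borel (W T)"
    and Z: "converges_in_prob M (\<lambda>T w. Z T w - W T w) (\<lambda>_. 0) at_top"
      "\<forall>\<^sub>F T in at_top. random_variable borel (Z T)"
  shows "converges_in_distr M (\<lambda>T w. \<tau> (Z T w)) \<mu> at_top"
proof (rule converges_in_distr_slutsky[OF prob_space_axioms \<mu>, where W = "\<lambda>T w. \<tau> (W T w)"])
  interpret \<tau>: bounded_linear \<tau> by fact
  have [measurable]: "\<tau> \<in> borel_measurable borel"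
    by (intro borel_measurable_continuous_onI \<tau>.continuous_on continuous_on_id)
  show "\<forall>\<^sub>F T in at_top. random_variable borel (\<lambda>w. \<tau> (Z T w))"
    using Z(2) by eventually_elim measurable
  show "\<forall>\<^sub>F T in at_top. random_variable borel (\<lambda>w. \<tau> (W T w))"
    using W(3) by eventually_elim measurable
  show "((\<lambda>T. \<integral>w. iexp (\<theta> \<bullet> \<tau> (W T w)) \<partial>M) \<longlongrightarrow> (\<integral>z. iexp (\<theta> \<bullet> z) \<partial>\<mu>)) at_top" for \<theta>
  proof -
    obtain \<zeta> where \<zeta>: "\<And>z. \<theta> \<bullet> \<tau> z = Re (\<zeta> * z)"
      "(\<integral>z. iexp (\<theta> \<bullet> z) \<partial>\<mu>) = exp (- of_real (v / 2 * limit_variance \<omega> (\<zeta> * H)))"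
      using char by blast
    show ?thesis unfolding \<zeta>(2) \<zeta>(1) by (rule W(1))
  qed
  show "\<exists>R. \<forall>\<^sub>F T in at_top. prob {w \<in> space M. norm (\<tau> (W T w)) > R} < \<epsilon>" if "\<epsilon> > 0" for \<epsilon>
    unfolding \<tau>(2) by (rule W(2)[OF that])
  show "converges_in_prob M (\<lambda>T w. \<tau> (Z T w) - \<tau> (W T w)) (\<lambda>_. 0) at_top"
    using Z(1) unfolding converges_in_prob_def by (simp add: \<tau>.diff[symmetric] \<tau>(2))
qed

end

section \<open>The limit laws at nonzero and at zero frequency\<close>

lemma transfer_function_0: "transfer_function a b 0 = of_real (poly b 0 / poly a 0)"
  by (simp add: transfer_function_def poly_0_coeff_0 coeff_map_poly)

lemma bounded_linear_vector_Re_Im: "bounded_linear (\<lambda>z. vector [Re z, Im z] :: real^2)"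
  by (intro linear_conv_bounded_linear[THEN iffD1] linearI) (simp_all add: vec_eq_iff forall_2)

lemma norm_vector_Re_Im: "norm (vector [Re z, Im z] :: real^2) = norm z"
  by (simp add: norm_vec_def L2_set_def sum_2 cmod_def)

theorem theorem3p15:
  fixes M :: "'a measure"
    and F :: "real \<Rightarrow> 'a measure"
    and L L' :: "real \<Rightarrow> 'a \<Rightarrow> real"
    and X :: "real \<Rightarrow> 'a \<Rightarrow> (real, 'n::{finite,linorder}) vec"
    and Y :: "real \<Rightarrow> 'a \<Rightarrow> real"
    and A :: "((real, 'n) vec, 'n) vec"
    and a b :: "real poly"
    and q :: nat
    and \<sigma> \<omega> :: real
    and N :: "real \<Rightarrow> nat"
    and x :: "real \<Rightarrow> nat \<Rightarrow> real"
    and \<T> :: "real \<Rightarrow> 'a \<Rightarrow> complex"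
    and \<Sigma> :: "real^2^2"
  assumes q_less: "q < CARD('n)"
    and a: "degree a = CARD('n)" "lead_coeff a = 1"
    and b: "coeff b q \<noteq> 0" "\<And>j. q < j \<Longrightarrow> coeff b j = 0"
    and A: "A = companion_matrix a"
    and L: "levy_process M F L"
    and L': "independent_copy M L L'"
    and X: "state_process M L A last_unit_vector X"
    and Y: "\<And>t w. Y t w = coeff_vector b \<bullet> X t w"
    and mean_L: "integrable M (L 1)" "(\<integral>w. L 1 w \<partial>M) = 0"
    and var_L: "integrable M (\<lambda>w. \<bar>L 1 w\<bar>\<^sup>2)" "(\<integral>w. \<bar>L 1 w\<bar>\<^sup>2 \<partial>M) = \<sigma>\<^sup>2"
    and X0_indep: "independent_rvs M borel (X 0) path_space (path_map L)"
    and eigenvalues: "\<And>l. eigenvalue (map_matrix complex_of_real A) l \<Longrightarrow> Re l < 0"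
    and X0_distr: "\<exists>Z. has_stoch_integral_minf M (two_sided L L')
                          (\<lambda>u. matrix_exp ((- u) *\<^sub>R A) *v last_unit_vector) 0 Z \<and>
                        distr M borel (X 0) = distr M borel Z"
    and N: "\<And>T. T > 0 \<Longrightarrow> N T \<ge> 2"
    and grid: "\<And>T. T > 0 \<Longrightarrow> is_grid 0 T (N T - 1) (x T)"
    and mesh: "((\<lambda>T. real (N T) * (h_max (N T) (x T)) ^ 3) \<longlongrightarrow> 0) at_top"
    and \<T>: "\<And>T w. \<T> T w = trapezoid_fourier \<omega> T (N T) (x T) Y w"
    and \<Sigma>: "\<Sigma> = (\<sigma>\<^sup>2 / 2 * (cmod (transfer_function a b \<omega>))\<^sup>2) *\<^sub>R mat 1"
  shows "(\<omega> \<noteq> 0 \<longrightarrow>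
           converges_in_distr M (\<lambda>T w. vector [Re (\<T> T w), Im (\<T> T w)] :: real^2)
             (multivariate_normal_law 0 \<Sigma>) at_top \<and>
           converges_in_distr M (\<lambda>T w. (Re (\<T> T w))\<^sup>2 + (Im (\<T> T w))\<^sup>2)
             (exponential_law (\<sigma>\<^sup>2 * (cmod (transfer_function a b \<omega>))\<^sup>2)) at_top) \<and>
         (\<omega> = 0 \<longrightarrow>
           converges_in_distr M \<T>
             (distr (normal_law 0 ((poly b 0 / poly a 0)\<^sup>2 * \<sigma>\<^sup>2)) borel complex_of_real) at_top \<and>
           (poly b 0 \<noteq> 0 \<and> \<sigma>\<^sup>2 > 0 \<longrightarrow>
             converges_in_distr M
               (\<lambda>T w. 1 / \<sigma>\<^sup>2 *
                  (cmod (complex_of_real (poly a 0) * \<T> T w / complex_of_real (poly b 0)))\<^sup>2)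
               (chi_squared_law 1) at_top))"
proof -
  interpret levy_process M F L by fact
  interpret square_integrable_levy_process M F L "\<sigma>\<^sup>2"
    by unfold_locales (use mean_L var_L in simp_all)
  define H where "H = transfer_function a b \<omega>"
  have "degree b \<le> q" using b(2) by (intro degree_le) auto
  then have deg_b: "degree b < CARD('n)" using q_less by simp
  have \<T>_eq: "\<T> T = trapezoid_fourier \<omega> T (N T) (x T) (\<lambda>t w. coeff_vector b \<bullet> X t w)" for T
    using \<T> Y by (simp add: fun_eq_iff trapezoid_fourier_def)
  have stable: "\<forall>l. eigenvalue (map_matrix complex_of_real A) l \<longrightarrow> Re l < 0"
    and N2: "\<forall>T>0. N T \<ge> 2" and grids: "\<forall>T>0. is_grid 0 T (N T - 1) (x T)"
    using eigenvalues N grid by blast+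
  have "\<exists>W. (\<forall>\<zeta>. ((\<lambda>T. \<integral>w. iexp (Re (\<zeta> * W T w)) \<partial>M) \<longlongrightarrow>
          exp (- of_real (\<sigma>\<^sup>2 / 2 * limit_variance \<omega> (\<zeta> * H)))) at_top) \<and>
      (\<forall>\<epsilon>>0. \<exists>R. \<forall>\<^sub>F T in at_top. prob {w \<in> space M. norm (W T w) > R} < \<epsilon>) \<and>
      (\<forall>\<^sub>F T in at_top. random_variable borel (W T)) \<and>
      converges_in_prob M (\<lambda>T w. \<T> T w - W T w) (\<lambda>_. 0) at_top"
    unfolding \<T>_eq H_def by (rule trapezoid_fourier_approximation[OF a deg_b A stable X N2 grids mesh])
  then obtain W where "(\<forall>\<zeta>. ((\<lambda>T. \<integral>w. iexp (Re (\<zeta> * W T w)) \<partial>M) \<longlongrightarrow>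
          exp (- of_real (\<sigma>\<^sup>2 / 2 * limit_variance \<omega> (\<zeta> * H)))) at_top) \<and>
      (\<forall>\<epsilon>>0. \<exists>R. \<forall>\<^sub>F T in at_top. prob {w \<in> space M. norm (W T w) > R} < \<epsilon>) \<and>
      (\<forall>\<^sub>F T in at_top. random_variable borel (W T)) \<and>
      converges_in_prob M (\<lambda>T w. \<T> T w - W T w) (\<lambda>_. 0) at_top" (is "?P1 \<and> ?P2 \<and> ?P3 \<and> ?P4")
    by (rule exE)
  then have W: ?P1 ?P2 ?P3 and diff: ?P4 by blast+
  have meas: "\<forall>\<^sub>F T in at_top. random_variable borel (\<T> T)"
    using eventually_gt_at_top[of 0]
  proof eventually_elim
    case (elim T)
    have "random_variable borel (X (x T j))" if "j < N T" for j
      using X is_grid_bounds[OF grid[OF elim], of j] that by (simp add: state_process_def)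
    then show ?case unfolding \<T>_eq by (intro trapezoid_fourier_measurable) measurable
  qed
  note conv = trapezoid_fourier_converges_in_distr
    [OF _ _ _ _ _ W(1)[rule_format] W(2)[rule_format] W(3) diff meas]
  show ?thesis
  proof (intro conjI impI)
    assume \<omega>: "\<omega> \<noteq> 0"
    define s where "s = \<sigma>\<^sup>2 / 2 * (cmod H)\<^sup>2"
    have s: "s \<ge> 0" by (simp add: s_def)
    have \<Sigma>_eq: "\<Sigma> = s *\<^sub>R mat 1" by (simp add: \<Sigma> s_def H_def)
    show normal: "converges_in_distr M (\<lambda>T w. vector [Re (\<T> T w), Im (\<T> T w)] :: real^2)
        (multivariate_normal_law 0 \<Sigma>) at_top"
    proof (rule conv[OF bounded_linear_vector_Re_Im norm_vector_Re_Im])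
      fix \<theta> :: "real^2"
      \<comment> \<open>With the conjugate sign \<open>Re (\<zeta> * z)\<close> is the inner product
        of \<open>\<theta>\<close> with the vector of real and imaginary part; the norms agree,
        hence so do the variances.\<close>
      define \<zeta> where "\<zeta> = Complex (\<theta> $ 1) (- (\<theta> $ 2))"
      have "(cmod \<zeta>)\<^sup>2 = (norm \<theta>)\<^sup>2"
        unfolding power2_norm_eq_inner[of \<theta>] cmod_power2
        by (simp add: \<zeta>_def inner_vec_def sum_2 power2_eq_square)
      then have "(\<integral>z. iexp (\<theta> \<bullet> z) \<partial>multivariate_normal_law 0 \<Sigma>) = exp (- of_real (\<sigma>\<^sup>2 / 2 * limit_variance \<omega> (\<zeta> * H)))"
        unfolding \<Sigma>_eq char_multivariate_normal_law[OF s] using \<omega>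
        by (simp add: limit_variance_def s_def norm_mult power_mult_distrib mult_ac)
      moreover have "\<theta> \<bullet> vector [Re z, Im z] = Re (\<zeta> * z)" for z
        by (simp add: \<zeta>_def inner_vec_def sum_2)
      ultimately show "\<exists>\<zeta>. (\<forall>z. \<theta> \<bullet> vector [Re z, Im z] = Re (\<zeta> * z)) \<and>
          (\<integral>z. iexp (\<theta> \<bullet> z) \<partial>multivariate_normal_law 0 \<Sigma>) = exp (- of_real (\<sigma>\<^sup>2 / 2 * limit_variance \<omega> (\<zeta> * H)))"
        by blast
    qed (rule prob_space_multivariate_normal_law sets_multivariate_normal_law)+
    have \<tau>_meas: "(\<lambda>z. vector [Re z, Im z] :: real^2) \<in> borel_measurable borel"
      by (intro borel_measurable_continuous_onI linear_continuous_on bounded_linear_vector_Re_Im)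
    have "converges_in_distr M (\<lambda>T w. (norm (vector [Re (\<T> T w), Im (\<T> T w)] :: real^2))\<^sup>2)
        (distr (multivariate_normal_law 0 \<Sigma>) borel (\<lambda>z. (norm z)\<^sup>2)) at_top"
    proof (rule converges_in_distr_comp[OF normal])
      show "\<forall>\<^sub>F T in at_top. random_variable borel (\<lambda>w. vector [Re (\<T> T w), Im (\<T> T w)] :: real^2)"
        using meas by eventually_elim (rule measurable_compose[OF _ \<tau>_meas])
    qed (auto intro!: continuous_intros simp: sets_multivariate_normal_law)
    then show "converges_in_distr M (\<lambda>T w. (Re (\<T> T w))\<^sup>2 + (Im (\<T> T w))\<^sup>2)
        (exponential_law (\<sigma>\<^sup>2 * (cmod (transfer_function a b \<omega>))\<^sup>2)) at_top"
      unfolding \<Sigma>_eq distr_square_norm_multivariate_normal_law[OF s] norm_vector_Re_Im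
      by (simp add: s_def H_def cmod_power2)
  next
    assume \<omega>: "\<omega> = 0"
    define r where "r = poly b 0 / poly a 0"
    have H: "H = of_real r" by (simp add: H_def \<omega> transfer_function_0 r_def)
    \<comment> \<open>The transform is complex valued also at frequency zero, so the real normal law
      is carried to the real axis; only \<open>Re \<theta>\<close> enters its characteristic
      function.\<close>
    let ?\<mu> = "distr (normal_law 0 (r\<^sup>2 * \<sigma>\<^sup>2)) borel complex_of_real"
    interpret N: prob_space "normal_law 0 (r\<^sup>2 * \<sigma>\<^sup>2)" by (rule prob_space_normal_law) simp
    have of_real_meas [measurable]: "complex_of_real \<in> borel_measurable (normal_law 0 (r\<^sup>2 * \<sigma>\<^sup>2))"
      by (simp add: measurable_cong_sets[OF sets_normal_law refl])
    have "converges_in_distr M (\<lambda>T w. \<T> T w) ?\<mu> at_top"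
    proof (rule conv[OF bounded_linear_ident])
      show "prob_space ?\<mu>" by (rule N.prob_space_distr[OF of_real_meas])
      fix \<theta> :: complex
      have "(\<integral>z. iexp (\<theta> \<bullet> z) \<partial>?\<mu>) = (\<integral>x. iexp (Re \<theta> * x) \<partial>normal_law 0 (r\<^sup>2 * \<sigma>\<^sup>2))"
        by (subst integral_distr[OF of_real_meas]) (auto simp: inner_complex_def)
      also have "\<dots> = exp (- of_real (\<sigma>\<^sup>2 / 2 * limit_variance \<omega> (cnj \<theta> * H)))"
        by (subst char_normal_law) (auto simp: limit_variance_def \<omega> H power_mult_distrib mult_ac)
      finally show "\<exists>\<zeta>. (\<forall>z. \<theta> \<bullet> z = Re (\<zeta> * z)) \<and> (\<integral>z. iexp (\<theta> \<bullet> z) \<partial>?\<mu>) =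
          exp (- of_real (\<sigma>\<^sup>2 / 2 * limit_variance \<omega> (\<zeta> * H)))"
        by (intro exI[of _ "cnj \<theta>"]) (simp add: inner_complex_def)
    qed auto
    then show normal: "converges_in_distr M \<T> (distr (normal_law 0 ((poly b 0 / poly a 0)\<^sup>2 * \<sigma>\<^sup>2)) borel complex_of_real) at_top"
      by (simp add: r_def)
    assume nondegenerate: "poly b 0 \<noteq> 0 \<and> \<sigma>\<^sup>2 > 0"
    \<comment> \<open>Stability excludes \<open>0\<close> as an eigenvalue, hence as a root of
      \<open>a\<close>.\<close>
    have "poly a 0 \<noteq> 0"
    proof
      assume "poly a 0 = 0"
      then have "poly (map_poly complex_of_real a) 0 = 0" by (simp add: poly_0_coeff_0 coeff_map_poly)
      then show False using eigenvalues[OF root_imp_eigenvalue[OF a A]] by fastforce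
    qed
    then have r: "r \<noteq> 0" using nondegenerate by (simp add: r_def)
    have \<sigma>: "\<sigma> \<noteq> 0" using nondegenerate by auto
    let ?f = "\<lambda>z. 1 / \<sigma>\<^sup>2 * (cmod (complex_of_real (poly a 0) * z / complex_of_real (poly b 0)))\<^sup>2"
    have "converges_in_distr M (\<lambda>T w. ?f (\<T> T w)) (distr ?\<mu> borel ?f) at_top"
      using normal meas unfolding r_def
      by (intro converges_in_distr_comp[of M \<T>]) (auto intro!: continuous_intros simp: nondegenerate \<sigma>)
    \<comment> \<open>On the real axis \<open>?f\<close> is the square divided by
      \<open>r\<^sup>2 * \<sigma>\<^sup>2\<close>, the variance of the limit.\<close>
    also have "distr ?\<mu> borel ?f = distr (normal_law 0 (r\<^sup>2 * \<sigma>\<^sup>2)) borel (\<lambda>x. 1 / (r\<^sup>2 * \<sigma>\<^sup>2) * x\<^sup>2)"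
    proof (subst distr_distr[OF _ of_real_meas])
      show "?f \<in> borel_measurable borel"
        by (intro borel_measurable_continuous_onI continuous_intros) (simp_all add: nondegenerate \<sigma>)
      show "distr (normal_law 0 (r\<^sup>2 * \<sigma>\<^sup>2)) borel (?f \<circ> complex_of_real) =
          distr (normal_law 0 (r\<^sup>2 * \<sigma>\<^sup>2)) borel (\<lambda>x. 1 / (r\<^sup>2 * \<sigma>\<^sup>2) * x\<^sup>2)"
        by (intro distr_cong) (auto simp: norm_mult norm_divide power_mult_distrib power_divide r_def)
    qed
    also have "\<dots> = chi_squared_law 1"
      using r nondegenerate by (intro distr_square_normal_law) auto
    finally show "converges_in_distr M (\<lambda>T w. ?f (\<T> T w)) (chi_squared_law 1) at_top" .
  qed
qed

end
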